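(* Let $A_i=T(a_i)+K_i\in\mathcal{QT}$ be positive definite (so that $a_i>0$), for $i=1,\ldots,p$. There exists a unique positive definite solution $X\in\mathcal B(\ell^2)$ of the equation $$\sum_{i=1}^p\log(X^{-1/2}A_iX^{-1/2})=0,$$ and $X=T(g)+K_G\in\mathcal{QT}$ with $K_G$ compact, where $g=(a_1\cdots a_p)^{1/p}$.
   Context: $\ell^2$ is the complex Hilbert space of square-summable sequences indexed by the positive integers. $C_{2\pi}$ is the set of continuous $a:[0,2\pi]\to\mathbb C$ with $a(0)=a(2\pi)$. For $a\in C_{2\pi}$ with Fourier series $\sum_{k}a_ke^{\mathrm{i}kt}$, $T(a)$ is the bounded operator on $\ell^2$ with matrix $(T(a))_{i,j}=a_{j-i}$, $i,j\ge1$. $\mathcal{QT}=\{T(a)+K: a\in C_{2\pi},\ K \text{ compact on }\ell^2\}$ is the $C^*$-subalgebra of $\mathcal B(\ell^2)$ of quasi-Toeplitz matrices; the decomposition $A=T(a)+K$ of $A\in\mathcal{QT}$ is unique. A bounded operator $A$ is positive definite if it is self-adjoint and there is $\gamma>0$ with $v^*Av\ge\gamma\|v\|_2^2$ for all $v\in\ell^2$. Powers and logarithms of positive definite operators are defined by the continuous functional calculus. The solution $X$ is called the Karcher mean of $A_1,\ldots,A_p$. *)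

theory Defs
  imports
    "HOL-Analysis.Analysis"
    "HOL-Computational_Algebra.Polynomial"
begin

section \<open>The complex Hilbert space of square-summable sequences\<close>

text \<open>
  Sequences are indexed by \<^typ>\<open>nat\<close>, starting at 0 instead of 1.  Matrix entries of Toeplitz
  operators depend only on the difference of the indices, so they are not affected by the shift.
\<close>

typedef ell2 = "{x :: nat \<Rightarrow> complex. summable (\<lambda>n. (cmod (x n))\<^sup>2)}"
  morphisms ell2_coord Abs_ell2
  by (rule exI[of _ "\<lambda>_. 0"]) simp

setup_lifting type_definition_ell2

lemma square_summable_add:
  fixes x y :: "nat \<Rightarrow> complex"
  assumes "summable (\<lambda>n. (cmod (x n))\<^sup>2)" and "summable (\<lambda>n. (cmod (y n))\<^sup>2)"
  shows "summable (\<lambda>n. (cmod (x n + y n))\<^sup>2)"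
proof (rule summable_comparison_test')
  show "summable (\<lambda>n. 2 * (cmod (x n))\<^sup>2 + 2 * (cmod (y n))\<^sup>2)"
    using assms by (intro summable_add summable_mult)
  show "norm ((cmod (x n + y n))\<^sup>2) \<le> 2 * (cmod (x n))\<^sup>2 + 2 * (cmod (y n))\<^sup>2"
    if "0 \<le> n" for n
  proof -
    have "(cmod (x n + y n))\<^sup>2 \<le> (cmod (x n) + cmod (y n))\<^sup>2"
      by (intro power_mono norm_triangle_ineq) simp
    also have "\<dots> \<le> 2 * (cmod (x n))\<^sup>2 + 2 * (cmod (y n))\<^sup>2"
      using sum_squares_bound[of "cmod (x n)" "cmod (y n)"] by (simp add: power2_sum)
    finally show ?thesis by simp
  qed
qed

lemma square_summable_scale:
  fixes x :: "nat \<Rightarrow> complex"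
  assumes "summable (\<lambda>n. (cmod (x n))\<^sup>2)"
  shows "summable (\<lambda>n. (cmod (c * x n))\<^sup>2)"
  using assms by (simp add: norm_mult power_mult_distrib summable_mult)

lemma square_summable_cinner:
  fixes x y :: "nat \<Rightarrow> complex"
  assumes "summable (\<lambda>n. (cmod (x n))\<^sup>2)" and "summable (\<lambda>n. (cmod (y n))\<^sup>2)"
  shows "summable (\<lambda>n. cnj (x n) * y n)"
proof (rule summable_comparison_test')
  show "summable (\<lambda>n. (cmod (x n))\<^sup>2 + (cmod (y n))\<^sup>2)"
    using assms by (rule summable_add)
  show "norm (cnj (x n) * y n) \<le> (cmod (x n))\<^sup>2 + (cmod (y n))\<^sup>2" if "0 \<le> n" for n
  proof -
    have "0 \<le> cmod (x n) * cmod (y n)" by simp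
    with sum_squares_bound[of "cmod (x n)" "cmod (y n)"]
    have "cmod (x n) * cmod (y n) \<le> (cmod (x n))\<^sup>2 + (cmod (y n))\<^sup>2" by linarith
    then show ?thesis by (simp add: norm_mult)
  qed
qed

instantiation ell2 :: real_vector
begin

lift_definition zero_ell2 :: ell2 is "\<lambda>_. 0" by simp

lift_definition plus_ell2 :: "ell2 \<Rightarrow> ell2 \<Rightarrow> ell2" is "\<lambda>x y n. x n + y n"
  by (rule square_summable_add)

lift_definition uminus_ell2 :: "ell2 \<Rightarrow> ell2" is "\<lambda>x n. - x n" by simp

lift_definition minus_ell2 :: "ell2 \<Rightarrow> ell2 \<Rightarrow> ell2" is "\<lambda>x y n. x n - y n"
  subgoal for x y using square_summable_add[of x "\<lambda>n. - y n"] by simp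
  done

lift_definition scaleR_ell2 :: "real \<Rightarrow> ell2 \<Rightarrow> ell2" is "\<lambda>r x n. complex_of_real r * x n"
  by (rule square_summable_scale)

instance
  by standard (transfer; simp add: algebra_simps)+

end

lift_definition scaleC_ell2 :: "complex \<Rightarrow> ell2 \<Rightarrow> ell2" (infixr \<open>*\<^sub>C\<close> 75)
  is "\<lambda>c x n. c * x n"
  by (rule square_summable_scale)

lift_definition cinner_ell2 :: "ell2 \<Rightarrow> ell2 \<Rightarrow> complex" is "\<lambda>x y. \<Sum>n. cnj (x n) * y n" .

lemma summable_cinner_ell2: "summable (\<lambda>n. cnj (ell2_coord x n) * ell2_coord y n)"
  by (rule square_summable_cinner) (use ell2_coord in auto)

lemma cinner_ell2_commute: "cinner_ell2 y x = cnj (cinner_ell2 x y)"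
proof -
  have "(\<lambda>n. cnj (cnj (ell2_coord x n) * ell2_coord y n)) sums cnj (cinner_ell2 x y)"
    unfolding sums_cnj cinner_ell2.rep_eq by (rule summable_sums[OF summable_cinner_ell2])
  then show ?thesis by (simp add: cinner_ell2.rep_eq sums_iff mult.commute)
qed

lemma cinner_ell2_add_left: "cinner_ell2 (x + y) z = cinner_ell2 x z + cinner_ell2 y z"
  by (simp add: cinner_ell2.rep_eq plus_ell2.rep_eq distrib_right
      suminf_add[OF summable_cinner_ell2 summable_cinner_ell2])

lemma cinner_ell2_scaleR_left: "cinner_ell2 (r *\<^sub>R x) y = complex_of_real r * cinner_ell2 x y"
  by (simp add: cinner_ell2.rep_eq scaleR_ell2.rep_eq mult.assoc
      suminf_mult[OF summable_cinner_ell2])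

lemma square_summable_ell2: "summable (\<lambda>n. (cmod (ell2_coord x n))\<^sup>2)"
  using ell2_coord by auto

lemma cinner_ell2_self: "cinner_ell2 x x = complex_of_real (\<Sum>n. (cmod (ell2_coord x n))\<^sup>2)"
  by (simp add: cinner_ell2.rep_eq suminf_of_real[OF square_summable_ell2]
      complex_norm_square mult.commute del: of_real_power)

instantiation ell2 :: real_inner
begin

definition inner_ell2 :: "ell2 \<Rightarrow> ell2 \<Rightarrow> real" where "inner_ell2 x y = Re (cinner_ell2 x y)"
definition norm_ell2 :: "ell2 \<Rightarrow> real" where "norm_ell2 x = sqrt (\<Sum>n. (cmod (ell2_coord x n))\<^sup>2)"
definition dist_ell2 :: "ell2 \<Rightarrow> ell2 \<Rightarrow> real" where "dist_ell2 x y = norm (x - y)"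
definition sgn_ell2 :: "ell2 \<Rightarrow> ell2" where "sgn_ell2 x = inverse (norm x) *\<^sub>R x"
definition uniformity_ell2 :: "(ell2 \<times> ell2) filter"
  where "uniformity_ell2 = (INF e\<in>{0<..}. principal {(x, y). dist x y < e})"
definition open_ell2 :: "ell2 set \<Rightarrow> bool"
  where "open_ell2 U \<longleftrightarrow> (\<forall>x\<in>U. \<forall>\<^sub>F (x', y) in uniformity. x' = x \<longrightarrow> y \<in> U)"

instance
proof
  fix x y z :: ell2 and r :: real
  show "inner x y = inner y x"
    unfolding inner_ell2_def by (subst cinner_ell2_commute) simp
  show "inner (x + y) z = inner x z + inner y z"
    by (simp add: inner_ell2_def cinner_ell2_add_left)
  show "inner (r *\<^sub>R x) y = r * inner x y"
    by (simp add: inner_ell2_def cinner_ell2_scaleR_left)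
  show "0 \<le> inner x x"
    by (simp add: inner_ell2_def cinner_ell2_self suminf_nonneg[OF square_summable_ell2])
  show "inner x x = 0 \<longleftrightarrow> x = 0"
    by (simp add: inner_ell2_def cinner_ell2_self suminf_eq_zero_iff[OF square_summable_ell2]
        flip: ell2_coord_inject) (simp add: zero_ell2.rep_eq fun_eq_iff)
  show "norm x = sqrt (inner x x)"
    by (simp add: inner_ell2_def cinner_ell2_self norm_ell2_def)
qed (simp_all add: dist_ell2_def sgn_ell2_def uniformity_ell2_def open_ell2_def)

end

lemma norm_scaleC_ell2: "norm (c *\<^sub>C x) = cmod c * norm x"
  by (simp add: norm_ell2_def scaleC_ell2.rep_eq norm_mult power_mult_distrib
      suminf_mult[OF square_summable_ell2] real_sqrt_mult)

lemma scaleC_ell2_add_right: "c *\<^sub>C (x + y) = c *\<^sub>C x + c *\<^sub>C y"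
  by transfer (simp add: algebra_simps)

lemma scaleC_ell2_scaleR: "c *\<^sub>C (r *\<^sub>R x) = r *\<^sub>R (c *\<^sub>C x)"
  by transfer (simp add: algebra_simps)

lemma scaleC_ell2_scaleC: "c *\<^sub>C (d *\<^sub>C x) = (c * d) *\<^sub>C x"
  by transfer (simp add: algebra_simps)

lemma scaleC_ell2_of_real: "complex_of_real r *\<^sub>C x = r *\<^sub>R x"
  by transfer simp

lemma bounded_linear_scaleC_ell2: "bounded_linear (\<lambda>x. c *\<^sub>C x)"
  by (rule bounded_linear_intro[where K = "cmod c"])
     (simp_all add: scaleC_ell2_add_right scaleC_ell2_scaleR norm_scaleC_ell2 mult.commute)

lift_definition ell2_basis :: "nat \<Rightarrow> ell2" is "\<lambda>i n. if n = i then 1 else 0"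
proof -
  fix i :: nat
  have "summable (\<lambda>n. if n = i then 1 else 0 :: real)" by (rule summable_single)
  also have "(\<lambda>n. if n = i then 1 else 0) = (\<lambda>n. (cmod (if n = i then 1 else 0))\<^sup>2)" by auto
  finally show "summable (\<lambda>n. (cmod (if n = i then 1 else 0))\<^sup>2)" .
qed

lemma sum_le_norm_ell2: "(\<Sum>n<N. (cmod (ell2_coord x n))\<^sup>2) \<le> (norm x)\<^sup>2"
  by (simp add: norm_ell2_def suminf_nonneg[OF square_summable_ell2]
      sum_le_suminf[OF square_summable_ell2])

instance ell2 :: complete_space
proof
  fix X :: "nat \<Rightarrow> ell2"
  assume X: "Cauchy X"
  have coord_le: "cmod (ell2_coord x n) \<le> norm x" for x n
  proof -
    have "(cmod (ell2_coord x n))\<^sup>2 \<le> (\<Sum>k<Suc n. (cmod (ell2_coord x k))\<^sup>2)"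
      by (simp add: sum_nonneg)
    also have "\<dots> \<le> (norm x)\<^sup>2" by (rule sum_le_norm_ell2)
    finally show ?thesis by (rule power2_le_imp_le) simp
  qed
  have "Cauchy (\<lambda>m. ell2_coord (X m) n)" for n
  proof (rule CauchyI)
    fix e :: real assume "0 < e"
    with X obtain M where M: "\<And>m k. m \<ge> M \<Longrightarrow> k \<ge> M \<Longrightarrow> norm (X m - X k) < e"
      by (meson CauchyD)
    have "norm (ell2_coord (X m) n - ell2_coord (X k) n) < e" if "m \<ge> M" "k \<ge> M" for m k
      using le_less_trans[OF coord_le[of "X m - X k" n] M[OF that]]
      by (simp add: minus_ell2.rep_eq)
    then show "\<exists>M. \<forall>m\<ge>M. \<forall>k\<ge>M. norm (ell2_coord (X m) n - ell2_coord (X k) n) < e"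
      by blast
  qed
  then have "\<exists>l. \<forall>n. (\<lambda>m. ell2_coord (X m) n) \<longlonglongrightarrow> l n"
    by (intro choice allI) (simp add: Cauchy_convergent_iff convergent_def)
  then obtain l where l: "\<And>n. (\<lambda>m. ell2_coord (X m) n) \<longlonglongrightarrow> l n" by blast
  have tail: "\<exists>M. \<forall>m\<ge>M. \<forall>N. (\<Sum>n<N. (cmod (ell2_coord (X m) n - l n))\<^sup>2) \<le> e\<^sup>2"
    if "0 < e" for e :: real
  proof -
    from X that obtain M where M: "\<And>m k. m \<ge> M \<Longrightarrow> k \<ge> M \<Longrightarrow> norm (X m - X k) < e"
      by (meson CauchyD)
    have "(\<Sum>n<N. (cmod (ell2_coord (X m) n - l n))\<^sup>2) \<le> e\<^sup>2" if "m \<ge> M" for m N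
    proof (rule LIMSEQ_le_const2)
      show "(\<lambda>k. \<Sum>n<N. (cmod (ell2_coord (X m) n - ell2_coord (X k) n))\<^sup>2)
              \<longlonglongrightarrow> (\<Sum>n<N. (cmod (ell2_coord (X m) n - l n))\<^sup>2)"
        by (intro tendsto_intros l)
      show "\<exists>K. \<forall>k\<ge>K. (\<Sum>n<N. (cmod (ell2_coord (X m) n - ell2_coord (X k) n))\<^sup>2) \<le> e\<^sup>2"
      proof (intro exI[of _ M] allI impI)
        fix k assume "k \<ge> M"
        have "(\<Sum>n<N. (cmod (ell2_coord (X m - X k) n))\<^sup>2) \<le> (norm (X m - X k))\<^sup>2"
          by (rule sum_le_norm_ell2)
        also have "\<dots> \<le> e\<^sup>2"
          using M[OF \<open>m \<ge> M\<close> \<open>k \<ge> M\<close>] by (intro power_mono) auto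
        finally show "(\<Sum>n<N. (cmod (ell2_coord (X m) n - ell2_coord (X k) n))\<^sup>2) \<le> e\<^sup>2"
          by (simp add: minus_ell2.rep_eq)
      qed
    qed
    then show ?thesis by blast
  qed
  have diff_summable: "summable (\<lambda>n. (cmod (ell2_coord (X m) n - l n))\<^sup>2)"
    if "\<forall>N. (\<Sum>n<N. (cmod (ell2_coord (X m) n - l n))\<^sup>2) \<le> B" for m B
    by (rule bounded_imp_summable[where B = B])
       (simp_all add: that del: sum.lessThan_Suc flip: lessThan_Suc_atMost)
  from tail[of 1] obtain m where "\<forall>N. (\<Sum>n<N. (cmod (ell2_coord (X m) n - l n))\<^sup>2) \<le> 1\<^sup>2"
    by auto
  from diff_summable[OF this]
  have "summable (\<lambda>n. (cmod (l n - ell2_coord (X m) n))\<^sup>2)" by (simp add: norm_minus_commute)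
  from square_summable_add[OF this square_summable_ell2[of "X m"]]
  have "summable (\<lambda>n. (cmod (l n))\<^sup>2)" by simp
  then have L: "ell2_coord (Abs_ell2 l) = l" by (simp add: Abs_ell2_inverse)
  have "X \<longlonglongrightarrow> Abs_ell2 l"
  proof (rule LIMSEQ_I)
    fix e :: real assume "0 < e"
    with tail[of "e / 2"] obtain M
      where M: "\<And>m N. m \<ge> M \<Longrightarrow> (\<Sum>n<N. (cmod (ell2_coord (X m) n - l n))\<^sup>2) \<le> (e / 2)\<^sup>2"
      by auto
    have "norm (X m - Abs_ell2 l) < e" if "m \<ge> M" for m
    proof -
      have "(\<Sum>n. (cmod (ell2_coord (X m) n - l n))\<^sup>2) \<le> (e / 2)\<^sup>2"
        using M[OF that] by (intro suminf_le_const diff_summable) auto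
      then have "sqrt (\<Sum>n. (cmod (ell2_coord (X m) n - l n))\<^sup>2) \<le> e / 2"
        using \<open>0 < e\<close> by (intro real_le_lsqrt) auto
      then have "norm (X m - Abs_ell2 l) \<le> e / 2"
        unfolding norm_ell2_def minus_ell2.rep_eq L .
      with \<open>0 < e\<close> show ?thesis by simp
    qed
    then show "\<exists>M. \<forall>m\<ge>M. norm (X m - Abs_ell2 l) < e" by blast
  qed
  then show "convergent X" by (rule convergentI)
qed

instance ell2 :: banach ..

instance ell2 :: perfect_space
proof
  fix x :: ell2
  have "ell2_basis 0 \<noteq> 0"
    by (auto simp: ell2_basis.rep_eq zero_ell2.rep_eq fun_eq_iff simp flip: ell2_coord_inject)
  then have n: "norm (ell2_basis 0) > 0" by simp
  show "\<not> open {x}"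
  proof
    assume "open {x}"
    then obtain e where e: "e > 0" "\<And>y. dist y x < e \<Longrightarrow> y = x"
      by (auto simp: open_dist)
    define y where "y = x + (e / (2 * norm (ell2_basis 0))) *\<^sub>R ell2_basis 0"
    have "dist y x < e" using n e(1) by (simp add: y_def dist_norm)
    then have "y = x" by (rule e(2))
    then show False using n e(1) by (simp add: y_def)
  qed
qed


lifting_forget ell2.lifting


section \<open>The Banach algebra of bounded complex-linear operators\<close>

typedef ell2_op = "{A :: ell2 \<Rightarrow>\<^sub>L ell2. \<forall>c x. blinfun_apply A (c *\<^sub>C x) = c *\<^sub>C blinfun_apply A x}"
  morphisms blinfun_of_op Abs_ell2_op
  by (rule exI[of _ id_blinfun]) simp

setup_lifting type_definition_ell2_op

lift_definition op_apply :: "ell2_op \<Rightarrow> ell2 \<Rightarrow> ell2" (infixr \<open>\<bullet>\<^sub>v\<close> 74) is blinfun_apply .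

lemma op_eqI: "(\<And>x. A \<bullet>\<^sub>v x = B \<bullet>\<^sub>v x) \<Longrightarrow> A = B"
  by transfer (rule blinfun_eqI)

instantiation ell2_op :: real_normed_algebra_1
begin

lift_definition zero_ell2_op :: ell2_op is "0 :: ell2 \<Rightarrow>\<^sub>L ell2"
  by (simp add: linear_0[OF bounded_linear.linear[OF bounded_linear_scaleC_ell2]])

lift_definition plus_ell2_op :: "ell2_op \<Rightarrow> ell2_op \<Rightarrow> ell2_op" is "(+)"
  by (simp add: blinfun.add_left scaleC_ell2_add_right)

lift_definition uminus_ell2_op :: "ell2_op \<Rightarrow> ell2_op" is uminus
  by (simp add: blinfun.minus_left linear_neg[OF bounded_linear.linear[OF bounded_linear_scaleC_ell2]])

lift_definition minus_ell2_op :: "ell2_op \<Rightarrow> ell2_op \<Rightarrow> ell2_op" is "(-)"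
  by (simp add: blinfun.diff_left linear_diff[OF bounded_linear.linear[OF bounded_linear_scaleC_ell2]])

lift_definition scaleR_ell2_op :: "real \<Rightarrow> ell2_op \<Rightarrow> ell2_op" is "scaleR"
  by (simp add: blinfun.scaleR_left scaleC_ell2_scaleR)

lift_definition one_ell2_op :: ell2_op is id_blinfun by simp

lift_definition times_ell2_op :: "ell2_op \<Rightarrow> ell2_op \<Rightarrow> ell2_op" is blinfun_compose by simp

lift_definition norm_ell2_op :: "ell2_op \<Rightarrow> real" is norm .

definition dist_ell2_op :: "ell2_op \<Rightarrow> ell2_op \<Rightarrow> real" where "dist_ell2_op A B = norm (A - B)"
definition sgn_ell2_op :: "ell2_op \<Rightarrow> ell2_op" where "sgn_ell2_op A = inverse (norm A) *\<^sub>R A"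
definition uniformity_ell2_op :: "(ell2_op \<times> ell2_op) filter"
  where "uniformity_ell2_op = (INF e\<in>{0<..}. principal {(A, B). dist A B < e})"
definition open_ell2_op :: "ell2_op set \<Rightarrow> bool"
  where "open_ell2_op U \<longleftrightarrow> (\<forall>A\<in>U. \<forall>\<^sub>F (A', B) in uniformity. A' = A \<longrightarrow> B \<in> U)"

instance
proof
  fix A B C :: ell2_op and r s :: real
  show "A + B + C = A + (B + C)" by transfer (simp add: algebra_simps)
  show "A + B = B + A" by transfer (simp add: algebra_simps)
  show "0 + A = A" by transfer simp
  show "- A + A = 0" by transfer simp
  show "A - B = A + - B" by transfer simp
  show "r *\<^sub>R (A + B) = r *\<^sub>R A + r *\<^sub>R B" by transfer (simp add: algebra_simps)
  show "(r + s) *\<^sub>R A = r *\<^sub>R A + s *\<^sub>R A" by transfer (simp add: algebra_simps)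
  show "r *\<^sub>R s *\<^sub>R A = (r * s) *\<^sub>R A" by transfer simp
  show "1 *\<^sub>R A = A" by transfer simp
  show "A * B * C = A * (B * C)" by transfer (simp add: blinfun_eqI)
  show "(A + B) * C = A * C + B * C" by transfer (simp add: blinfun_eqI blinfun.add_left)
  show "A * (B + C) = A * B + A * C"
    by transfer (simp add: blinfun_eqI blinfun.add_left blinfun.add_right)
  show "r *\<^sub>R A * B = r *\<^sub>R (A * B)" by transfer (simp add: blinfun_eqI blinfun.scaleR_left)
  show "A * r *\<^sub>R B = r *\<^sub>R (A * B)"
    by transfer (simp add: blinfun_eqI blinfun.scaleR_left blinfun.scaleR_right)
  show "1 * A = A" by transfer (simp add: blinfun_eqI)
  show "A * 1 = A" by transfer (simp add: blinfun_eqI)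
  show "norm A = 0 \<longleftrightarrow> A = 0" by transfer simp
  show "norm (A + B) \<le> norm A + norm B" by transfer (rule norm_triangle_ineq)
  show "norm (r *\<^sub>R A) = \<bar>r\<bar> * norm A" by transfer simp
  show "norm (A * B) \<le> norm A * norm B" by transfer (rule norm_blinfun_compose)
  show norm_one: "norm (1 :: ell2_op) = 1" by transfer (rule norm_blinfun_id)
  show "(0 :: ell2_op) \<noteq> 1" using norm_one by (metis norm_blinfun_id norm_zero one_ell2_op.rep_eq zero_ell2_op.rep_eq zero_neq_one)
qed (simp_all add: dist_ell2_op_def sgn_ell2_op_def uniformity_ell2_op_def open_ell2_op_def)

end

instance ell2_op :: banach
proof
  fix A :: "nat \<Rightarrow> ell2_op"
  assume A: "Cauchy A"
  have dist_rep: "dist (blinfun_of_op S) (blinfun_of_op T) = dist S T" for S T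
    by (simp add: dist_norm norm_ell2_op.rep_eq minus_ell2_op.rep_eq)
  have "Cauchy (\<lambda>n. blinfun_of_op (A n))"
    using A by (simp add: Cauchy_def dist_rep)
  then obtain B where B: "(\<lambda>n. blinfun_of_op (A n)) \<longlonglongrightarrow> B"
    using Cauchy_convergent convergent_def by blast
  have "blinfun_apply B (c *\<^sub>C x) = c *\<^sub>C blinfun_apply B x" for c x
  proof (rule LIMSEQ_unique)
    have pt: "(\<lambda>n. blinfun_apply (blinfun_of_op (A n)) y) \<longlonglongrightarrow> blinfun_apply B y" for y
      by (intro tendsto_intros B)
    show "(\<lambda>n. blinfun_apply (blinfun_of_op (A n)) (c *\<^sub>C x)) \<longlonglongrightarrow> blinfun_apply B (c *\<^sub>C x)"
      by (rule pt)
    have "(\<lambda>n. c *\<^sub>C blinfun_apply (blinfun_of_op (A n)) x) \<longlonglongrightarrow> c *\<^sub>C blinfun_apply B x"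
      by (rule bounded_linear.tendsto[OF bounded_linear_scaleC_ell2 pt])
    then show "(\<lambda>n. blinfun_apply (blinfun_of_op (A n)) (c *\<^sub>C x)) \<longlonglongrightarrow> c *\<^sub>C blinfun_apply B x"
      using blinfun_of_op by simp
  qed
  then have "blinfun_of_op (Abs_ell2_op B) = B" by (simp add: Abs_ell2_op_inverse)
  then have "A \<longlonglongrightarrow> Abs_ell2_op B"
    using B by (simp add: tendsto_iff flip: dist_rep)
  then show "convergent A" by (rule convergentI)
qed

lift_definition scaleC_op :: "complex \<Rightarrow> ell2_op \<Rightarrow> ell2_op"
  is "\<lambda>c A. blinfun_compose (Blinfun (\<lambda>x. c *\<^sub>C x)) A"
  by (simp add: bounded_linear_Blinfun_apply[OF bounded_linear_scaleC_ell2]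
      scaleC_ell2_scaleC mult.commute)

lemma op_apply_scaleC: "scaleC_op c A \<bullet>\<^sub>v x = c *\<^sub>C (A \<bullet>\<^sub>v x)"
  by transfer (simp add: bounded_linear_Blinfun_apply[OF bounded_linear_scaleC_ell2])

definition op_entry :: "ell2_op \<Rightarrow> nat \<Rightarrow> nat \<Rightarrow> complex" where
  "op_entry A i j = cinner_ell2 (ell2_basis i) (A \<bullet>\<^sub>v ell2_basis j)"

definition compact_op :: "ell2_op \<Rightarrow> bool" where
  "compact_op K \<longleftrightarrow> compact (closure ((\<lambda>x. K \<bullet>\<^sub>v x) ` cball 0 1))"

definition selfadjoint_op :: "ell2_op \<Rightarrow> bool" where
  "selfadjoint_op A \<longleftrightarrow> (\<forall>x y. cinner_ell2 x (A \<bullet>\<^sub>v y) = cinner_ell2 (A \<bullet>\<^sub>v x) y)"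

text \<open>
  For self-adjoint \<open>A\<close> the quadratic form is real, so taking its real part loses nothing.
\<close>

definition posdef_op :: "ell2_op \<Rightarrow> bool" where
  "posdef_op A \<longleftrightarrow> selfadjoint_op A \<and>
     (\<exists>\<gamma>>0. \<forall>v. Re (cinner_ell2 v (A \<bullet>\<^sub>v v)) \<ge> \<gamma> * (norm v)\<^sup>2)"


section \<open>Continuous functional calculus\<close>

definition op_spectrum :: "ell2_op \<Rightarrow> complex set" where
  "op_spectrum A = {z. \<not> (\<exists>B. (A - scaleC_op z 1) * B = 1 \<and> B * (A - scaleC_op z 1) = 1)}"

definition poly_op :: "complex poly \<Rightarrow> ell2_op \<Rightarrow> ell2_op" where
  "poly_op p A = (\<Sum>k\<le>degree p. scaleC_op (coeff p k) (A ^ k))"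

text \<open>
  For self-adjoint \<open>A\<close> and \<open>f\<close> continuous on the spectrum of \<open>A\<close>, the operator \<open>f(A)\<close> is the
  norm limit of \<open>p\<^sub>n(A)\<close> for any sequence of polynomials \<open>p\<^sub>n\<close> that converges to \<open>f\<close> uniformly on
  the spectrum.  Outside that setting the value is unspecified.
\<close>

definition op_fun :: "(complex \<Rightarrow> complex) \<Rightarrow> ell2_op \<Rightarrow> ell2_op" where
  "op_fun f A = (THE B. \<forall>p. uniform_limit (op_spectrum A) (\<lambda>n. poly (p n)) f sequentially
                        \<longrightarrow> (\<lambda>n. poly_op (p n) A) \<longlonglongrightarrow> B)"

text \<open>
  The spectrum of a positive definite operator lies in the positive reals, where the principal
  branches of the complex power and logarithm are the real ones.
\<close>

definition op_powr :: "ell2_op \<Rightarrow> real \<Rightarrow> ell2_op" where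
  "op_powr A s = op_fun (\<lambda>z. z powr complex_of_real s) A"

definition op_log :: "ell2_op \<Rightarrow> ell2_op" where
  "op_log A = op_fun Ln A"


section \<open>Quasi-Toeplitz operators\<close>

text \<open>
  Symbols are functions on the reals of which only the values on \<open>[0, 2\<pi>]\<close> matter.
\<close>

definition C2pi :: "(real \<Rightarrow> complex) set" where
  "C2pi = {a. continuous_on {0..2 * pi} a \<and> a 0 = a (2 * pi)}"

definition fourier_coeff :: "(real \<Rightarrow> complex) \<Rightarrow> int \<Rightarrow> complex" where
  "fourier_coeff a k =
     integral {0..2 * pi} (\<lambda>t. a t * exp (- (\<i> * of_int k * complex_of_real t))) / (2 * pi)"

definition toeplitz :: "(real \<Rightarrow> complex) \<Rightarrow> ell2_op" where
  "toeplitz a = (THE A. \<forall>i j. op_entry A i j = fourier_coeff a (int j - int i))"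

definition quasi_toeplitz :: "ell2_op set" where
  "quasi_toeplitz = {toeplitz a + K | a K. a \<in> C2pi \<and> compact_op K}"


section \<open>Karcher mean\<close>

definition is_karcher_mean :: "nat \<Rightarrow> (nat \<Rightarrow> ell2_op) \<Rightarrow> ell2_op \<Rightarrow> bool" where
  "is_karcher_mean p A X \<longleftrightarrow> posdef_op X \<and>
     (\<Sum>i=1..p. op_log (op_powr X (- 1 / 2) * A i * op_powr X (- 1 / 2))) = 0"

text \<open>
  The principal power agrees with the positive real root when the symbols are positive.
\<close>

definition geo_mean_symbol :: "nat \<Rightarrow> (nat \<Rightarrow> real \<Rightarrow> complex) \<Rightarrow> real \<Rightarrow> complex" where
  "geo_mean_symbol p a = (\<lambda>t. (\<Prod>i=1..p. a i t) powr (1 / of_nat p))"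

end

theory Submission
  imports Defs "HOL-Computational_Algebra.Fundamental_Theorem_Algebra"
begin

text \<open>
  Let \<open>d(X, Y) = \<parallel>log (X\<^sup>-\<^sup>1\<^sup>/\<^sup>2 Y X\<^sup>-\<^sup>1\<^sup>/\<^sup>2)\<parallel>\<close> be the Thompson metric and, for \<open>s = 2\<^sup>-\<^sup>n\<close>, let \<open>F\<^sub>n X\<close> be the
  arithmetic mean of the weighted geometric means \<open>X #\<^sub>s A\<^sub>i\<close>.  Since \<open>X #\<^sub>s A\<close> arises by iterating
  the monotone and homogeneous mean \<open>X # A\<close>, the map \<open>F\<^sub>n\<close> contracts \<open>d\<close> by the factor \<open>1 - s\<close>.
  If \<open>B\<^sub>i = X\<^sup>-\<^sup>1\<^sup>/\<^sup>2 A\<^sub>i X\<^sup>-\<^sup>1\<^sup>/\<^sup>2\<close>, then \<open>B\<^sub>i\<^sup>s = 1 + s log B\<^sub>i + O(s\<^sup>2)\<close>, so \<open>d(F\<^sub>n X, X) = O(s\<^sup>2)\<close> for a solution \<open>X\<close>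
  of the Karcher equation.  Two solutions therefore have distance at most \<open>(1 - s) d + O(s\<^sup>2)\<close>, and
  \<open>s \<longlongrightarrow> 0\<close> gives uniqueness.  The fixed points \<open>X\<^sub>n\<close> of \<open>F\<^sub>n\<close> satisfy \<open>d(X\<^sub>m, X\<^sub>n) = O(2\<^sup>-\<^sup>m + 2\<^sup>-\<^sup>n)\<close> by the same
  expansion, and their limit solves the equation.  All limits are limits in norm, so the solution
  stays in the closed algebra of quasi-Toeplitz operators, and its symbol is found by evaluating
  the equation at the characters \<open>T(a) + K \<mapsto> a(t)\<close>.
\<close>

section \<open>Bounded operators and their order\<close>

text \<open>What drives the metric argument is a comparison of orders. Applying \<open>F n\<close>
  gains a term of order \<open>s\<close> in the distance, and at a general operator it also moves by
  order \<open>s\<close>. At a solution the first-order term cancels and the movement has order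
  \<open>s\<^sup>2\<close>; dividing by the gain \<open>s\<close> still leaves a bound that vanishes
  with \<open>s\<close>.

  The weights are dyadic because the square root is the one power whose operator monotonicity is
  proved, by comparing squares. The mean \<open>A # B\<close> is the unique positive definite
  solution \<open>X\<close> of the Riccati equation \<open>X * op_powr A (- 1) * X = B\<close>. This
  equation exposes the symmetry in \<open>A\<close> and \<open>B\<close>, and symmetry turns
  monotonicity in one argument into monotonicity in both.

  Uniqueness ranges over all bounded operators while the iteration stays inside the algebra, which
  places the only solution there. On the Toeplitz side the obstacle is that the splitting into
  symbol and compact part has to survive norm limits; it does because the value of the symbol at
  each point is bounded by the norm of the whole operator.\<close>

lemma op_apply_mult [simp]: "(A * B) \<bullet>\<^sub>v x = A \<bullet>\<^sub>v B \<bullet>\<^sub>v x"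
  by transfer simp

lemma op_apply_plus [simp]: "(A + B) \<bullet>\<^sub>v x = A \<bullet>\<^sub>v x + B \<bullet>\<^sub>v x"
  by transfer (simp add: blinfun.add_left)

lemma op_apply_minus [simp]: "(A - B) \<bullet>\<^sub>v x = A \<bullet>\<^sub>v x - B \<bullet>\<^sub>v x"
  by transfer (simp add: blinfun.diff_left)

lemma op_apply_uminus [simp]: "(- A) \<bullet>\<^sub>v x = - (A \<bullet>\<^sub>v x)"
  by transfer (simp add: blinfun.minus_left)

lemma op_apply_scaleR [simp]: "(r *\<^sub>R A) \<bullet>\<^sub>v x = r *\<^sub>R (A \<bullet>\<^sub>v x)"
  by transfer (simp add: blinfun.scaleR_left)

lemma op_apply_one [simp]: "1 \<bullet>\<^sub>v x = x"
  by transfer simp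

lemma op_apply_zero [simp]: "0 \<bullet>\<^sub>v x = 0"
  by transfer simp

lemma op_apply_add_right [simp]: "A \<bullet>\<^sub>v (x + y) = A \<bullet>\<^sub>v x + A \<bullet>\<^sub>v y"
  by transfer (simp add: blinfun.add_right)

lemma op_apply_diff_right [simp]: "A \<bullet>\<^sub>v (x - y) = A \<bullet>\<^sub>v x - A \<bullet>\<^sub>v y"
  by transfer (simp add: blinfun.diff_right)

lemma op_apply_scaleR_right [simp]: "A \<bullet>\<^sub>v (r *\<^sub>R x) = r *\<^sub>R (A \<bullet>\<^sub>v x)"
  by transfer (simp add: blinfun.scaleR_right)

lemma op_apply_zero_right [simp]: "A \<bullet>\<^sub>v 0 = 0"
  by transfer simp

lemma op_apply_scaleC_right [simp]: "A \<bullet>\<^sub>v (c *\<^sub>C x) = c *\<^sub>C (A \<bullet>\<^sub>v x)"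
  by transfer simp

lemma op_apply_sum_right: "A \<bullet>\<^sub>v (\<Sum>i\<in>I. x i) = (\<Sum>i\<in>I. A \<bullet>\<^sub>v x i)"
  by (induction I rule: infinite_finite_induct) auto

lemma norm_op_apply: "norm (A \<bullet>\<^sub>v x) \<le> norm A * norm x"
  by transfer (rule norm_blinfun)

lemma norm_op_bound: "0 \<le> c \<Longrightarrow> (\<And>x. norm (A \<bullet>\<^sub>v x) \<le> c * norm x) \<Longrightarrow> norm A \<le> c"
  by transfer (rule norm_blinfun_bound)

declare op_apply_scaleC [simp]

lemma bounded_linear_op_apply: "bounded_linear (\<lambda>A. A \<bullet>\<^sub>v x)"
  by (rule bounded_linear_intro[where K = "norm x"])
     (use norm_op_apply in auto)

lemma bounded_linear_op_apply_right: "bounded_linear (\<lambda>x. A \<bullet>\<^sub>v x)"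
  by (rule bounded_linear_intro[where K = "norm A"])
     (use norm_op_apply in \<open>auto simp: mult.commute\<close>)

lemmas tendsto_op_apply = bounded_linear.tendsto[OF bounded_linear_op_apply]
lemmas tendsto_op_apply_right = bounded_linear.tendsto[OF bounded_linear_op_apply_right]

section \<open>Complex scalars and the complex inner product\<close>

lemma scaleC_ell2_add_left: "(c + d) *\<^sub>C x = c *\<^sub>C x + d *\<^sub>C x"
  by (simp flip: ell2_coord_inject add: scaleC_ell2.rep_eq plus_ell2.rep_eq algebra_simps)

lemma scaleC_ell2_diff_left: "(c - d) *\<^sub>C x = c *\<^sub>C x - d *\<^sub>C x"
  by (simp flip: ell2_coord_inject add: scaleC_ell2.rep_eq minus_ell2.rep_eq algebra_simps)

lemma scaleC_ell2_diff_right: "c *\<^sub>C (x - y) = c *\<^sub>C x - c *\<^sub>C y"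
  by (simp flip: ell2_coord_inject add: scaleC_ell2.rep_eq minus_ell2.rep_eq algebra_simps)

lemma scaleC_ell2_one [simp]: "1 *\<^sub>C x = x"
  by (simp flip: ell2_coord_inject add: scaleC_ell2.rep_eq)

lemma scaleC_ell2_zero [simp]: "0 *\<^sub>C x = 0" "c *\<^sub>C 0 = 0"
  by (simp_all flip: ell2_coord_inject add: scaleC_ell2.rep_eq zero_ell2.rep_eq)

lemma cinner_ell2_scaleC_right: "cinner_ell2 x (c *\<^sub>C y) = c * cinner_ell2 x y"
proof -
  have "cinner_ell2 x (c *\<^sub>C y) = (\<Sum>n. c * (cnj (ell2_coord x n) * ell2_coord y n))"
    by (simp add: cinner_ell2.rep_eq scaleC_ell2.rep_eq mult_ac)
  then show ?thesis
    by (simp add: suminf_mult[OF summable_cinner_ell2] cinner_ell2.rep_eq)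
qed

lemma cinner_ell2_scaleC_left: "cinner_ell2 (c *\<^sub>C x) y = cnj c * cinner_ell2 x y"
  by (subst (1 2) cinner_ell2_commute) (simp add: cinner_ell2_scaleC_right)

lemma cinner_ell2_add_right: "cinner_ell2 x (y + z) = cinner_ell2 x y + cinner_ell2 x z"
  by (subst (1 2 3) cinner_ell2_commute) (simp add: cinner_ell2_add_left)

lemma Im_cinner_ell2: "Im (cinner_ell2 x y) = - (x \<bullet> (\<i> *\<^sub>C y))"
  by (simp add: inner_ell2_def cinner_ell2_scaleC_right)

text \<open>Multiplying \<open>y\<close> by \<open>cnj c\<close> makes the form real and
  nonnegative, so the real Cauchy-Schwarz inequality applies.\<close>

lemma norm_cinner_ell2_le: "norm (cinner_ell2 x y) \<le> norm x * norm y"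
proof -
  define c where "c = cinner_ell2 x y"
  have "(cmod c)\<^sup>2 = Re (cinner_ell2 x (cnj c *\<^sub>C y))"
    by (simp only: cinner_ell2_scaleC_right flip: c_def)
       (metis Re_complex_of_real complex_norm_square mult.commute of_real_power)
  also have "\<dots> = x \<bullet> (cnj c *\<^sub>C y)" by (simp add: inner_ell2_def)
  also have "\<dots> \<le> norm x * (cmod c * norm y)"
    using norm_cauchy_schwarz[of x "cnj c *\<^sub>C y"] by (simp add: norm_scaleC_ell2)
  finally have "cmod c * cmod c \<le> cmod c * (norm x * norm y)"
    by (simp add: power2_eq_square mult_ac)
  then show ?thesis
    by (cases "c = 0") (auto simp: c_def)
qed

text \<open>The imaginary part of the form at \<open>y\<close> is, up to sign, a real part at
  \<open>\<i> *\<^sub>C y\<close>. Adjoint relations can therefore be checked with the real inner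
  product alone.\<close>

lemma cinner_ell2_eqI:
  assumes "\<And>x y. x \<bullet> f y = g x \<bullet> y" "\<And>y. f (\<i> *\<^sub>C y) = \<i> *\<^sub>C f y"
  shows "cinner_ell2 x (f y) = cinner_ell2 (g x) y"
proof (rule complex_eqI)
  show "Re (cinner_ell2 x (f y)) = Re (cinner_ell2 (g x) y)"
    using assms(1)[of x y] by (simp add: inner_ell2_def)
  show "Im (cinner_ell2 x (f y)) = Im (cinner_ell2 (g x) y)"
    using assms(1)[of x "\<i> *\<^sub>C y"] by (simp add: Im_cinner_ell2 assms(2))
qed

section \<open>Self-adjoint operators\<close>

lemma selfadjoint_iff_inner:
  "selfadjoint_op A \<longleftrightarrow> (\<forall>x y. x \<bullet> (A \<bullet>\<^sub>v y) = (A \<bullet>\<^sub>v x) \<bullet> y)"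
  using cinner_ell2_eqI[of "\<lambda>x. A \<bullet>\<^sub>v x" "\<lambda>x. A \<bullet>\<^sub>v x"]
  unfolding selfadjoint_op_def by (auto simp: inner_ell2_def)

lemma selfadjointD: "selfadjoint_op A \<Longrightarrow> (A \<bullet>\<^sub>v x) \<bullet> y = x \<bullet> (A \<bullet>\<^sub>v y)"
  by (simp add: selfadjoint_iff_inner)

lemma selfadjoint_one [simp]: "selfadjoint_op 1"
  by (simp add: selfadjoint_iff_inner)

lemma selfadjoint_add: "selfadjoint_op A \<Longrightarrow> selfadjoint_op B \<Longrightarrow> selfadjoint_op (A + B)"
  by (simp add: selfadjoint_iff_inner inner_add_left inner_add_right)

lemma selfadjoint_diff: "selfadjoint_op A \<Longrightarrow> selfadjoint_op B \<Longrightarrow> selfadjoint_op (A - B)"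
  by (simp add: selfadjoint_iff_inner inner_diff_left inner_diff_right)

lemma selfadjoint_scaleR: "selfadjoint_op A \<Longrightarrow> selfadjoint_op (r *\<^sub>R A)"
  by (simp add: selfadjoint_iff_inner)

lemma selfadjoint_square: "selfadjoint_op A \<Longrightarrow> selfadjoint_op (A * A)"
  by (simp add: selfadjoint_iff_inner)

lemma selfadjoint_congruence: "selfadjoint_op A \<Longrightarrow> selfadjoint_op C \<Longrightarrow> selfadjoint_op (C * A * C)"
  by (simp add: selfadjoint_iff_inner)

lemma selfadjoint_LIMSEQ:
  assumes "A \<longlonglongrightarrow> B" "\<And>n. selfadjoint_op (A n)"
  shows "selfadjoint_op B"
  unfolding selfadjoint_iff_inner
proof (intro allI)
  fix x y
  have "(\<lambda>n. x \<bullet> (A n \<bullet>\<^sub>v y)) \<longlonglongrightarrow> x \<bullet> (B \<bullet>\<^sub>v y)" "(\<lambda>n. (A n \<bullet>\<^sub>v x) \<bullet> y) \<longlonglongrightarrow> (B \<bullet>\<^sub>v x) \<bullet> y"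
    by (intro tendsto_intros tendsto_op_apply assms)+
  moreover have "(A n \<bullet>\<^sub>v x) \<bullet> y = x \<bullet> (A n \<bullet>\<^sub>v y)" for n
    using assms(2) by (rule selfadjointD)
  ultimately show "x \<bullet> (B \<bullet>\<^sub>v y) = (B \<bullet>\<^sub>v x) \<bullet> y"
    using LIMSEQ_unique by auto
qed

text \<open>The Loewner order. Only real parts of quadratic forms are compared, so on all operators
  this is a preorder; antisymmetry is proved for self-adjoint ones.\<close>

definition op_le :: "ell2_op \<Rightarrow> ell2_op \<Rightarrow> bool" where
  "op_le A B \<longleftrightarrow> (\<forall>v. v \<bullet> (A \<bullet>\<^sub>v v) \<le> v \<bullet> (B \<bullet>\<^sub>v v))"

lemma op_le_refl [simp]: "op_le A A"
  by (simp add: op_le_def)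

lemma op_le_trans [trans]: "op_le A B \<Longrightarrow> op_le B C \<Longrightarrow> op_le A C"
  unfolding op_le_def by (meson order_trans)

lemma op_le_add: "op_le A B \<Longrightarrow> op_le C D \<Longrightarrow> op_le (A + C) (B + D)"
  by (simp add: op_le_def inner_add_right add_mono)

lemma op_le_sum: "(\<And>i. i \<in> I \<Longrightarrow> op_le (A i) (B i)) \<Longrightarrow> op_le (\<Sum>i\<in>I. A i) (\<Sum>i\<in>I. B i)"
  by (induction I rule: infinite_finite_induct) (auto simp: op_le_add)

lemma op_le_scaleR: "0 \<le> r \<Longrightarrow> op_le A B \<Longrightarrow> op_le (r *\<^sub>R A) (r *\<^sub>R B)"
  by (simp add: op_le_def mult_left_mono)

lemma op_le_scaleR_one: "r \<le> s \<Longrightarrow> op_le (r *\<^sub>R 1) (s *\<^sub>R 1)"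
  by (simp add: op_le_def mult_right_mono)

lemma op_le_scaleR_left: "r \<le> s \<Longrightarrow> op_le 0 A \<Longrightarrow> op_le (r *\<^sub>R A) (s *\<^sub>R A)"
  by (simp add: op_le_def mult_right_mono)

lemma op_le_diff_iff: "op_le 0 (B - A) \<longleftrightarrow> op_le A B"
  by (simp add: op_le_def inner_diff_right)

lemma op_le_congruence: "selfadjoint_op C \<Longrightarrow> op_le A B \<Longrightarrow> op_le (C * A * C) (C * B * C)"
  by (simp add: op_le_def selfadjoint_iff_inner)

lemma op_le_LIMSEQ:
  assumes "A \<longlonglongrightarrow> A'" "B \<longlonglongrightarrow> B'" "\<And>n::nat. op_le (A n) (B n)"
  shows "op_le A' B'"
  unfolding op_le_def
proof
  fix v
  show "v \<bullet> (A' \<bullet>\<^sub>v v) \<le> v \<bullet> (B' \<bullet>\<^sub>v v)"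
  proof (rule LIMSEQ_le)
    show "(\<lambda>n. v \<bullet> (A n \<bullet>\<^sub>v v)) \<longlonglongrightarrow> v \<bullet> (A' \<bullet>\<^sub>v v)" "(\<lambda>n. v \<bullet> (B n \<bullet>\<^sub>v v)) \<longlonglongrightarrow> v \<bullet> (B' \<bullet>\<^sub>v v)"
      by (intro tendsto_intros tendsto_op_apply assms)+
  qed (use assms(3) in \<open>auto simp: op_le_def\<close>)
qed

lemma op_le_norm: "op_le A (norm A *\<^sub>R 1)" "op_le ((- norm A) *\<^sub>R 1) A"
proof -
  have "\<bar>v \<bullet> (A \<bullet>\<^sub>v v)\<bar> \<le> norm A * (v \<bullet> v)" for v
  proof -
    have "\<bar>v \<bullet> (A \<bullet>\<^sub>v v)\<bar> \<le> norm v * norm (A \<bullet>\<^sub>v v)" by (rule Cauchy_Schwarz_ineq2)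
    also have "\<dots> \<le> norm v * (norm A * norm v)" by (intro mult_left_mono norm_op_apply) auto
    finally show ?thesis by (simp add: dot_square_norm power2_eq_square mult_ac)
  qed
  then show "op_le A (norm A *\<^sub>R 1)" "op_le ((- norm A) *\<^sub>R 1) A"
    unfolding op_le_def by (auto simp: abs_le_iff) (metis minus_le_iff)
qed

text \<open>Taking \<open>x\<close> in the direction of \<open>A \<bullet>\<^sub>v y\<close> with
  the length of \<open>y\<close> makes the sum of squares equal to twice the product of the norms.
  Sums of squares are the convenient hypothesis: they come out of the parallelogram law and of
  Parseval's identity.\<close>

lemma norm_op_le_of_form:
  assumes "0 \<le> c" and form: "\<And>x y. x \<bullet> (A \<bullet>\<^sub>v y) \<le> c / 2 * ((norm x)\<^sup>2 + (norm y)\<^sup>2)"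
  shows "norm A \<le> c"
proof (rule norm_op_bound[OF \<open>0 \<le> c\<close>])
  fix y
  show "norm (A \<bullet>\<^sub>v y) \<le> c * norm y"
  proof (cases "A \<bullet>\<^sub>v y = 0")
    case True then show ?thesis using \<open>0 \<le> c\<close> by simp
  next
    case False
    then have "norm y > 0" by auto
    define x where "x = (norm y / norm (A \<bullet>\<^sub>v y)) *\<^sub>R (A \<bullet>\<^sub>v y)"
    have "norm x = norm y" using False by (simp add: x_def)
    moreover have "x \<bullet> (A \<bullet>\<^sub>v y) = norm y * norm (A \<bullet>\<^sub>v y)"
      using False by (simp add: x_def dot_square_norm power2_eq_square)
    ultimately have "norm y * norm (A \<bullet>\<^sub>v y) \<le> norm y * (c * norm y)"
      using form[of x y] by (simp add: power2_eq_square mult_ac)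
    then show ?thesis using \<open>norm y > 0\<close> by simp
  qed
qed

text \<open>Polarization expresses the bilinear form of a self-adjoint operator by its quadratic
  form, and the parallelogram law adds up the two bounds.\<close>

lemma norm_selfadjoint_le:
  assumes A: "selfadjoint_op A" and c: "op_le A (c *\<^sub>R 1)" "op_le ((- c) *\<^sub>R 1) A"
  shows "norm A \<le> c"
proof -
  have q: "\<bar>v \<bullet> (A \<bullet>\<^sub>v v)\<bar> \<le> c * (norm v)\<^sup>2" for v
  proof -
    have "v \<bullet> (A \<bullet>\<^sub>v v) \<le> c * (v \<bullet> v)" "- c * (v \<bullet> v) \<le> v \<bullet> (A \<bullet>\<^sub>v v)"
      using c unfolding op_le_def by (auto dest: spec[of _ v])
    then show ?thesis by (simp add: dot_square_norm abs_le_iff)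
  qed
  \<comment> \<open>The two-sided bound at a single nonzero vector already forces \<open>c\<close>
    to be nonnegative.\<close>
  have "0 \<le> c * (norm (ell2_basis 0))\<^sup>2" using q[of "ell2_basis 0"] by linarith
  moreover have "ell2_basis 0 \<noteq> 0"
    by (auto simp: ell2_basis.rep_eq zero_ell2.rep_eq fun_eq_iff simp flip: ell2_coord_inject)
  ultimately have "0 \<le> c" by (simp add: zero_le_mult_iff)
  show ?thesis
  proof (rule norm_op_le_of_form[OF \<open>0 \<le> c\<close>])
    fix x y
    have "4 * (x \<bullet> (A \<bullet>\<^sub>v y)) = (x + y) \<bullet> (A \<bullet>\<^sub>v (x + y)) - (x - y) \<bullet> (A \<bullet>\<^sub>v (x - y))"
      using selfadjointD[OF A, of x y]
      by (simp add: inner_add_left inner_add_right inner_diff_left inner_diff_right inner_commute)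
    also have "\<dots> \<le> c * ((norm (x + y))\<^sup>2 + (norm (x - y))\<^sup>2)"
      using q[of "x + y"] q[of "x - y"] by (simp add: algebra_simps)
    also have "(norm (x + y))\<^sup>2 + (norm (x - y))\<^sup>2 = 2 * ((norm x)\<^sup>2 + (norm y)\<^sup>2)"
      by (simp add: power2_norm_eq_inner algebra_simps inner_commute)
    finally show "x \<bullet> (A \<bullet>\<^sub>v y) \<le> c / 2 * ((norm x)\<^sup>2 + (norm y)\<^sup>2)"
      by (simp add: algebra_simps)
  qed
qed

lemma op_le_antisym:
  assumes "selfadjoint_op A" "selfadjoint_op B" "op_le A B" "op_le B A"
  shows "A = B"
proof -
  have "norm (A - B) \<le> 0"
    by (rule norm_selfadjoint_le)
       (use assms in \<open>auto simp: selfadjoint_diff op_le_def inner_diff_right\<close>)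
  then show ?thesis by simp
qed

text \<open>Positivity of the form at \<open>v - (1 / M) *\<^sub>R w\<close> gives the claim. It
  turns a small value of a positive form at \<open>v\<close> into a small vector
  \<open>A \<bullet>\<^sub>v v\<close>, that is, it produces approximate eigenvectors.\<close>

lemma norm_positive_op_apply:
  assumes A: "selfadjoint_op A" "op_le 0 A"
  shows "(norm (A \<bullet>\<^sub>v v))\<^sup>2 \<le> norm A * (v \<bullet> (A \<bullet>\<^sub>v v))"
proof (cases "A = 0")
  case False
  define M where "M = norm A"
  then have M: "M > 0" using False by simp
  define w where "w = A \<bullet>\<^sub>v v"
  have "0 \<le> (v - (1 / M) *\<^sub>R w) \<bullet> (A \<bullet>\<^sub>v (v - (1 / M) *\<^sub>R w))"
    using A(2)[unfolded op_le_def, rule_format, of "v - (1 / M) *\<^sub>R w"] by simp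
  also have "\<dots> = v \<bullet> w - 2 * (w \<bullet> w) / M + (w \<bullet> (A \<bullet>\<^sub>v w)) / M\<^sup>2"
    using selfadjointD[OF A(1), of v w] M
    by (simp add: inner_diff_left inner_diff_right w_def[symmetric] power2_eq_square field_simps)
  also have "w \<bullet> (A \<bullet>\<^sub>v w) \<le> M * (w \<bullet> w)"
    using op_le_norm(1)[of A] by (auto simp: op_le_def M_def)
  finally have "0 \<le> v \<bullet> w - 2 * (w \<bullet> w) / M + M * (w \<bullet> w) / M\<^sup>2"
    using M by (simp add: divide_right_mono)
  then have "w \<bullet> w \<le> M * (v \<bullet> w)"
    using M by (simp add: field_simps power2_eq_square)
  then show ?thesis by (simp add: w_def M_def dot_square_norm)
qed simp

lemma posdef_iff:
  "posdef_op A \<longleftrightarrow> selfadjoint_op A \<and> (\<exists>c>0. op_le (c *\<^sub>R 1) A)"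
  by (auto simp: posdef_op_def op_le_def inner_ell2_def[symmetric] dot_square_norm)

section \<open>Invertible operators\<close>

definition op_invertible :: "ell2_op \<Rightarrow> bool" where
  "op_invertible A \<longleftrightarrow> (\<exists>B. A * B = 1 \<and> B * A = 1)"

lemma op_invertible_mult: "op_invertible A \<Longrightarrow> op_invertible B \<Longrightarrow> op_invertible (A * B)"
  unfolding op_invertible_def by (metis mult.assoc mult.right_neutral)

lemma op_invertible_commuting_factor:
  assumes "op_invertible (A * B)" "A * B = B * A"
  shows "op_invertible A"
proof -
  from assms obtain C where C: "A * B * C = 1" "C * (A * B) = 1"
    by (auto simp: op_invertible_def)
  have "A * (B * C) = 1" "(C * B) * A = 1"
    using C by (simp add: mult.assoc) (use C assms(2) in \<open>simp add: mult.assoc\<close>)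
  then have "B * C = C * B"
    by (metis mult.assoc mult.left_neutral mult.right_neutral)
  with \<open>A * (B * C) = 1\<close> \<open>(C * B) * A = 1\<close> show ?thesis
    unfolding op_invertible_def by metis
qed

lemma op_invertible_near_one:
  assumes "norm (R :: ell2_op) < 1"
  shows "op_invertible (1 - R)"
proof -
  have s: "summable (\<lambda>n. R ^ n)"
    by (rule summable_comparison_test'[of "\<lambda>n. norm R ^ n" 0])
       (use assms in \<open>auto simp: norm_power_ineq summable_geometric\<close>)
  define S where "S = (\<Sum>n. R ^ n)"
  have "S = 1 + (\<Sum>n. R ^ Suc n)"
    using suminf_split_head[OF s] by (simp add: S_def)
  moreover have "(\<Sum>n. R ^ Suc n) = R * S"
    unfolding S_def by (simp add: suminf_mult[OF s])
  moreover have "(\<Sum>n. R ^ Suc n) = S * R"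
    unfolding S_def by (simp only: power_Suc2 suminf_mult2[OF s])
  ultimately have "(1 - R) * S = 1" "S * (1 - R) = 1"
    by (simp_all add: algebra_simps)
  then show ?thesis unfolding op_invertible_def by blast
qed

lemma op_invertible_scaleR: "r \<noteq> 0 \<Longrightarrow> op_invertible (r *\<^sub>R A) \<longleftrightarrow> op_invertible A"
proof -
  have *: "op_invertible (r *\<^sub>R A)" if "r \<noteq> 0" "op_invertible A" for r A
  proof -
    from that obtain B where "A * B = 1" "B * A = 1" by (auto simp: op_invertible_def)
    with that(1) show ?thesis
      unfolding op_invertible_def by (intro exI[of _ "inverse r *\<^sub>R B"]) simp
  qed
  assume "r \<noteq> 0"
  then show ?thesis using *[of r A] *[of "inverse r" "r *\<^sub>R A"] by auto
qed

text \<open>Division by \<open>M\<close> turns \<open>A\<close> into \<open>1 - R\<close> with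
  \<open>norm R \<le> 1 - c / M < 1\<close>, and the Neumann series inverts \<open>1 - R\<close>.
  Adding \<open>c\<close> to \<open>norm A\<close> makes \<open>M\<close> positive and at least
  \<open>c\<close>.\<close>

lemma posdef_invertible:
  assumes "posdef_op A"
  shows "op_invertible A"
proof -
  from assms obtain c where A: "selfadjoint_op A" and c: "c > 0" "op_le (c *\<^sub>R 1) A"
    by (auto simp: posdef_iff)
  define M where "M = norm A + c"
  have M: "M > 0" "c \<le> M" using c by (auto simp: M_def add_nonneg_pos)
  define R where "R = 1 - (1 / M) *\<^sub>R A"
  have "norm R \<le> 1 - c / M"
  proof (rule norm_selfadjoint_le)
    show "selfadjoint_op R"
      using A by (simp add: R_def selfadjoint_diff selfadjoint_scaleR)
    have l: "v \<bullet> v * c \<le> v \<bullet> (A \<bullet>\<^sub>v v)" for v using c by (auto simp: op_le_def mult.commute)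
    have u: "v \<bullet> (A \<bullet>\<^sub>v v) \<le> v \<bullet> v * norm A" for v
      using op_le_norm(1)[of A] by (auto simp: op_le_def mult.commute)
    show "op_le R ((1 - c / M) *\<^sub>R 1)"
      unfolding op_le_def using l M by (auto simp: R_def inner_diff_right field_simps)
    show "op_le ((- (1 - c / M)) *\<^sub>R 1) R"
      unfolding op_le_def
    proof
      fix v
      have "v \<bullet> (A \<bullet>\<^sub>v v) \<le> v \<bullet> v * (2 * M - c)"
        using order_trans[OF u[of v] mult_left_mono[of "norm A" "2 * M - c" "v \<bullet> v"]] c
        by (simp add: M_def)
      then have "(v \<bullet> (A \<bullet>\<^sub>v v)) / M \<le> (v \<bullet> v * (2 * M - c)) / M"
        using M by (intro divide_right_mono) auto
      also have "\<dots> = 2 * (v \<bullet> v) - c / M * (v \<bullet> v)"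
        using M by (simp add: field_simps)
      finally show "v \<bullet> ((- (1 - c / M)) *\<^sub>R 1 \<bullet>\<^sub>v v) \<le> v \<bullet> (R \<bullet>\<^sub>v v)"
        by (simp add: R_def inner_diff_right algebra_simps)
    qed
  qed
  also have "\<dots> < 1" using c M by simp
  finally have "op_invertible (1 - R)" by (rule op_invertible_near_one)
  then show ?thesis using M by (simp add: R_def op_invertible_scaleR)
qed

lemma ell2_basis_nonzero [simp]: "ell2_basis i \<noteq> 0"
proof
  assume "ell2_basis i = 0"
  then have "ell2_coord (ell2_basis i) i = ell2_coord 0 i" by simp
  then show False by (simp add: ell2_basis.rep_eq zero_ell2.rep_eq)
qed

section \<open>Polynomials of an operator\<close>

lemma scaleC_op_of_real: "scaleC_op (of_real r) A = r *\<^sub>R A"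
  by (rule op_eqI) (simp add: scaleC_ell2_of_real)

lemma scaleC_op_mult_left [simp]: "scaleC_op c A * B = scaleC_op c (A * B)"
  by (rule op_eqI) simp

lemma scaleC_op_mult_right [simp]: "A * scaleC_op c B = scaleC_op c (A * B)"
  by (rule op_eqI) simp

lemma scaleC_op_scaleC_op [simp]: "scaleC_op c (scaleC_op d A) = scaleC_op (c * d) A"
  by (rule op_eqI) (simp add: scaleC_ell2_scaleC)

lemma scaleC_op_add_left: "scaleC_op (c + d) A = scaleC_op c A + scaleC_op d A"
  by (rule op_eqI) (simp add: scaleC_ell2_add_left)

lemma scaleC_op_add_right: "scaleC_op c (A + B) = scaleC_op c A + scaleC_op c B"
  by (rule op_eqI) (simp add: scaleC_ell2_add_right)

lemma scaleC_op_diff_right: "scaleC_op c (A - B) = scaleC_op c A - scaleC_op c B"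
  by (rule op_eqI) (simp add: scaleC_ell2_diff_right)

lemma scaleC_op_zero [simp]: "scaleC_op 0 A = 0" "scaleC_op c 0 = 0"
  by (rule op_eqI; simp)+

lemma scaleC_op_one [simp]: "scaleC_op 1 A = A"
  by (rule op_eqI) simp

lemma scaleC_op_minus_left: "scaleC_op (- c) A = - scaleC_op c A"
  using scaleC_op_add_left[of "- c" c A] by (simp add: eq_neg_iff_add_eq_0)

lemma poly_op_altdef:
  assumes "degree p \<le> n"
  shows "poly_op p A = (\<Sum>k\<le>n. scaleC_op (coeff p k) (A ^ k))"
  unfolding poly_op_def
  by (rule sum.mono_neutral_left) (use assms in \<open>auto simp: not_le coeff_eq_0\<close>)

lemma poly_op_0 [simp]: "poly_op 0 A = 0"
  by (simp add: poly_op_def)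

lemma poly_op_pCons: "poly_op (pCons a p) A = scaleC_op a 1 + A * poly_op p A"
proof -
  have "poly_op (pCons a p) A = (\<Sum>k\<le>Suc (degree p). scaleC_op (coeff (pCons a p) k) (A ^ k))"
    by (rule poly_op_altdef) (rule degree_pCons_le)
  also have "\<dots> = scaleC_op a 1 + (\<Sum>k\<le>degree p. scaleC_op (coeff p k) (A ^ Suc k))"
    by (subst sum.atMost_Suc_shift) simp
  finally show ?thesis by (simp add: poly_op_def sum_distrib_left)
qed

lemma poly_op_const [simp]: "poly_op [:c:] A = scaleC_op c 1"
  by (simp add: poly_op_pCons)

lemma poly_op_linear: "poly_op [:- z, 1:] A = A - scaleC_op z 1"
  by (simp add: poly_op_pCons scaleC_op_minus_left)

lemma poly_op_add: "poly_op (p + q) A = poly_op p A + poly_op q A"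
proof -
  let ?n = "max (degree p) (degree q)"
  have "poly_op (p + q) A = (\<Sum>k\<le>?n. scaleC_op (coeff (p + q) k) (A ^ k))"
    by (rule poly_op_altdef) (rule degree_add_le_max)
  then show ?thesis
    by (simp add: poly_op_altdef[of p ?n] poly_op_altdef[of q ?n] scaleC_op_add_left sum.distrib)
qed

lemma poly_op_smult: "poly_op (smult c p) A = scaleC_op c (poly_op p A)"
  by (induction p) (simp_all add: poly_op_pCons scaleC_op_add_right)

lemma poly_op_diff: "poly_op (p - q) A = poly_op p A - poly_op q A"
  using poly_op_add[of "p - q" q A] by (simp add: algebra_simps)

lemma poly_op_mult: "poly_op (p * q) A = poly_op p A * poly_op q A"
  by (induction p) (simp_all add: poly_op_pCons poly_op_add poly_op_smult mult.assoc distrib_right)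

lemma poly_map_poly_cnj: "poly (map_poly cnj p) z = cnj (poly p (cnj z))"
  by (induction p) (simp_all add: map_poly_pCons)

text \<open>Polynomials with complex coefficients lead out of the self-adjoint operators;
  conjugating the coefficients keeps track of the adjoint. The factor \<open>A\<close> split off in
  the induction reappears on the other side of \<open>poly_op\<close>, so commutation is
  used.\<close>

lemma poly_op_adjoint:
  assumes "selfadjoint_op A"
  shows "cinner_ell2 x (poly_op p A \<bullet>\<^sub>v y) = cinner_ell2 (poly_op (map_poly cnj p) A \<bullet>\<^sub>v x) y"
proof (induction p arbitrary: x y)
  case (pCons a p)
  have com: "poly_op q A * A = A * poly_op q A" for q
    using poly_op_mult[of q "[:0, 1:]" A] poly_op_mult[of "[:0, 1:]" q A]
    by (simp add: poly_op_pCons mult.commute)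
  have "cinner_ell2 x (A \<bullet>\<^sub>v poly_op p A \<bullet>\<^sub>v y)
      = cinner_ell2 ((poly_op (map_poly cnj p) A * A) \<bullet>\<^sub>v x) y"
    using assms by (simp add: selfadjoint_op_def pCons)
  then show ?case
    by (simp add: poly_op_pCons map_poly_pCons cinner_ell2_add_left cinner_ell2_add_right com
        cinner_ell2_scaleC_left cinner_ell2_scaleC_right)
qed (simp add: cinner_ell2_scaleC_left[of 0, simplified] cinner_ell2_scaleC_right[of _ 0, simplified])


lemma op_le_square:
  assumes "selfadjoint_op B"
  shows "op_le 0 (B * B)"
proof -
  have "v \<bullet> (B \<bullet>\<^sub>v B \<bullet>\<^sub>v v) = (B \<bullet>\<^sub>v v) \<bullet> (B \<bullet>\<^sub>v v)" for v
    by (rule selfadjointD[OF assms, symmetric])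
  then show ?thesis by (simp add: op_le_def)
qed


section \<open>The spectrum of a self-adjoint operator\<close>

lemma op_spectrum_iff: "z \<in> op_spectrum A \<longleftrightarrow> \<not> op_invertible (A - scaleC_op z 1)"
  by (simp add: op_spectrum_def op_invertible_def)

text \<open>Stands in for the spectrum lying in \<open>{m..M}\<close>: functions are approximated on
  an interval, where the classical approximation theorem applies.\<close>

definition op_between :: "real \<Rightarrow> real \<Rightarrow> ell2_op \<Rightarrow> bool" where
  "op_between m M A \<longleftrightarrow> selfadjoint_op A \<and> op_le (m *\<^sub>R 1) A \<and> op_le A (M *\<^sub>R 1)"

lemma op_between_norm: "selfadjoint_op A \<Longrightarrow> op_between (- norm A) (norm A) A"
  using op_le_norm[of A] by (simp add: op_between_def)

lemma op_between_le: 
  assumes "op_between m M A"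
  shows "m \<le> M"
proof -
  have "op_le (m *\<^sub>R 1) (M *\<^sub>R 1)" using assms by (auto simp: op_between_def intro: op_le_trans)
  then have "m * (ell2_basis 0 \<bullet> ell2_basis 0) \<le> M * (ell2_basis 0 \<bullet> ell2_basis 0)"
    by (auto simp: op_le_def)
  moreover have "ell2_basis 0 \<bullet> ell2_basis 0 > 0" by simp
  ultimately show ?thesis by (simp add: mult_le_cancel_right)
qed

lemma op_invertible_shift_above:
  assumes "selfadjoint_op A" "op_le (m *\<^sub>R 1) A" "a < m"
  shows "op_invertible (A - a *\<^sub>R 1)"
proof (rule posdef_invertible)
  have "op_le ((m - a) *\<^sub>R 1) (A - a *\<^sub>R 1)"
    using assms(2) by (simp add: op_le_def inner_diff_right algebra_simps)
  then show "posdef_op (A - a *\<^sub>R 1)"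
    using assms by (auto simp: posdef_iff selfadjoint_diff selfadjoint_scaleR intro!: exI[of _ "m - a"])
qed

text \<open>For \<open>z = a + i b\<close> with \<open>b \<noteq> 0\<close> the operators
  \<open>B - J\<close> and \<open>B + J\<close> commute and their product
  \<open>B * B + b\<^sup>2 *\<^sub>R 1\<close> is positive definite, so \<open>A - z\<close> is
  invertible. A real point outside the interval makes the shifted operator definite.\<close>

lemma op_spectrum_between:
  assumes A: "op_between m M A" and z: "z \<in> op_spectrum A"
  shows "z \<in> of_real ` {m..M}"
proof -
  define a b where "a = Re z" and "b = Im z"
  have sa: "selfadjoint_op A" using A by (simp add: op_between_def)
  have sa': "selfadjoint_op (A - a *\<^sub>R 1)"
    by (simp add: sa selfadjoint_diff selfadjoint_scaleR)
  have "b = 0"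
  proof (rule ccontr)
    assume "b \<noteq> 0"
    define B where "B = A - a *\<^sub>R 1"
    define J where "J = scaleC_op (\<i> * b) 1"
    have zB: "A - scaleC_op z 1 = B - J"
      unfolding B_def J_def
      by (subst complex_eq[of z])
         (simp add: a_def b_def scaleC_op_add_left scaleC_op_of_real)
    have JJ: "J * J = - (b\<^sup>2 *\<^sub>R 1)"
    proof -
      have "J * J = scaleC_op (of_real (- b\<^sup>2)) 1"
        by (simp add: J_def mult.commute mult.left_commute power2_eq_square)
      then show ?thesis by (simp only: scaleC_op_of_real) simp
    qed
    have JB: "J * B = B * J" by (simp add: J_def)
    have eq: "(B - J) * (B + J) = B * B + b\<^sup>2 *\<^sub>R 1" "(B + J) * (B - J) = B * B + b\<^sup>2 *\<^sub>R 1"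
      using JJ JB by (simp_all add: algebra_simps)
    have "posdef_op (B * B + b\<^sup>2 *\<^sub>R 1)"
      unfolding posdef_iff
    proof (intro conjI exI[of _ "b\<^sup>2"])
      show "selfadjoint_op (B * B + b\<^sup>2 *\<^sub>R 1)"
        using sa' by (simp add: B_def selfadjoint_add selfadjoint_square selfadjoint_scaleR)
      show "op_le (b\<^sup>2 *\<^sub>R 1) (B * B + b\<^sup>2 *\<^sub>R 1)"
        using op_le_add[OF op_le_square[OF sa'[folded B_def]] op_le_refl[of "b\<^sup>2 *\<^sub>R 1"]] by simp
    qed (use \<open>b \<noteq> 0\<close> in auto)
    then have "op_invertible ((B - J) * (B + J))"
      using eq posdef_invertible by simp
    then have "op_invertible (B - J)"
      by (rule op_invertible_commuting_factor) (simp add: eq)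
    with z zB show False by (simp add: op_spectrum_iff)
  qed
  then have za: "z = of_real a" by (simp add: a_def b_def complex_eq_iff)
  have ni: "\<not> op_invertible (A - a *\<^sub>R 1)"
    using z by (simp add: op_spectrum_iff za scaleC_op_of_real)
  have "m \<le> a"
    using op_invertible_shift_above[of A m a] sa A ni by (force simp: op_between_def)
  moreover have "a \<le> M"
  proof (rule ccontr)
    assume "\<not> a \<le> M"
    \<comment> \<open>The upper end is the lower end for \<open>- A\<close>.\<close>
    then have "op_invertible ((- A) - (- a) *\<^sub>R 1)"
      using A by (intro op_invertible_shift_above[of _ "- M"])
        (auto simp: op_between_def op_le_def selfadjoint_iff_inner inner_minus_right)
    then have "op_invertible ((-1) *\<^sub>R (A - a *\<^sub>R 1))" by (simp add: algebra_simps)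
    then show False using ni by (subst (asm) op_invertible_scaleR) auto
  qed
  ultimately show ?thesis using za by auto
qed

text \<open>
  If neither \<open>m = \<parallel>S\<parallel>\<close> nor \<open>- m\<close> were in the spectrum, \<open>m\<^sup>2 - S\<^sup>2\<close> would be invertible and positive,
  hence bounded below, and the norm of \<open>S\<close> would be smaller than \<open>m\<close>.
\<close>

lemma norm_selfadjoint_in_spectrum:
  assumes S: "selfadjoint_op S"
  shows "\<exists>z\<in>op_spectrum S. cmod z = norm S"
proof (rule ccontr)
  assume neg: "\<not> ?thesis"
  define m where "m = norm S"
  have "complex_of_real m \<notin> op_spectrum S" "complex_of_real (- m) \<notin> op_spectrum S"
    using neg by (auto simp: m_def)
  then have "op_invertible (S - m *\<^sub>R 1)" "op_invertible (S + m *\<^sub>R 1)"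
    unfolding op_spectrum_iff scaleC_op_of_real by simp_all
  then have "op_invertible ((S - m *\<^sub>R 1) * (S + m *\<^sub>R 1))" by (rule op_invertible_mult)
  moreover define P where "P = m\<^sup>2 *\<^sub>R 1 - S * S"
  have "(S - m *\<^sub>R 1) * (S + m *\<^sub>R 1) = (-1) *\<^sub>R P"
    by (simp add: P_def algebra_simps power2_eq_square)
  ultimately have "op_invertible P"
    by (simp only: op_invertible_scaleR[of "-1"])
  then obtain B where B: "B * P = 1" by (auto simp: op_invertible_def)
  have vP: "v \<bullet> (P \<bullet>\<^sub>v v) = m\<^sup>2 * (norm v)\<^sup>2 - (norm (S \<bullet>\<^sub>v v))\<^sup>2" for v
    using selfadjointD[OF S, of v "S \<bullet>\<^sub>v v"] by (simp add: P_def inner_diff_right dot_square_norm)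
  have saP: "selfadjoint_op P" "op_le 0 P"
  proof -
    show "selfadjoint_op P"
      using S by (simp add: P_def selfadjoint_diff selfadjoint_square selfadjoint_scaleR)
    have "(norm (S \<bullet>\<^sub>v v))\<^sup>2 \<le> (m * norm v)\<^sup>2" for v
      using norm_op_apply[of S v] by (intro power_mono) (auto simp: m_def)
    then show "op_le 0 P" by (simp add: op_le_def vP power_mult_distrib)
  qed
  define k where "k = (norm B)\<^sup>2 * norm P"
  have k: "(norm v)\<^sup>2 \<le> k * (m\<^sup>2 * (norm v)\<^sup>2 - (norm (S \<bullet>\<^sub>v v))\<^sup>2)" for v
  proof -
    have "v = B \<bullet>\<^sub>v P \<bullet>\<^sub>v v" using B by (metis op_apply_mult op_apply_one)
    then have "norm v \<le> norm B * norm (P \<bullet>\<^sub>v v)" by (metis norm_op_apply)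
    then have "(norm v)\<^sup>2 \<le> (norm B)\<^sup>2 * (norm (P \<bullet>\<^sub>v v))\<^sup>2"
      by (metis norm_ge_zero power_mono power_mult_distrib)
    also have "\<dots> \<le> (norm B)\<^sup>2 * (norm P * (v \<bullet> (P \<bullet>\<^sub>v v)))"
      by (intro mult_left_mono norm_positive_op_apply saP) auto
    finally show ?thesis by (simp add: k_def vP mult_ac)
  qed
  have "k \<noteq> 0" using k[of "ell2_basis 0"] by auto
  then have "k > 0" by (simp add: k_def order.strict_iff_order)
  have le: "(norm (S \<bullet>\<^sub>v v))\<^sup>2 \<le> (m\<^sup>2 - 1 / k) * (norm v)\<^sup>2" for v
    using k[of v] \<open>k > 0\<close> by (simp add: field_simps)
  have "0 \<le> (m\<^sup>2 - 1 / k) * (norm (ell2_basis 0))\<^sup>2"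
    using order_trans[OF zero_le_power2 le[of "ell2_basis 0"]] by simp
  then have nn: "0 \<le> m\<^sup>2 - 1 / k" by (simp add: zero_le_mult_iff)
  have "norm S \<le> sqrt (m\<^sup>2 - 1 / k)"
  proof (rule norm_op_bound)
    fix v
    have "norm (S \<bullet>\<^sub>v v) \<le> sqrt ((m\<^sup>2 - 1 / k) * (norm v)\<^sup>2)"
      using le[of v] by (rule real_le_rsqrt)
    then show "norm (S \<bullet>\<^sub>v v) \<le> sqrt (m\<^sup>2 - 1 / k) * norm v"
      by (simp add: real_sqrt_mult)
  qed (use nn in simp)
  then have "m\<^sup>2 \<le> m\<^sup>2 - 1 / k"
    using nn by (metis m_def norm_ge_zero power_mono real_sqrt_pow2)
  then show False using \<open>k > 0\<close> by simp
qed

text \<open>Over the complex numbers \<open>p\<close> splits into linear factors, each of which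
  gives an invertible operator.\<close>

lemma op_invertible_poly_op:
  assumes "p \<noteq> 0" "\<And>z. poly p z = 0 \<Longrightarrow> op_invertible (A - scaleC_op z 1)"
  shows "op_invertible (poly_op p A)"
  using assms
proof (induction "degree p" arbitrary: p)
  case 0
  then obtain c where c: "p = [:c:]" by (metis degree_eq_zeroE)
  with 0 have "c \<noteq> 0" by auto
  then have "scaleC_op c 1 * scaleC_op (inverse c) 1 = 1" "scaleC_op (inverse c) 1 * scaleC_op c 1 = 1"
    by simp_all
  then show ?case unfolding c op_invertible_def poly_op_const by blast
next
  case (Suc n)
  then have "\<not> constant (poly p)" by (simp add: constant_degree)
  then obtain z where z: "poly p z = 0" using fundamental_theorem_of_algebra by blast
  then obtain q where q: "p = [:- z, 1:] * q" by (auto simp: poly_eq_0_iff_dvd)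
  with Suc.prems have "q \<noteq> 0" by auto
  then have "degree p = Suc (degree q)" unfolding q by (subst degree_mult_eq) auto
  then have "op_invertible (poly_op q A)"
    using Suc.prems Suc.hyps(2) \<open>q \<noteq> 0\<close> by (intro Suc.hyps(1)) (auto simp: q)
  moreover have "op_invertible (A - scaleC_op z 1)" using Suc.prems z by blast
  ultimately show ?case
    unfolding q poly_op_mult poly_op_linear by (intro op_invertible_mult)
qed

text \<open>One inclusion of the spectral mapping theorem, by factoring \<open>q - [:w:]\<close>. A
  nonempty spectrum excludes the constant \<open>q = [:w:]\<close>, for which there is nothing to
  factor.\<close>

lemma op_spectrum_poly_op:
  assumes "w \<in> op_spectrum (poly_op q A)" "op_spectrum A \<noteq> {}"
  shows "\<exists>z\<in>op_spectrum A. poly q z = w"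
proof (rule ccontr)
  assume neg: "\<not> ?thesis"
  have "q - [:w:] \<noteq> 0" using neg assms(2) by auto
  then have "op_invertible (poly_op (q - [:w:]) A)"
    by (rule op_invertible_poly_op) (use neg in \<open>auto simp: op_spectrum_iff\<close>)
  then show False using assms(1) by (simp add: poly_op_diff op_spectrum_iff)
qed

text \<open>The operator \<open>poly_op p A\<close> need not be self-adjoint, so its norm is read
  off from \<open>S\<close>, the product of its adjoint with itself. The norm of \<open>S\<close> is
  attained on its spectrum, whose points are values of \<open>q * p\<close> on the spectrum of
  \<open>A\<close>.\<close>

lemma norm_poly_op_le:
  assumes A: "selfadjoint_op A" and c: "\<And>z. z \<in> op_spectrum A \<Longrightarrow> cmod (poly p z) \<le> c"
  shows "norm (poly_op p A) \<le> c"
proof -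
  obtain z0 where z0: "z0 \<in> op_spectrum A" using norm_selfadjoint_in_spectrum[OF A] by blast
  then have "0 \<le> c" using c norm_ge_zero order_trans by blast
  define q where "q = map_poly cnj p"
  define S where "S = poly_op (q * p) A"
  have adj: "cinner_ell2 x (poly_op q A \<bullet>\<^sub>v y) = cinner_ell2 (poly_op p A \<bullet>\<^sub>v x) y" for x y
    using poly_op_adjoint[OF A, of y p x]
    by (subst (1 2) cinner_ell2_commute) (simp add: q_def)
  have sp: "cinner_ell2 x (S \<bullet>\<^sub>v y) = cinner_ell2 (poly_op p A \<bullet>\<^sub>v x) (poly_op p A \<bullet>\<^sub>v y)" for x y
    by (simp add: S_def poly_op_mult adj)
  have "cinner_ell2 (S \<bullet>\<^sub>v x) y = cinner_ell2 (poly_op p A \<bullet>\<^sub>v x) (poly_op p A \<bullet>\<^sub>v y)" for x y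
    by (subst (1 2) cinner_ell2_commute) (simp only: sp)
  then have S: "selfadjoint_op S"
    unfolding selfadjoint_op_def sp by simp
  from norm_selfadjoint_in_spectrum[OF S]
  obtain w where w: "w \<in> op_spectrum S" "cmod w = norm S" by blast
  then obtain z where z: "z \<in> op_spectrum A" "poly (q * p) z = w"
    using op_spectrum_poly_op z0 unfolding S_def by blast
  \<comment> \<open>At a real point the value of \<open>q\<close> is the conjugate of the value of
    \<open>p\<close>.\<close>
  have "cnj z = z"
    using op_spectrum_between[OF op_between_norm[OF A] z(1)] by auto
  then have "norm S = (cmod (poly p z))\<^sup>2"
    by (simp add: q_def poly_map_poly_cnj norm_mult power2_eq_square flip: w(2) z(2))
  also have "\<dots> \<le> c\<^sup>2" using c[OF z(1)] by (intro power_mono) auto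
  finally have nS: "norm S \<le> c\<^sup>2" .
  show ?thesis
  proof (rule norm_op_bound[OF \<open>0 \<le> c\<close>])
    fix x
    have "(norm (poly_op p A \<bullet>\<^sub>v x))\<^sup>2 = x \<bullet> (S \<bullet>\<^sub>v x)"
      by (simp add: inner_ell2_def sp flip: dot_square_norm)
    also have "\<dots> \<le> norm S * (norm x)\<^sup>2"
      using op_le_norm(1)[of S] by (auto simp: op_le_def dot_square_norm)
    also have "\<dots> \<le> (c * norm x)\<^sup>2"
      using nS by (simp add: power_mult_distrib mult_right_mono)
    finally show "norm (poly_op p A \<bullet>\<^sub>v x) \<le> c * norm x"
      using \<open>0 \<le> c\<close> by (simp add: power2_le_iff_abs_le)
  qed
qed


section \<open>Continuous functional calculus\<close>

text \<open>Stated for two sequences: \<open>p = q\<close> gives the Cauchy property, and distinct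
  sequences give independence of the limit from the choice.\<close>

lemma uniform_limit_poly_op_diff:
  assumes A: "selfadjoint_op A"
    and p: "uniform_limit (op_spectrum A) (\<lambda>n. poly (p n)) f sequentially"
    and q: "uniform_limit (op_spectrum A) (\<lambda>n. poly (q n)) f sequentially"
    and e: "e > 0"
  shows "\<exists>N. \<forall>m\<ge>N. \<forall>n\<ge>N. norm (poly_op (p m) A - poly_op (q n) A) \<le> e"
proof -
  obtain N1 where N1: "\<And>n z. n \<ge> N1 \<Longrightarrow> z \<in> op_spectrum A \<Longrightarrow> dist (poly (p n) z) (f z) < e / 2"
    using uniform_limitD[OF p, of "e / 2"] e by (auto simp: eventually_sequentially)
  obtain N2 where N2: "\<And>n z. n \<ge> N2 \<Longrightarrow> z \<in> op_spectrum A \<Longrightarrow> dist (poly (q n) z) (f z) < e / 2"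
    using uniform_limitD[OF q, of "e / 2"] e by (auto simp: eventually_sequentially)
  have "norm (poly_op (p m) A - poly_op (q n) A) \<le> e" if "m \<ge> max N1 N2" "n \<ge> max N1 N2" for m n
  proof -
    have "norm (poly_op (p m - q n) A) \<le> e"
    proof (rule norm_poly_op_le[OF A])
      fix z assume z: "z \<in> op_spectrum A"
      have "dist (poly (p m) z) (poly (q n) z) < e"
        by (rule dist_triangle_half_l[of _ "f z"]) (use N1 N2 that z in \<open>auto simp: dist_commute\<close>)
      then show "cmod (poly (p m - q n) z) \<le> e" by (simp add: dist_norm)
    qed
    then show ?thesis by (simp add: poly_op_diff)
  qed
  then show ?thesis by blast
qed

lemma cnj_dist: "cmod (cnj z - of_real x) = cmod (z - of_real x)"
  by (metis complex_cnj_complex_of_real complex_cnj_diff complex_mod_cnj)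

text \<open>One uniformly convergent polynomial sequence determines the operator limit of all
  others, so the definite description in \<open>op_fun\<close> has a value, and this is it.\<close>

theorem op_fun_LIMSEQ:
  assumes A: "selfadjoint_op A"
    and p: "uniform_limit (op_spectrum A) (\<lambda>n. poly (p n)) f sequentially"
  shows "(\<lambda>n. poly_op (p n) A) \<longlonglongrightarrow> op_fun f A"
proof -
  have "Cauchy (\<lambda>n. poly_op (p n) A)"
  proof (rule metric_CauchyI)
    fix e :: real assume "e > 0"
    then obtain N where "\<forall>m\<ge>N. \<forall>n\<ge>N. norm (poly_op (p m) A - poly_op (p n) A) \<le> e / 2"
      using uniform_limit_poly_op_diff[OF A p p, of "e / 2"] by auto
    then show "\<exists>M. \<forall>m\<ge>M. \<forall>n\<ge>M. dist (poly_op (p m) A) (poly_op (p n) A) < e"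
      using \<open>e > 0\<close> unfolding dist_norm
      by (intro exI[of _ N]) (auto intro: order_le_less_trans[where y = "e / 2"] simp del: le_divide_eq_numeral1)
  qed
  then obtain B where B: "(\<lambda>n. poly_op (p n) A) \<longlonglongrightarrow> B"
    using Cauchy_convergent convergent_def by blast
  have all: "(\<lambda>n. poly_op (q n) A) \<longlonglongrightarrow> B"
    if q: "uniform_limit (op_spectrum A) (\<lambda>n. poly (q n)) f sequentially" for q
  proof -
    have "(\<lambda>n. poly_op (p n) A - poly_op (q n) A) \<longlonglongrightarrow> 0"
    proof (rule LIMSEQ_I)
      fix e :: real assume "e > 0"
      then obtain N where "\<forall>m\<ge>N. \<forall>n\<ge>N. norm (poly_op (p m) A - poly_op (q n) A) \<le> e / 2"
        using uniform_limit_poly_op_diff[OF A p q, of "e / 2"] by auto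
      then show "\<exists>no. \<forall>n\<ge>no. norm (poly_op (p n) A - poly_op (q n) A - 0) < e"
        using \<open>e > 0\<close>
        by (intro exI[of _ N]) (auto intro: order_le_less_trans[where y = "e / 2"] simp del: le_divide_eq_numeral1)
    qed
    from tendsto_diff[OF B this] show ?thesis by simp
  qed
  have "op_fun f A = B"
    unfolding op_fun_def
    by (rule the_equality) (use all p LIMSEQ_unique in blast)+
  with B show ?thesis by simp
qed

lemma op_fun_cong:
  assumes "\<And>z. z \<in> op_spectrum A \<Longrightarrow> f z = g z"
  shows "op_fun f A = op_fun g A"
proof -
  have "uniform_limit (op_spectrum A) (\<lambda>n. poly (p n)) f sequentially
      \<longleftrightarrow> uniform_limit (op_spectrum A) (\<lambda>n. poly (p n)) g sequentially" for p
    using assms by (intro uniform_limit_cong') auto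
  then show ?thesis by (simp add: op_fun_def)
qed

text \<open>Self-adjoint operators have real spectrum, so \<open>Re\<close> loses nothing there.
  Functions of a real variable give access to order, intervals and Weierstrass
  approximation.\<close>

definition op_rfun :: "(real \<Rightarrow> real) \<Rightarrow> ell2_op \<Rightarrow> ell2_op" where
  "op_rfun h = op_fun (\<lambda>z. of_real (h (Re z)))"

lemma uniform_limit_sequence_exists:
  assumes "\<And>e::real. 0 < e \<Longrightarrow> \<exists>q. P q \<and> (\<forall>x\<in>S. dist (q x) (f x) < e)"
  shows "\<exists>q. (\<forall>n. P (q n)) \<and> uniform_limit S q f sequentially"
proof -
  have "\<exists>q. P q \<and> (\<forall>x\<in>S. dist (q x) (f x) < 1 / Suc n)" for n by (rule assms) simp
  then obtain q where q: "\<And>n. P (q n)" "\<And>n x. x \<in> S \<Longrightarrow> dist (q n x) (f x) < 1 / Suc n"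
    by metis
  have "uniform_limit S q f sequentially"
  proof (rule uniform_limitI)
    fix e :: real assume "e > 0"
    then obtain N where N: "1 / Suc N < e" by (meson nat_approx_posE)
    have "1 / Suc n \<le> 1 / Suc N" if "n \<ge> N" for n using that by (simp add: frac_le)
    then show "\<forall>\<^sub>F n in sequentially. \<forall>x\<in>S. dist (q n x) (f x) < e"
      unfolding eventually_sequentially
      by (intro exI[of _ N]) (meson N q(2) less_le_trans order_less_trans)
  qed
  with q(1) show ?thesis by blast
qed

lemma exists_poly_uniform_limit:
  fixes h :: "real \<Rightarrow> real"
  assumes "continuous_on {m..M} h"
  shows "\<exists>p :: nat \<Rightarrow> complex poly. uniform_limit (of_real ` {m..M}) (\<lambda>n. poly (p n))
            (\<lambda>z. of_real (h (Re z))) sequentially"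
proof -
  have "\<exists>q. (\<exists>p :: complex poly. q = poly p) \<and>
      (\<forall>z\<in>of_real ` {m..M}. dist (q z) (of_real (h (Re z))) < e)" if e: "0 < e" for e
  proof -
    obtain g where g: "real_polynomial_function g" "\<And>x. x \<in> {m..M} \<Longrightarrow> \<bar>h x - g x\<bar> < e"
      using Stone_Weierstrass_real_polynomial_function[OF compact_Icc assms e] by blast
    then obtain a k where a: "g = (\<lambda>x. \<Sum>i\<le>k. a i * x ^ i)"
      by (auto simp: real_polynomial_function_iff_sum)
    define p where "p = (\<Sum>i\<le>k. monom (complex_of_real (a i)) i)"
    have "poly p (of_real x) = of_real (g x)" for x
      by (simp add: p_def poly_sum poly_monom a)
    then show ?thesis
      using g(2) by (intro exI[of _ "poly p"])
        (auto simp: dist_norm abs_minus_commute simp flip: of_real_diff)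
  qed
  from uniform_limit_sequence_exists[of "\<lambda>q. \<exists>p. q = poly p", OF this] obtain q
    where q: "\<forall>n. \<exists>p. q n = poly p"
      "uniform_limit (of_real ` {m..M}) q (\<lambda>z. of_real (h (Re z))) sequentially"
    by blast
  from choice[OF q(1)] obtain p where "\<And>n. q n = poly (p n)" by blast
  with q(2) show ?thesis by (intro exI[of _ p]) (simp flip: \<open>\<And>n. q n = poly (p n)\<close>)
qed

lemma op_rfun_LIMSEQ:
  assumes A: "op_between m M A"
    and p: "uniform_limit (of_real ` {m..M}) (\<lambda>n. poly (p n)) (\<lambda>z. of_real (h (Re z))) sequentially"
  shows "(\<lambda>n. poly_op (p n) A) \<longlonglongrightarrow> op_rfun h A"
  unfolding op_rfun_def
proof (rule op_fun_LIMSEQ)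
  show "uniform_limit (op_spectrum A) (\<lambda>n. poly (p n)) (\<lambda>z. of_real (h (Re z))) sequentially"
    using p by (rule uniform_limit_on_subset) (use op_spectrum_between[OF A] in blast)
qed (use A in \<open>simp add: op_between_def\<close>)

lemma op_rfunE:
  assumes "op_between m M A" "continuous_on {m..M} h"
  obtains p :: "nat \<Rightarrow> complex poly" where
    "uniform_limit (of_real ` {m..M}) (\<lambda>n. poly (p n)) (\<lambda>z. of_real (h (Re z))) sequentially"
    "(\<lambda>n. poly_op (p n) A) \<longlonglongrightarrow> op_rfun h A"
  using exists_poly_uniform_limit[OF assms(2)] op_rfun_LIMSEQ[OF assms(1)] by blast

lemma op_rfun_cong:
  assumes "op_between m M A" "\<And>x. m \<le> x \<Longrightarrow> x \<le> M \<Longrightarrow> h x = k x"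
  shows "op_rfun h A = op_rfun k A"
  unfolding op_rfun_def
  by (rule op_fun_cong) (use op_spectrum_between[OF assms(1)] assms(2) in fastforce)

lemma op_rfun_add:
  assumes A: "op_between m M A" and h: "continuous_on {m..M} h" and k: "continuous_on {m..M} k"
  shows "op_rfun (\<lambda>x. h x + k x) A = op_rfun h A + op_rfun k A"
proof -
  obtain p where p: "uniform_limit (of_real ` {m..M}) (\<lambda>n. poly (p n)) (\<lambda>z. of_real (h (Re z))) sequentially"
    "(\<lambda>n. poly_op (p n) A) \<longlonglongrightarrow> op_rfun h A" using op_rfunE[OF A h] .
  obtain q where q: "uniform_limit (of_real ` {m..M}) (\<lambda>n. poly (q n)) (\<lambda>z. of_real (k (Re z))) sequentially"
    "(\<lambda>n. poly_op (q n) A) \<longlonglongrightarrow> op_rfun k A" using op_rfunE[OF A k] .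
  have "(\<lambda>n. poly_op (p n + q n) A) \<longlonglongrightarrow> op_rfun (\<lambda>x. h x + k x) A"
    using uniform_limit_add[OF p(1) q(1)]
    by (intro op_rfun_LIMSEQ[OF A]) (simp add: poly_add[abs_def])
  moreover have "(\<lambda>n. poly_op (p n + q n) A) \<longlonglongrightarrow> op_rfun h A + op_rfun k A"
    unfolding poly_op_add by (intro tendsto_add p q)
  ultimately show ?thesis by (rule LIMSEQ_unique)
qed

lemma op_rfun_mult:
  assumes A: "op_between m M A" and h: "continuous_on {m..M} h" and k: "continuous_on {m..M} k"
  shows "op_rfun (\<lambda>x. h x * k x) A = op_rfun h A * op_rfun k A"
proof -
  \<comment> \<open>A product of uniform limits is a uniform limit when the limit functions are
    bounded.\<close>
  have bd: "bounded ((\<lambda>z. complex_of_real (f (Re z))) ` of_real ` {m..M})"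
    if "continuous_on {m..M} f" for f
  proof -
    have "bounded (of_real ` f ` {m..M} :: complex set)"
      using that by (intro compact_imp_bounded compact_continuous_image continuous_intros) auto
    then show ?thesis by (simp add: image_image)
  qed
  obtain p where p: "uniform_limit (of_real ` {m..M}) (\<lambda>n. poly (p n)) (\<lambda>z. of_real (h (Re z))) sequentially"
    "(\<lambda>n. poly_op (p n) A) \<longlonglongrightarrow> op_rfun h A" using op_rfunE[OF A h] .
  obtain q where q: "uniform_limit (of_real ` {m..M}) (\<lambda>n. poly (q n)) (\<lambda>z. of_real (k (Re z))) sequentially"
    "(\<lambda>n. poly_op (q n) A) \<longlonglongrightarrow> op_rfun k A" using op_rfunE[OF A k] .
  have "(\<lambda>n. poly_op (p n * q n) A) \<longlonglongrightarrow> op_rfun (\<lambda>x. h x * k x) A"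
    using uniform_lim_mult[OF p(1) q(1) bd[OF h] bd[OF k]]
    by (intro op_rfun_LIMSEQ[OF A]) (simp add: poly_mult[abs_def])
  moreover have "(\<lambda>n. poly_op (p n * q n) A) \<longlonglongrightarrow> op_rfun h A * op_rfun k A"
    unfolding poly_op_mult by (intro tendsto_mult p q)
  ultimately show ?thesis by (rule LIMSEQ_unique)
qed

lemma op_rfun_const [simp]:
  assumes A: "op_between m M A"
  shows "op_rfun (\<lambda>_. c) A = c *\<^sub>R 1"
proof -
  have "(\<lambda>n::nat. poly_op [:of_real c:] A) \<longlonglongrightarrow> op_rfun (\<lambda>_. c) A"
    by (rule op_rfun_LIMSEQ[OF A]) (auto intro!: uniform_limitI)
  then show ?thesis by (simp add: LIMSEQ_const_iff scaleC_op_of_real)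
qed

lemma op_rfun_id:
  assumes A: "op_between m M A"
  shows "op_rfun (\<lambda>x. x) A = A"
proof -
  have "(\<lambda>n::nat. poly_op [:0, 1:] A) \<longlonglongrightarrow> op_rfun (\<lambda>x. x) A"
    by (rule op_rfun_LIMSEQ[OF A]) (auto intro!: uniform_limitI)
  then show ?thesis by (simp add: LIMSEQ_const_iff poly_op_pCons)
qed

lemma op_rfun_scaleR:
  assumes A: "op_between m M A" and h: "continuous_on {m..M} h"
  shows "op_rfun (\<lambda>x. c * h x) A = c *\<^sub>R op_rfun h A"
  using op_rfun_mult[OF A continuous_on_const h, of c] by (simp add: op_rfun_const[OF A])

text \<open>The approximating polynomials may have complex coefficients. On a real interval the
  conjugated polynomials converge to the same real function, so the limit operator is its own
  adjoint.\<close>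

lemma selfadjoint_op_rfun:
  assumes A: "op_between m M A" and h: "continuous_on {m..M} h"
  shows "selfadjoint_op (op_rfun h A)"
proof -
  obtain p where p: "uniform_limit (of_real ` {m..M}) (\<lambda>n. poly (p n)) (\<lambda>z. of_real (h (Re z))) sequentially"
    "(\<lambda>n. poly_op (p n) A) \<longlonglongrightarrow> op_rfun h A" using op_rfunE[OF A h] .
  have q: "(\<lambda>n. poly_op (map_poly cnj (p n)) A) \<longlonglongrightarrow> op_rfun h A"
  proof (rule op_rfun_LIMSEQ[OF A], rule uniform_limitI)
    fix e :: real assume "e > 0"
    from uniform_limitD[OF p(1) this]
    show "\<forall>\<^sub>F n in sequentially. \<forall>x\<in>of_real ` {m..M}.
            dist (poly (map_poly cnj (p n)) x) (of_real (h (Re x))) < e"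
      by (rule eventually_mono)
         (auto simp: poly_map_poly_cnj dist_norm intro: order_le_less_trans[OF eq_refl[OF cnj_dist]])
  qed
  show ?thesis
    unfolding selfadjoint_iff_inner
  proof (intro allI)
    fix x y
    have "(\<lambda>n. x \<bullet> (poly_op (p n) A \<bullet>\<^sub>v y)) \<longlonglongrightarrow> x \<bullet> (op_rfun h A \<bullet>\<^sub>v y)"
      by (intro tendsto_intros tendsto_op_apply p)
    moreover have "(\<lambda>n. (poly_op (map_poly cnj (p n)) A \<bullet>\<^sub>v x) \<bullet> y) \<longlonglongrightarrow> (op_rfun h A \<bullet>\<^sub>v x) \<bullet> y"
      by (intro tendsto_intros tendsto_op_apply q)
    moreover have "x \<bullet> (poly_op (p n) A \<bullet>\<^sub>v y) = (poly_op (map_poly cnj (p n)) A \<bullet>\<^sub>v x) \<bullet> y" for n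
      using A by (simp add: inner_ell2_def poly_op_adjoint op_between_def)
    ultimately show "x \<bullet> (op_rfun h A \<bullet>\<^sub>v y) = (op_rfun h A \<bullet>\<^sub>v x) \<bullet> y"
      using LIMSEQ_unique by auto
  qed
qed

text \<open>On the interval \<open>h\<close> is the square of \<open>k\<close>, and the square of a
  self-adjoint operator is positive.\<close>

lemma op_rfun_nonneg:
  assumes A: "op_between m M A" and h: "continuous_on {m..M} h"
    and nn: "\<And>x. m \<le> x \<Longrightarrow> x \<le> M \<Longrightarrow> 0 \<le> h x"
  shows "op_le 0 (op_rfun h A)"
proof -
  define k where "k = (\<lambda>x. sqrt (h x))"
  have k: "continuous_on {m..M} k" unfolding k_def by (intro continuous_intros h)
  have "op_rfun h A = op_rfun (\<lambda>x. k x * k x) A"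
    by (rule op_rfun_cong[OF A]) (auto simp: k_def nn)
  also have "\<dots> = op_rfun k A * op_rfun k A" by (rule op_rfun_mult[OF A k k])
  finally show ?thesis
    by (simp add: op_le_square[OF selfadjoint_op_rfun[OF A k]])
qed

lemma op_rfun_mono:
  assumes A: "op_between m M A" and h: "continuous_on {m..M} h" and k: "continuous_on {m..M} k"
    and le: "\<And>x. m \<le> x \<Longrightarrow> x \<le> M \<Longrightarrow> h x \<le> k x"
  shows "op_le (op_rfun h A) (op_rfun k A)"
proof -
  have c: "continuous_on {m..M} (\<lambda>x. k x - h x)" by (intro continuous_intros h k)
  have "op_rfun k A = op_rfun (\<lambda>x. h x + (k x - h x)) A" by simp
  also have "\<dots> = op_rfun h A + op_rfun (\<lambda>x. k x - h x) A"
    by (rule op_rfun_add[OF A h c])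
  finally show ?thesis
    using op_rfun_nonneg[OF A c] le op_le_diff_iff[of "op_rfun k A" "op_rfun h A"] by simp
qed

lemma op_between_op_rfun:
  assumes A: "op_between m M A" and h: "continuous_on {m..M} h"
    and le: "\<And>x. m \<le> x \<Longrightarrow> x \<le> M \<Longrightarrow> l \<le> h x" "\<And>x. m \<le> x \<Longrightarrow> x \<le> M \<Longrightarrow> h x \<le> u"
  shows "op_between l u (op_rfun h A)"
  using op_rfun_mono[OF A continuous_on_const h le(1)] op_rfun_mono[OF A h continuous_on_const le(2)]
    selfadjoint_op_rfun[OF A h]
  by (simp add: op_between_def op_rfun_const[OF A])

lemma norm_op_rfun_le:
  assumes A: "op_between m M A" and h: "continuous_on {m..M} h"
    and le: "\<And>x. m \<le> x \<Longrightarrow> x \<le> M \<Longrightarrow> \<bar>h x\<bar> \<le> c"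
  shows "norm (op_rfun h A) \<le> c"
proof -
  have "op_between (- c) c (op_rfun h A)"
    by (rule op_between_op_rfun[OF A h]) (use le in \<open>force simp: abs_le_iff\<close>)+
  then show ?thesis
    by (auto simp: op_between_def intro: norm_selfadjoint_le)
qed

lemma op_log_eq_op_rfun:
  assumes A: "op_between m M A" and m: "0 < m"
  shows "op_log A = op_rfun ln A"
  unfolding op_log_def op_rfun_def
  by (rule op_fun_cong) (use op_spectrum_between[OF A] m in \<open>fastforce simp: Ln_of_real\<close>)

lemma op_powr_eq_op_rfun:
  assumes A: "op_between m M A" and m: "0 < m"
  shows "op_powr A s = op_rfun (\<lambda>x. x powr s) A"
  unfolding op_powr_def op_rfun_def
  by (rule op_fun_cong) (use op_spectrum_between[OF A] m in \<open>fastforce simp: powr_of_real\<close>)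

section \<open>Positive definite operators\<close>

lemma posdef_selfadjoint: "posdef_op A \<Longrightarrow> selfadjoint_op A"
  by (simp add: posdef_op_def)

lemma posdef_between:
  assumes "posdef_op A"
  obtains m M where "0 < m" "op_between m M A"
  using assms op_le_norm[of A] unfolding posdef_iff op_between_def by blast

lemma between_posdef: "op_between m M A \<Longrightarrow> 0 < m \<Longrightarrow> posdef_op A"
  by (auto simp: posdef_iff op_between_def)

lemma posdef_op_le_0:
  assumes "posdef_op A"
  shows "op_le 0 A"
proof -
  obtain c where "c > 0" "op_le (c *\<^sub>R 1) A" using assms by (auto simp: posdef_iff)
  moreover have "op_le 0 (c *\<^sub>R 1)" using \<open>c > 0\<close> by (simp add: op_le_def)
  ultimately show ?thesis using op_le_trans by blast
qed

lemma posdef_op_le: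
  assumes "posdef_op A" "selfadjoint_op B" "op_le A B"
  shows "posdef_op B"
  using assms unfolding posdef_iff by (meson op_le_trans)

lemma posdef_add:
  assumes "posdef_op A" "posdef_op B"
  shows "posdef_op (A + B)"
proof (rule posdef_op_le[OF assms(1)])
  show "selfadjoint_op (A + B)" using assms by (simp add: posdef_selfadjoint selfadjoint_add)
  show "op_le A (A + B)"
    using op_le_add[OF op_le_refl posdef_op_le_0[OF assms(2)], of A] by simp
qed

lemma posdef_sum:
  assumes "finite I" "I \<noteq> {}" "\<And>i. i \<in> I \<Longrightarrow> posdef_op (A i)"
  shows "posdef_op (\<Sum>i\<in>I. A i)"
  using assms by (induction I rule: finite_ne_induct) (auto simp: posdef_add)

lemma posdef_scaleR:
  assumes "0 < r" "posdef_op A"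
  shows "posdef_op (r *\<^sub>R A)"
proof -
  from assms obtain c where c: "c > 0" "op_le (c *\<^sub>R 1) A" "selfadjoint_op A"
    by (auto simp: posdef_iff)
  then have "op_le ((r * c) *\<^sub>R 1) (r *\<^sub>R A)"
    using op_le_scaleR[of r "c *\<^sub>R 1" A] assms by simp
  then show ?thesis
    using c assms unfolding posdef_iff by (auto intro!: exI[of _ "r * c"] selfadjoint_scaleR)
qed

lemma posdef_congruence:
  assumes "posdef_op A" "posdef_op C"
  shows "posdef_op (C * A * C)"
proof -
  obtain a where a: "a > 0" "op_le (a *\<^sub>R 1) A" "selfadjoint_op A"
    using assms(1) by (auto simp: posdef_iff)
  obtain c where c: "c > 0" "op_le (c *\<^sub>R 1) C" "selfadjoint_op C"
    using assms(2) by (auto simp: posdef_iff)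
  have "op_le ((c\<^sup>2) *\<^sub>R 1) (C * 1 * C)"
    unfolding op_le_def
  proof
    fix v
    have "c * (norm v * norm v) \<le> v \<bullet> (C \<bullet>\<^sub>v v)"
      using c(2) by (auto simp: op_le_def dot_square_norm power2_eq_square)
    also have "\<dots> \<le> norm v * norm (C \<bullet>\<^sub>v v)" by (rule norm_cauchy_schwarz)
    finally have "norm v * (c * norm v) \<le> norm v * norm (C \<bullet>\<^sub>v v)" by (simp add: mult_ac)
    then have "c * norm v \<le> norm (C \<bullet>\<^sub>v v)" by (cases "v = 0") auto
    then have "(c * norm v)\<^sup>2 \<le> (norm (C \<bullet>\<^sub>v v))\<^sup>2"
      using c(1) by (intro power_mono) auto
    then show "v \<bullet> (c\<^sup>2 *\<^sub>R 1 \<bullet>\<^sub>v v) \<le> v \<bullet> ((C * 1 * C) \<bullet>\<^sub>v v)"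
      using selfadjointD[OF c(3), of v "C \<bullet>\<^sub>v v"]
      by (simp add: dot_square_norm power_mult_distrib)
  qed
  then have "op_le ((a * c\<^sup>2) *\<^sub>R 1) (C * (a *\<^sub>R 1) * C)"
    using op_le_scaleR[of a "c\<^sup>2 *\<^sub>R 1" "C * 1 * C"] a by simp
  also have "op_le \<dots> (C * A * C)" by (rule op_le_congruence[OF c(3) a(2)])
  finally show ?thesis
    using a c unfolding posdef_iff
    by (auto intro!: exI[of _ "a * c\<^sup>2"] selfadjoint_congruence)
qed

section \<open>Powers of positive definite operators\<close>

lemma continuous_on_powr_Icc: "0 < m \<Longrightarrow> continuous_on {m..M} (\<lambda>x::real. x powr s)"
  by (intro continuous_intros) auto

lemma posdef_op_powr:
  assumes "posdef_op A"
  shows "posdef_op (op_powr A s)"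
proof -
  obtain m M where m: "0 < m" and A: "op_between m M A" using posdef_between[OF assms] .
  have mM: "m \<le> M" by (rule op_between_le[OF A])
  \<comment> \<open>The function \<open>x powr s\<close> increases or decreases according to the
    sign of \<open>s\<close>, so its minimum may sit at either endpoint.\<close>
  define l where "l = min (m powr s) (M powr s)"
  have l: "l \<le> x powr s" if "m \<le> x" "x \<le> M" for x
    using powr_mono2[of s m x] powr_mono2'[of s x M] that m
    by (cases "s \<ge> 0") (auto simp: l_def min_le_iff_disj)
  have "op_between l (max (m powr s) (M powr s)) (op_rfun (\<lambda>x. x powr s) A)"
  proof (rule op_between_op_rfun[OF A continuous_on_powr_Icc[OF m] l])
    fix x assume "m \<le> x" "x \<le> M"
    then show "x powr s \<le> max (m powr s) (M powr s)"
      using powr_mono2[of s x M] powr_mono2'[of s m x] m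
      by (cases "s \<ge> 0") (auto simp: le_max_iff_disj)
  qed auto
  moreover have "l > 0" using m mM by (simp add: l_def)
  ultimately show ?thesis
    using between_posdef by (simp add: op_powr_eq_op_rfun[OF A m])
qed

lemma op_powr_add:
  assumes "posdef_op A"
  shows "op_powr A (s + t) = op_powr A s * op_powr A t"
proof -
  obtain m M where m: "0 < m" and A: "op_between m M A" using posdef_between[OF assms] .
  show ?thesis
    using op_rfun_mult[OF A continuous_on_powr_Icc[OF m] continuous_on_powr_Icc[OF m]]
    by (simp add: op_powr_eq_op_rfun[OF A m] powr_add)
qed

lemma op_powr_one [simp]:
  assumes "posdef_op A"
  shows "op_powr A 1 = A"
proof -
  obtain m M where m: "0 < m" and A: "op_between m M A" using posdef_between[OF assms] .
  have "op_rfun (\<lambda>x. x powr 1) A = op_rfun (\<lambda>x. x) A"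
    by (rule op_rfun_cong[OF A]) (use m in auto)
  then show ?thesis
    by (simp only: op_powr_eq_op_rfun[OF A m] op_rfun_id[OF A])
qed

lemma op_powr_zero [simp]:
  assumes "posdef_op A"
  shows "op_powr A 0 = 1"
proof -
  obtain m M where m: "0 < m" and A: "op_between m M A" using posdef_between[OF assms] .
  have "op_rfun (\<lambda>x. x powr 0) A = op_rfun (\<lambda>x. 1) A"
    by (rule op_rfun_cong[OF A]) (use m in auto)
  then show ?thesis
    by (simp only: op_powr_eq_op_rfun[OF A m] op_rfun_const[OF A]) simp
qed

lemma op_powr_half_mult:
  assumes "posdef_op A"
  shows "op_powr A (1 / 2) * op_powr A (1 / 2) = A"
    "op_powr A (1 / 2) * op_powr A (- 1 / 2) = 1"
    "op_powr A (- 1 / 2) * op_powr A (1 / 2) = 1"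
    "op_powr A (- 1 / 2) * op_powr A (- 1 / 2) = op_powr A (- 1)"
  using op_powr_add[OF assms, of "1/2" "1/2"] op_powr_add[OF assms, of "1/2" "-1/2"]
    op_powr_add[OF assms, of "-1/2" "1/2"] op_powr_add[OF assms, of "-1/2" "-1/2"] assms
  by simp_all

lemma op_powr_minus_one_mult:
  assumes "posdef_op A"
  shows "op_powr A (- 1) * A = 1" "A * op_powr A (- 1) = 1"
  using op_powr_add[OF assms, of "-1" "1"] op_powr_add[OF assms, of "1" "-1"] assms
  by simp_all

lemma op_powr_minus_one_unique:
  assumes "posdef_op A" "A * J = 1"
  shows "op_powr A (- 1) = J"
  by (metis assms mult.assoc mult.left_neutral mult.right_neutral op_powr_minus_one_mult(1))

text \<open>
  At an approximate eigenvector \<open>v\<close> for a negative lower bound \<open>l\<close> of the spectrum of \<open>D = T - S\<close>,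
  \<open>0 \<le> \<parallel>T v\<parallel>\<^sup>2 - \<parallel>S v\<parallel>\<^sup>2 = \<langle>D v, (T + S) v\<rangle>\<close> is close to \<open>l \<langle>v, (T + S) v\<rangle> < 0\<close>.
\<close>

lemma op_le_of_square_le:
  assumes S: "posdef_op S" and T: "posdef_op T" and le: "op_le (S * S) (T * T)"
  shows "op_le S T"
proof (rule ccontr)
  assume "\<not> op_le S T"
  define D where "D = T - S"
  have saS: "selfadjoint_op S" and saT: "selfadjoint_op T"
    using S T by (simp_all add: posdef_selfadjoint)
  obtain w where w: "w \<bullet> (D \<bullet>\<^sub>v w) < 0"
    using \<open>\<not> op_le S T\<close> by (auto simp: op_le_def D_def inner_diff_right not_le)
  define P where "P = (\<lambda>v. v \<bullet> (D \<bullet>\<^sub>v v)) ` {v. norm v = 1}"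
  have bdd: "bdd_below P"
  proof (rule bdd_belowI[of _ "- norm D"])
    fix x assume "x \<in> P"
    then obtain v where "norm v = 1" "x = v \<bullet> (D \<bullet>\<^sub>v v)" by (auto simp: P_def)
    then show "- norm D \<le> x"
      using op_le_norm(2)[of D] by (auto simp: op_le_def dot_square_norm dest: spec[of _ v])
  qed

  have inP: "v \<bullet> (D \<bullet>\<^sub>v v) / (norm v)\<^sup>2 \<in> P" if "v \<noteq> 0" for v
    using that unfolding P_def
    by (intro image_eqI[where x = "(1 / norm v) *\<^sub>R v"]) (auto simp: power2_eq_square)
  define l where "l = Inf P"
  have "w \<noteq> 0" using w by auto
  then have "l \<le> w \<bullet> (D \<bullet>\<^sub>v w) / (norm w)\<^sup>2"
    unfolding l_def by (intro cInf_lower inP bdd)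
  also have "\<dots> < 0" using w \<open>w \<noteq> 0\<close> by (simp add: divide_less_0_iff)
  finally have "l < 0" .
  define E where "E = D - l *\<^sub>R 1"
  have saE: "selfadjoint_op E"
    by (simp add: E_def D_def selfadjoint_diff selfadjoint_scaleR saS saT)
  have E0: "op_le 0 E"
    unfolding op_le_def
  proof
    fix v
    show "v \<bullet> (0 \<bullet>\<^sub>v v) \<le> v \<bullet> (E \<bullet>\<^sub>v v)"
    proof (cases "v = 0")
      case False
      have "l \<le> v \<bullet> (D \<bullet>\<^sub>v v) / (norm v)\<^sup>2"
        unfolding l_def by (intro cInf_lower inP bdd False)
      then show ?thesis
        using False by (simp add: E_def inner_diff_right dot_square_norm field_simps)
    qed simp
  qed
  obtain c where c: "c > 0" "op_le (c *\<^sub>R 1) T" using T by (auto simp: posdef_iff)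
  define W where "W = norm (T + S)"
  \<comment> \<open>With this choice the error \<open>d * (W + 1)\<close> uses up half of
    \<open>- l * c\<close>. The \<open>e\<close> below is such that
    \<open>norm E * e \<le> d\<^sup>2\<close>: an error \<open>e\<close> in the form then costs at
    most \<open>d\<close> in norm.\<close>
  define d where "d = - l * c / (2 * (W + 1))"
  have W0: "0 \<le> W" by (simp add: W_def)
  have d0: "0 < d" unfolding d_def using \<open>l < 0\<close> c W0 by (intro divide_pos_pos mult_pos_pos) auto
  define e where "e = d\<^sup>2 / (norm E + 1)"
  have "norm E + 1 > 0" by (simp add: add_nonneg_pos)
  then have "0 < e" using d0 by (simp add: e_def)
  have "P \<noteq> {}" using inP[OF \<open>w \<noteq> 0\<close>] by blast
  then obtain x where "x \<in> P" "x < l + e"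
    using cInf_lessD[of P "l + e"] \<open>0 < e\<close> by (auto simp: l_def)
  then obtain v where v: "norm v = 1" "v \<bullet> (D \<bullet>\<^sub>v v) < l + e" by (auto simp: P_def)
  have vv: "v \<bullet> v = 1" using v by (simp add: dot_square_norm)
  have "(norm (E \<bullet>\<^sub>v v))\<^sup>2 \<le> norm E * (v \<bullet> (E \<bullet>\<^sub>v v))"
    by (rule norm_positive_op_apply[OF saE E0])
  also have "\<dots> \<le> norm E * e"
    using v vv by (intro mult_left_mono) (auto simp: E_def inner_diff_right)
  also have "\<dots> \<le> d\<^sup>2"
    using \<open>norm E + 1 > 0\<close> by (simp add: e_def field_simps)
  finally have Ed: "norm (E \<bullet>\<^sub>v v) \<le> d" using d0 by (simp add: power2_le_iff_abs_le)
  have "0 \<le> (norm (T \<bullet>\<^sub>v v))\<^sup>2 - (norm (S \<bullet>\<^sub>v v))\<^sup>2"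
    using le selfadjointD[OF saS, of v "S \<bullet>\<^sub>v v"] selfadjointD[OF saT, of v "T \<bullet>\<^sub>v v"]
    by (auto simp: op_le_def dot_square_norm dest: spec[of _ v])
  also have "\<dots> = (D \<bullet>\<^sub>v v) \<bullet> ((T + S) \<bullet>\<^sub>v v)"
    by (simp add: D_def power2_norm_eq_inner inner_diff_left inner_add_right)
       (simp add: inner_commute)
  also have "\<dots> = l * (v \<bullet> ((T + S) \<bullet>\<^sub>v v)) + (E \<bullet>\<^sub>v v) \<bullet> ((T + S) \<bullet>\<^sub>v v)"
    by (simp add: E_def inner_diff_left)
  also have "l * (v \<bullet> ((T + S) \<bullet>\<^sub>v v)) \<le> l * c"
  proof -
    have "c \<le> v \<bullet> (T \<bullet>\<^sub>v v)" "0 \<le> v \<bullet> (S \<bullet>\<^sub>v v)"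
      using c(2) posdef_op_le_0[OF S] vv by (auto simp: op_le_def dest: spec[of _ v])
    then show ?thesis using \<open>l < 0\<close> by (simp add: inner_add_right)
  qed
  also have "(E \<bullet>\<^sub>v v) \<bullet> ((T + S) \<bullet>\<^sub>v v) \<le> d * W"
  proof -
    have "(E \<bullet>\<^sub>v v) \<bullet> ((T + S) \<bullet>\<^sub>v v) \<le> norm (E \<bullet>\<^sub>v v) * norm ((T + S) \<bullet>\<^sub>v v)"
      by (rule norm_cauchy_schwarz)
    also have "\<dots> \<le> d * W"
      using Ed d0 norm_op_apply[of "T + S" v] v by (intro mult_mono) (auto simp: W_def)
    finally show ?thesis .
  qed
  also have "d * W \<le> d * (W + 1)" using d0 by simp
  also have "d * (W + 1) = - (l * c) / 2" using W0 by (simp add: d_def field_simps)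
  finally have "l * c \<ge> 0" by (simp add: mult.commute)
  then show False using \<open>l < 0\<close> c(1) by (simp add: zero_le_mult_iff)
qed

lemma op_square_unique:
  assumes "posdef_op S" "posdef_op T" "S * S = T * T"
  shows "S = T"
proof (rule op_le_antisym)
  show "op_le S T" "op_le T S"
    by (rule op_le_of_square_le; use assms in simp)+
qed (use assms in \<open>simp_all add: posdef_selfadjoint\<close>)


section \<open>The geometric mean of two operators\<close>

text \<open>The geometric mean \<open>A # B\<close>. The two lemmas that follow characterize it by
  the Riccati equation, which replaces this formula in most arguments.\<close>

definition gm :: "ell2_op \<Rightarrow> ell2_op \<Rightarrow> ell2_op" where
  "gm A B = op_powr A (1 / 2)
     * op_powr (op_powr A (- 1 / 2) * B * op_powr A (- 1 / 2)) (1 / 2) * op_powr A (1 / 2)"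

lemma posdef_gm: "posdef_op A \<Longrightarrow> posdef_op B \<Longrightarrow> posdef_op (gm A B)"
  unfolding gm_def by (intro posdef_congruence posdef_op_powr)

lemma op_powr_half_cancel:
  assumes "posdef_op A"
  shows "op_powr A (1 / 2) * (op_powr A (- 1 / 2) * B) = B"
    "op_powr A (- 1 / 2) * (op_powr A (1 / 2) * B) = B"
  by (simp_all only: op_powr_half_mult[OF assms] mult_1_left mult.assoc[symmetric])

text \<open>Conjugation by \<open>op_powr A (- 1 / 2)\<close> turns the Riccati equation into
  \<open>Y * Y = R\<close>, and positive definite square roots are unique.\<close>

lemma gm_unique:
  assumes A: "posdef_op A" and B: "posdef_op B" and X: "posdef_op X"
    and eq: "X * op_powr A (- 1) * X = B"
  shows "gm A B = X"
proof -
  define H Hi where "H = op_powr A (1 / 2)" and "Hi = op_powr A (- 1 / 2)"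
  have H: "posdef_op H" "posdef_op Hi" using A by (simp_all add: H_def Hi_def posdef_op_powr)
  have c: "H * (Hi * C) = C" "Hi * (H * C) = C" "H * Hi = 1" "Hi * H = 1" for C
    using op_powr_half_cancel[OF A] op_powr_half_mult[OF A] by (simp_all add: H_def Hi_def)
  define R where "R = Hi * B * Hi"
  have R: "posdef_op R" unfolding R_def by (intro posdef_congruence B H)
  have "X * (Hi * Hi) * X = B"
    using eq op_powr_half_mult(4)[OF A] by (simp add: Hi_def)
  moreover have "(Hi * X * Hi) * (Hi * X * Hi) = Hi * (X * (Hi * Hi) * X) * Hi"
    by (simp add: mult.assoc)
  ultimately have "(Hi * X * Hi) * (Hi * X * Hi) = R" by (simp add: R_def)
  also have "R = op_powr R (1 / 2) * op_powr R (1 / 2)"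
    by (simp add: op_powr_half_mult[OF R])
  finally have "Hi * X * Hi = op_powr R (1 / 2)"
    by (rule op_square_unique[rotated 2]) (intro posdef_congruence posdef_op_powr X H R)+
  then have "gm A B = H * (Hi * X * Hi) * H"
    by (simp add: gm_def R_def H_def Hi_def)
  also have "\<dots> = X" by (simp add: mult.assoc c)
  finally show ?thesis .
qed

lemma gm_riccati:
  assumes A: "posdef_op A" and B: "posdef_op B"
  shows "gm A B * op_powr A (- 1) * gm A B = B"
proof -
  define H Hi where "H = op_powr A (1 / 2)" and "Hi = op_powr A (- 1 / 2)"
  have H: "posdef_op H" "posdef_op Hi" using A by (simp_all add: H_def Hi_def posdef_op_powr)
  have c: "H * (Hi * C) = C" "Hi * (H * C) = C" "H * Hi = 1" "Hi * H = 1" for C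
    using op_powr_half_cancel[OF A] op_powr_half_mult[OF A] by (simp_all add: H_def Hi_def)
  define R where "R = Hi * B * Hi"
  have R: "posdef_op R" unfolding R_def by (intro posdef_congruence B H)
  define Q where "Q = op_powr R (1 / 2)"
  have QQ: "Q * (Q * C) = R * C" for C
    unfolding Q_def by (simp add: op_powr_half_mult[OF R] flip: mult.assoc)
  have "gm A B = H * Q * H" by (simp add: gm_def R_def Q_def H_def Hi_def)
  moreover have "op_powr A (- 1) = Hi * Hi" using op_powr_half_mult(4)[OF A] by (simp add: Hi_def)
  ultimately show ?thesis by (simp add: mult.assoc c QQ) (simp add: R_def mult.assoc c)
qed

text \<open>Inverting the Riccati equation for \<open>X\<close> yields the same equation with
  \<open>A\<close> and \<open>B\<close> exchanged.\<close>

lemma gm_commute: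
  assumes A: "posdef_op A" and B: "posdef_op B"
  shows "gm B A = gm A B"
proof -
  define X where "X = gm A B"
  have X: "posdef_op X" using A B by (simp add: X_def posdef_gm)
  define X' where "X' = op_powr X (- 1)"
  have c: "X * (X' * C) = C" "X' * (X * C) = C" "X * X' = 1" "X' * X = 1" for C
    using op_powr_minus_one_mult[OF X] by (simp_all add: X'_def flip: mult.assoc)
  have J: "op_powr A (- 1) * (A * C) = C" for C
    using op_powr_minus_one_mult[OF A] by (simp flip: mult.assoc)
  have B_eq: "B = X * op_powr A (- 1) * X" using gm_riccati[OF A B] by (simp add: X_def)
  have "B * (X' * A * X') = 1"
    unfolding B_eq by (simp add: mult.assoc c J)
  then have "op_powr B (- 1) = X' * A * X'" by (rule op_powr_minus_one_unique[OF B])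
  then have "X * op_powr B (- 1) * X = A" by (simp add: mult.assoc c)
  from gm_unique[OF B A X this] show ?thesis unfolding X_def .
qed

lemma gm_self: "posdef_op A \<Longrightarrow> gm A A = A"
  by (rule gm_unique) (simp_all only: op_powr_minus_one_mult mult_1_left)

lemma gm_mono_right:
  assumes A: "posdef_op A" and B: "posdef_op B" and C: "posdef_op C" and le: "op_le B C"
  shows "op_le (gm A B) (gm A C)"
proof -
  let ?Hi = "op_powr A (- 1 / 2)"
  have Hi: "posdef_op ?Hi" by (rule posdef_op_powr[OF A])
  have *: "posdef_op (?Hi * B * ?Hi)" "posdef_op (?Hi * C * ?Hi)"
    by (intro posdef_congruence B C Hi)+
  have "op_le (?Hi * B * ?Hi) (?Hi * C * ?Hi)"
    by (intro op_le_congruence posdef_selfadjoint Hi le)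
  then have "op_le (op_powr (?Hi * B * ?Hi) (1 / 2)) (op_powr (?Hi * C * ?Hi) (1 / 2))"
    using * by (metis op_le_of_square_le op_powr_half_mult(1) posdef_op_powr)
  then show ?thesis
    unfolding gm_def by (intro op_le_congruence posdef_selfadjoint posdef_op_powr A)
qed

text \<open>The defining formula shows monotonicity only in the second argument, where it is that of
  the square root. Commuting twice brings the first argument into that place.\<close>

lemma gm_mono:
  assumes "posdef_op A" "posdef_op B" "posdef_op A'" "posdef_op B'" "op_le A A'" "op_le B B'"
  shows "op_le (gm A B) (gm A' B')"
proof -
  have "op_le (gm A B) (gm A B')" using assms by (intro gm_mono_right)
  also have "gm A B' = gm B' A" using assms by (intro gm_commute)
  also have "op_le \<dots> (gm B' A')" using assms by (intro gm_mono_right)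
  also have "\<dots> = gm A' B'" using assms by (intro gm_commute)
  finally show ?thesis .
qed

lemma gm_scaleR:
  assumes A: "posdef_op A" and B: "posdef_op B" and c: "0 < c" and d: "0 < d"
  shows "gm (c *\<^sub>R A) (d *\<^sub>R B) = sqrt (c * d) *\<^sub>R gm A B"
proof (rule gm_unique)
  have J: "op_powr (c *\<^sub>R A) (- 1) = (1 / c) *\<^sub>R op_powr A (- 1)"
    using A c by (intro op_powr_minus_one_unique posdef_scaleR) (auto simp: op_powr_minus_one_mult)
  have "(sqrt (c * d) *\<^sub>R gm A B) * op_powr (c *\<^sub>R A) (- 1) * (sqrt (c * d) *\<^sub>R gm A B)
      = (sqrt (c * d) * sqrt (c * d) / c) *\<^sub>R (gm A B * op_powr A (- 1) * gm A B)"
    by (simp add: J)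
  also have "sqrt (c * d) * sqrt (c * d) / c = d"
    using c d by simp
  finally show "(sqrt (c * d) *\<^sub>R gm A B) * op_powr (c *\<^sub>R A) (- 1) * (sqrt (c * d) *\<^sub>R gm A B) = d *\<^sub>R B"
    by (simp add: gm_riccati[OF A B])
qed (use assms in \<open>auto intro!: posdef_scaleR posdef_gm\<close>)


section \<open>The Thompson metric\<close>

text \<open>\<open>thompson_le r A B\<close> says that the Thompson distance of \<open>A\<close> and \<open>B\<close> is at most \<open>r\<close>.\<close>

definition thompson_le :: "real \<Rightarrow> ell2_op \<Rightarrow> ell2_op \<Rightarrow> bool" where
  "thompson_le r A B \<longleftrightarrow> op_le A (exp r *\<^sub>R B) \<and> op_le B (exp r *\<^sub>R A)"

lemma thompson_le_refl [simp]: "thompson_le 0 A A"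
  by (simp add: thompson_le_def)

lemma thompson_le_sym: "thompson_le r A B \<Longrightarrow> thompson_le r B A"
  by (simp add: thompson_le_def)

lemma thompson_le_trans:
  assumes "thompson_le r A B" "thompson_le s B C"
  shows "thompson_le (r + s) A C"
proof -
  have "op_le A (exp r *\<^sub>R exp s *\<^sub>R C)"
    by (rule op_le_trans[OF _ op_le_scaleR]) (use assms in \<open>auto simp: thompson_le_def\<close>)
  moreover have "op_le C (exp s *\<^sub>R exp r *\<^sub>R A)"
    by (rule op_le_trans[OF _ op_le_scaleR]) (use assms in \<open>auto simp: thompson_le_def\<close>)
  ultimately show ?thesis by (simp add: thompson_le_def exp_add mult.commute)
qed

lemma thompson_le_mono:
  assumes "thompson_le r A B" "r \<le> s" "posdef_op A" "posdef_op B"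
  shows "thompson_le s A B"
proof -
  have le: "op_le (exp r *\<^sub>R A) (exp s *\<^sub>R A)" "op_le (exp r *\<^sub>R B) (exp s *\<^sub>R B)"
    by (rule op_le_scaleR_left; use assms posdef_op_le_0 in simp)+
  show ?thesis
    using assms(1) op_le_trans[OF _ le(1), of B] op_le_trans[OF _ le(2), of A]
    unfolding thompson_le_def by blast
qed

lemma thompson_le_sum:
  assumes "\<And>i. i \<in> I \<Longrightarrow> thompson_le r (A i) (B i)"
  shows "thompson_le r (\<Sum>i\<in>I. A i) (\<Sum>i\<in>I. B i)"
  using assms by (auto simp: thompson_le_def scaleR_sum_right intro!: op_le_sum)

lemma thompson_le_scaleR:
  assumes "0 \<le> c" "thompson_le r A B"
  shows "thompson_le r (c *\<^sub>R A) (c *\<^sub>R B)"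
  using assms op_le_scaleR[of c A "exp r *\<^sub>R B"] op_le_scaleR[of c B "exp r *\<^sub>R A"]
  by (simp add: thompson_le_def mult.commute)

lemma thompson_le_congruence:
  assumes "selfadjoint_op C" "thompson_le r A B"
  shows "thompson_le r (C * A * C) (C * B * C)"
  using assms op_le_congruence[of C A "exp r *\<^sub>R B"] op_le_congruence[of C B "exp r *\<^sub>R A"]
  by (simp add: thompson_le_def)

lemma thompson_le_0_iff:
  assumes "selfadjoint_op A" "selfadjoint_op B"
  shows "thompson_le 0 A B \<longleftrightarrow> A = B"
  using op_le_antisym[OF assms] by (auto simp: thompson_le_def)

lemma thompson_le_LIMSEQ:
  assumes "A \<longlonglongrightarrow> A'" "B \<longlonglongrightarrow> B'" "r \<longlonglongrightarrow> r'" "\<And>n::nat. thompson_le (r n) (A n) (B n)"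
  shows "thompson_le r' A' B'"
  unfolding thompson_le_def
proof
  show "op_le A' (exp r' *\<^sub>R B')"
    by (rule op_le_LIMSEQ[where A = A and B = "\<lambda>n. exp (r n) *\<^sub>R B n"])
       (use assms in \<open>auto intro!: tendsto_intros simp: thompson_le_def\<close>)
  show "op_le B' (exp r' *\<^sub>R A')"
    by (rule op_le_LIMSEQ[where A = B and B = "\<lambda>n. exp (r n) *\<^sub>R A n"])
       (use assms in \<open>auto intro!: tendsto_intros simp: thompson_le_def\<close>)
qed

lemma thompson_le_limit:
  assumes "r \<longlonglongrightarrow> r'" "\<And>n::nat. thompson_le (r n) A B"
  shows "thompson_le r' A B"
  by (rule thompson_le_LIMSEQ[OF tendsto_const tendsto_const assms])

lemma op_le_exp_scaleR:
  assumes "op_le A (M *\<^sub>R 1)" "op_le (m *\<^sub>R 1) B" "0 < m" "M / m \<le> exp r"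
  shows "op_le A (exp r *\<^sub>R B)"
proof -
  have "op_le ((M / m) *\<^sub>R m *\<^sub>R 1) (exp r *\<^sub>R m *\<^sub>R 1)"
    unfolding scaleR_scaleR using assms by (intro op_le_scaleR_one mult_right_mono) auto
  also have "op_le \<dots> (exp r *\<^sub>R B)" by (intro op_le_scaleR assms) auto
  finally show ?thesis using assms by (auto intro: op_le_trans)
qed

lemma thompson_le_exists:
  assumes "posdef_op A" "posdef_op B"
  obtains r where "0 \<le> r" "thompson_le r A B"
proof -
  obtain m M where A: "0 < m" "op_between m M A" using posdef_between[OF assms(1)] .
  obtain k K where B: "0 < k" "op_between k K B" using posdef_between[OF assms(2)] .
  define r where "r = max 0 (max (ln (M / k)) (ln (K / m)))"
  have "M > 0" "K > 0" using A B op_between_le by fastforce+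
  have le: "x \<le> exp y" if "x > 0" "ln x \<le> y" for x y :: real
    using that by (metis exp_le_cancel_iff exp_ln)
  have "M / k \<le> exp r" "K / m \<le> exp r"
    using \<open>M > 0\<close> \<open>K > 0\<close> A B by (auto intro!: le simp: r_def)
  then have "thompson_le r A B"
    using A B unfolding thompson_le_def op_between_def by (blast intro: op_le_exp_scaleR)
  then show ?thesis using that[of r] by (simp add: r_def)
qed

text \<open>Monotonicity lets the factors \<open>exp r\<close> and \<open>exp s\<close> in, and
  homogeneity takes them out as the square root of their product, which averages the exponents.
  Every contraction factor below comes from this average.\<close>

lemma thompson_le_gm:
  assumes pd: "posdef_op A" "posdef_op B" "posdef_op A'" "posdef_op B'"
    and r: "thompson_le r A A'" and s: "thompson_le s B B'"
  shows "thompson_le ((r + s) / 2) (gm A B) (gm A' B')"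
proof -
  have *: "op_le (gm A B) (exp ((r + s) / 2) *\<^sub>R gm A' B')"
    if pd: "posdef_op A" "posdef_op B" "posdef_op A'" "posdef_op B'"
      and r: "thompson_le r A A'" and s: "thompson_le s B B'" for A B A' B'
  proof -
    have "op_le (gm A B) (gm (exp r *\<^sub>R A') (exp s *\<^sub>R B'))"
      using that by (intro gm_mono posdef_scaleR) (auto simp: thompson_le_def)
    also have "\<dots> = sqrt (exp r * exp s) *\<^sub>R gm A' B'"
      using pd by (intro gm_scaleR) auto
    also have "sqrt (exp r * exp s) = exp ((r + s) / 2)"
      by (simp add: exp_add[symmetric] exp_half_le2 real_sqrt_unique power2_eq_square)
    finally show ?thesis .
  qed
  show ?thesis
    unfolding thompson_le_def using assms by (intro conjI *) (auto intro: thompson_le_sym)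
qed

text \<open>From \<open>A\<close> below \<open>exp r *\<^sub>R B\<close> follows
  \<open>A - B\<close> below \<open>(exp r - 1) *\<^sub>R B\<close>. Under a common upper bound
  \<open>C\<close>, Thompson closeness is thus norm closeness.\<close>

lemma thompson_le_norm:
  assumes "selfadjoint_op A" "selfadjoint_op B" "thompson_le r A B" "0 \<le> r"
    and "op_le A (C *\<^sub>R 1)" "op_le B (C *\<^sub>R 1)"
  shows "norm (A - B) \<le> (exp r - 1) * C"
proof -
  have *: "op_le (A - B) (((exp r - 1) * C) *\<^sub>R 1)"
    if "op_le A (exp r *\<^sub>R B)" "op_le B (C *\<^sub>R 1)" for A B
  proof -
    have "op_le (A - B) ((exp r - 1) *\<^sub>R B)"
      using that(1) by (simp add: op_le_def inner_diff_right algebra_simps)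
    also have "op_le \<dots> ((exp r - 1) *\<^sub>R C *\<^sub>R 1)"
      using that(2) assms(4) by (intro op_le_scaleR) auto
    finally show ?thesis by simp
  qed
  show ?thesis
  proof (rule norm_selfadjoint_le)
    have "op_le (B - A) (((exp r - 1) * C) *\<^sub>R 1)"
      using assms by (intro *) (auto simp: thompson_le_def)
    then show "op_le ((- ((exp r - 1) * C)) *\<^sub>R 1) (A - B)"
      by (auto simp: op_le_def inner_diff_right algebra_simps)
  qed (use assms in \<open>auto simp: selfadjoint_diff thompson_le_def intro!: *\<close>)
qed

text \<open>The passage from norm to Thompson distance at the identity. The lower bound
  \<open>c\<close> makes the additive error \<open>d\<close> a multiplicative one, since
  \<open>d *\<^sub>R 1\<close> is at most \<open>(d / c) *\<^sub>R M\<close>; by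
  \<open>c \<le> 1\<close> the same rate serves the upper side.\<close>

lemma thompson_le_one:
  assumes "op_le (c *\<^sub>R 1) M" "0 < c" "c \<le> 1" "norm (M - 1) \<le> d"
  shows "thompson_le (d / c) M 1"
proof -
  have "0 \<le> d" using assms(4) norm_ge_zero order_trans by blast
  have "op_le (M - 1) (norm (M - 1) *\<^sub>R 1)" "op_le (norm (M - 1) *\<^sub>R 1) (d *\<^sub>R 1)"
    by (auto intro!: op_le_norm op_le_scaleR_one assms)
  then have "op_le (M - 1) (d *\<^sub>R 1)" by (rule op_le_trans)
  then have "op_le M ((1 + d) *\<^sub>R 1)"
    by (simp add: op_le_def inner_diff_right algebra_simps)
  moreover have "1 + d \<le> exp (d / c)"
  proof -
    have "1 + d \<le> 1 + d / c" using \<open>0 \<le> d\<close> assms by (simp add: field_simps mult_left_le_one_le)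
    also have "\<dots> \<le> exp (d / c)" by (rule exp_ge_add_one_self)
    finally show ?thesis .
  qed
  ultimately have 1: "op_le M (exp (d / c) *\<^sub>R 1)"
    using op_le_trans op_le_scaleR_one by blast
  have "op_le ((- norm (M - 1)) *\<^sub>R 1) (M - 1)" "op_le ((- d) *\<^sub>R 1) ((- norm (M - 1)) *\<^sub>R 1)"
    by (rule op_le_norm, rule op_le_scaleR_one) (use assms in simp)
  then have "op_le ((- d) *\<^sub>R 1) (M - 1)" using op_le_trans by blast
  then have "op_le 1 (M + (d / c) *\<^sub>R c *\<^sub>R 1)"
    using assms by (auto simp: op_le_def inner_diff_right inner_add_right algebra_simps)
  also have "op_le \<dots> (M + (d / c) *\<^sub>R M)"
    using assms \<open>0 \<le> d\<close> by (intro op_le_add op_le_scaleR) auto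
  also have "M + (d / c) *\<^sub>R M = (1 + d / c) *\<^sub>R M" by (simp add: scaleR_add_left)
  also have "op_le \<dots> (exp (d / c) *\<^sub>R M)"
  proof (rule op_le_scaleR_left[OF exp_ge_add_one_self])
    have "op_le 0 (c *\<^sub>R 1)" using assms by (simp add: op_le_def)
    then show "op_le 0 M" using assms(1) op_le_trans by blast
  qed
  finally show ?thesis using 1 by (simp add: thompson_le_def)
qed

text \<open>A distance \<open>\<delta>\<close> with
  \<open>\<delta> \<le> (1 - s) * \<delta> + s * b\<close> satisfies
  \<open>\<delta> \<le> b\<close>. Here only upper bounds are at hand, so the improvement is
  iterated; the excess over \<open>b\<close> shrinks by \<open>1 - s\<close> each time.\<close>

lemma thompson_le_absorb:
  assumes s: "0 < s" "s \<le> 1" and r0: "thompson_le r0 X Y"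
    and step: "\<And>r. thompson_le r X Y \<Longrightarrow> thompson_le ((1 - s) * r + s * b) X Y"
  shows "thompson_le b X Y"
proof -
  have all: "thompson_le (b + (1 - s) ^ k * (r0 - b)) X Y" for k
  proof (induction k)
    case (Suc k)
    from step[OF this] show ?case by (simp add: algebra_simps)
  qed (use r0 in simp)
  have "(\<lambda>k. b + (1 - s) ^ k * (r0 - b)) \<longlonglongrightarrow> b + 0 * (r0 - b)"
    using s by (intro tendsto_intros LIMSEQ_realpow_zero) auto
  from thompson_le_limit[OF this all] show ?thesis by simp
qed

text \<open>Completeness of the Thompson metric. From some index on the sequence stays between two
  positive multiples of \<open>1\<close>: the upper one converts Thompson bounds into norm bounds,
  the lower one keeps the limit positive definite.\<close>

lemma thompson_Cauchy_convergent:
  assumes pd: "\<And>n. posdef_op (Y n)"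
    and C: "\<And>e. 0 < e \<Longrightarrow> \<exists>N. \<forall>m\<ge>N. \<forall>n\<ge>N. thompson_le e (Y m) (Y n)"
  shows "\<exists>X. posdef_op X \<and> Y \<longlonglongrightarrow> X \<and> (\<forall>e>0. \<exists>N. \<forall>n\<ge>N. thompson_le e (Y n) X)"
proof -
  obtain N1 where N1: "\<And>n. n \<ge> N1 \<Longrightarrow> thompson_le 1 (Y n) (Y N1)"
    using C[of 1] by auto
  obtain l u where lu: "0 < l" "op_between l u (Y N1)" using posdef_between[OF pd] .
  define D where "D = exp 1 * u"
  have "u > 0" using lu op_between_le by fastforce
  then have "D > 0" by (simp add: D_def)
  have up: "op_le (Y n) (D *\<^sub>R 1)" if "n \<ge> N1" for n
  proof -
    have "op_le (Y n) (exp 1 *\<^sub>R Y N1)" using N1[OF that] by (simp add: thompson_le_def)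
    also have "op_le \<dots> (exp 1 *\<^sub>R u *\<^sub>R 1)"
      using lu by (intro op_le_scaleR) (auto simp: op_between_def)
    finally show ?thesis by (simp add: D_def)
  qed
  have lo: "op_le ((exp (- 1) * l) *\<^sub>R 1) (Y n)" if "n \<ge> N1" for n
  proof -
    have "op_le (l *\<^sub>R 1) (exp 1 *\<^sub>R Y n)"
      using N1[OF that] lu unfolding thompson_le_def op_between_def by (meson op_le_trans)
    then have "op_le (exp (- 1) *\<^sub>R l *\<^sub>R 1) (exp (- 1) *\<^sub>R exp 1 *\<^sub>R Y n)"
      by (intro op_le_scaleR) auto
    then show ?thesis by (simp add: exp_minus)
  qed
  have "Cauchy Y"
  proof (rule CauchyI)
    fix e :: real assume "0 < e"
    \<comment> \<open>Solves \<open>(exp d - 1) * D = e / 2\<close>.\<close>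
    define d where "d = ln (1 + e / (2 * D))"
    have "d > 0" unfolding d_def using \<open>0 < e\<close> \<open>D > 0\<close> by (intro ln_gt_zero) simp
    then obtain N where N: "\<forall>m\<ge>N. \<forall>n\<ge>N. thompson_le d (Y m) (Y n)" using C by blast
    have "norm (Y m - Y n) < e" if "m \<ge> max N N1" "n \<ge> max N N1" for m n
    proof -
      have "norm (Y m - Y n) \<le> (exp d - 1) * D"
        using that N \<open>d > 0\<close> by (intro thompson_le_norm posdef_selfadjoint pd up) auto
      also have "exp d = 1 + e / (2 * D)"
        unfolding d_def using \<open>0 < e\<close> \<open>D > 0\<close> by (intro exp_ln add_pos_pos) auto
      also have "(1 + e / (2 * D) - 1) * D = e / 2" using \<open>D > 0\<close> by simp
      finally show ?thesis using \<open>0 < e\<close> by simp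
    qed
    then show "\<exists>M. \<forall>m\<ge>M. \<forall>n\<ge>M. norm (Y m - Y n) < e" by blast
  qed
  then obtain X where X: "Y \<longlonglongrightarrow> X" using Cauchy_convergent convergent_def by blast
  have "selfadjoint_op X" using X by (rule selfadjoint_LIMSEQ) (simp add: pd posdef_selfadjoint)
  moreover have "op_le ((exp (- 1) * l) *\<^sub>R 1) X"
    by (rule op_le_LIMSEQ[OF tendsto_const LIMSEQ_ignore_initial_segment[OF X, of N1]]) (simp add: lo)
  ultimately have "posdef_op X"
    using lu unfolding posdef_iff by (auto intro!: exI[of _ "exp (- 1) * l"])
  moreover have "\<exists>N. \<forall>n\<ge>N. thompson_le e (Y n) X" if "e > 0" for e
  proof -
    obtain N where N: "\<forall>m\<ge>N. \<forall>n\<ge>N. thompson_le e (Y m) (Y n)" using C \<open>e > 0\<close> by blast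
    have "thompson_le e (Y n) X" if "n \<ge> N" for n
      by (rule thompson_le_LIMSEQ[OF tendsto_const LIMSEQ_ignore_initial_segment[OF X, of N] tendsto_const])
         (use N that in auto)
    then show ?thesis by blast
  qed
  ultimately show ?thesis using X by blast
qed

section \<open>Weighted geometric means\<close>

text \<open>The weighted mean of \<open>X\<close> and \<open>A\<close> with weight
  \<open>1 / 2 ^ n\<close> on \<open>A\<close>. Built by halving, it inherits all its order
  properties from \<open>gm\<close>.\<close>

fun gmn :: "nat \<Rightarrow> ell2_op \<Rightarrow> ell2_op \<Rightarrow> ell2_op" where
  "gmn 0 X A = A"
| "gmn (Suc n) X A = gm X (gmn n X A)"

lemma posdef_gmn: "posdef_op X \<Longrightarrow> posdef_op A \<Longrightarrow> posdef_op (gmn n X A)"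
  by (induction n) (simp_all add: posdef_gm)

lemma gmn_self: "posdef_op X \<Longrightarrow> gmn n X X = X"
  by (induction n) (simp_all add: gm_self)

lemma thompson_le_gmn:
  assumes pd: "posdef_op X" "posdef_op A" "posdef_op Y" "posdef_op B"
    and r: "thompson_le r X Y" and q: "thompson_le q A B"
  shows "thompson_le ((1 - 1 / 2 ^ n) * r + 1 / 2 ^ n * q) (gmn n X A) (gmn n Y B)"
proof (induction n)
  case (Suc n)
  have "thompson_le ((r + ((1 - 1 / 2 ^ n) * r + 1 / 2 ^ n * q)) / 2)
      (gmn (Suc n) X A) (gmn (Suc n) Y B)"
    unfolding gmn.simps by (intro thompson_le_gm posdef_gmn pd r Suc)
  then show ?case by (simp add: field_simps)
qed (use q in simp)

text \<open>Both sides are positive definite square roots of \<open>op_powr A s\<close>; this takes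
  the place of a composition rule for the functional calculus.\<close>

lemma op_powr_powr_half:
  assumes "posdef_op A"
  shows "op_powr (op_powr A s) (1 / 2) = op_powr A (s / 2)"
proof (rule op_square_unique)
  have "posdef_op (op_powr A s)" by (rule posdef_op_powr[OF assms])
  then show "op_powr (op_powr A s) (1 / 2) * op_powr (op_powr A s) (1 / 2)
      = op_powr A (s / 2) * op_powr A (s / 2)"
    using op_powr_add[OF assms, of "s / 2" "s / 2"] by (simp add: op_powr_half_mult)
qed (intro posdef_op_powr assms)+

text \<open>Conjugation by \<open>op_powr X (- 1 / 2)\<close> carries \<open>X\<close> to
  \<open>1\<close>, and there each step of \<open>gmn\<close> is a square root.\<close>

lemma gmn_eq:
  assumes X: "posdef_op X" and A: "posdef_op A"
  shows "gmn n X A = op_powr X (1 / 2)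
    * op_powr (op_powr X (- 1 / 2) * A * op_powr X (- 1 / 2)) (1 / 2 ^ n) * op_powr X (1 / 2)"
proof -
  define H Hi where "H = op_powr X (1 / 2)" and "Hi = op_powr X (- 1 / 2)"
  have H: "posdef_op H" "posdef_op Hi" using X by (simp_all add: H_def Hi_def posdef_op_powr)
  have c: "H * (Hi * C) = C" "Hi * (H * C) = C" "H * Hi = 1" "Hi * H = 1" for C
    using op_powr_half_cancel[OF X] op_powr_half_mult[OF X] by (simp_all add: H_def Hi_def)
  define B where "B = Hi * A * Hi"
  have B: "posdef_op B" unfolding B_def by (intro posdef_congruence A H)
  have "gmn n X A = H * op_powr B (1 / 2 ^ n) * H"
  proof (induction n)
    case 0
    have "A = H * B * H" by (simp add: B_def mult.assoc c)
    then show ?case using B by simp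
  next
    case (Suc n)
    have "gmn (Suc n) X A = H * op_powr (Hi * (H * op_powr B (1 / 2 ^ n) * H) * Hi) (1 / 2) * H"
      by (simp only: gmn.simps Suc gm_def H_def Hi_def)
    also have "Hi * (H * op_powr B (1 / 2 ^ n) * H) * Hi = op_powr B (1 / 2 ^ n)"
      by (simp add: mult.assoc c)
    finally show ?case by (simp add: op_powr_powr_half[OF B] mult.commute)
  qed
  then show ?thesis by (simp add: B_def H_def Hi_def)
qed

lemma exp_minus_linear_bound: "\<bar>exp u - 1 - u\<bar> \<le> exp \<bar>u\<bar> * u\<^sup>2" for u :: real
  using Taylor_exp_field[of u 1] by (simp add: power2_eq_square diff_diff_eq)

text \<open>For \<open>u = s * ln x\<close> the difference is the error of \<open>exp u\<close>
  against \<open>1 + u\<close>. On the spectral interval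
  \<open>\<bar>u\<bar> \<le> s * R \<le> R\<close>, which gives a constant independent of
  \<open>s\<close>.\<close>

lemma op_powr_expansion:
  assumes B: "op_between (exp (- R)) (exp R) B" and R: "0 \<le> R" and s: "0 \<le> s" "s \<le> 1"
  shows "norm (op_powr B s - 1 - s *\<^sub>R op_log B) \<le> s\<^sup>2 * (R\<^sup>2 * exp R)"
proof -
  let ?I = "{exp (- R)..exp R}"
  have pos: "x > 0" if "exp (- R) \<le> x" for x using that by (meson exp_gt_zero less_le_trans)
  have cln: "continuous_on ?I ln" by (intro continuous_intros) (use pos in force)
  have cpw: "continuous_on ?I (\<lambda>x. x powr s)" by (rule continuous_on_powr_Icc) simp
  have csln: "continuous_on ?I (\<lambda>x. (- s) * ln x)" by (intro continuous_intros cln)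
  have csum: "continuous_on ?I (\<lambda>x. - 1 + (- s) * ln x)" by (intro continuous_intros csln cln)
  have "op_powr B s - 1 - s *\<^sub>R op_log B = op_rfun (\<lambda>x. x powr s + (- 1 + (- s) * ln x)) B"
    unfolding op_rfun_add[OF B cpw csum] op_rfun_add[OF B continuous_on_const csln]
      op_rfun_const[OF B] op_rfun_scaleR[OF B cln]
    using op_powr_eq_op_rfun[OF B] op_log_eq_op_rfun[OF B] by simp
  also have "norm \<dots> \<le> s\<^sup>2 * (R\<^sup>2 * exp R)"
  proof (rule norm_op_rfun_le[OF B])
    fix x assume x: "exp (- R) \<le> x" "x \<le> exp R"
    then have "x > 0" using pos by blast
    then have "ln x \<le> R" "- R \<le> ln x" using x
      ln_le_cancel_iff[of x "exp R"] ln_le_cancel_iff[of "exp (- R)" x] by simp_all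
    then have l: "\<bar>ln x\<bar> \<le> R" by simp
    define u where "u = s * ln x"
    have u: "\<bar>u\<bar> \<le> s * R" using l s by (simp add: u_def abs_mult mult_left_mono)
    also have "s * R \<le> R" using s R by (simp add: mult_left_le_one_le)
    finally have uR: "\<bar>u\<bar> \<le> R" .
    have "\<bar>x powr s + (- 1 + - s * ln x)\<bar> = \<bar>exp u - 1 - u\<bar>"
      using \<open>x > 0\<close> by (simp add: powr_def u_def algebra_simps)
    also have "\<dots> \<le> exp \<bar>u\<bar> * u\<^sup>2" by (rule exp_minus_linear_bound)
    also have "\<dots> \<le> exp R * (s * R)\<^sup>2"
      using u uR by (intro mult_mono) (auto simp: abs_le_square_iff[symmetric])
    finally show "\<bar>x powr s + (- 1 + - s * ln x)\<bar> \<le> s\<^sup>2 * (R\<^sup>2 * exp R)"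
      by (simp add: power_mult_distrib mult_ac)
  qed (intro continuous_intros cpw csum)
  finally show ?thesis .
qed


section \<open>Existence and uniqueness of the Karcher mean\<close>

text \<open>Collects what keeps the iteration inside the algebra: polynomials and norm limits, hence
  the functional calculus. The existence proof can then ignore symbols and compact
  operators.\<close>

locale closed_op_algebra =
  fixes Q :: "ell2_op set"
  assumes one: "1 \<in> Q"
    and add: "A \<in> Q \<Longrightarrow> B \<in> Q \<Longrightarrow> A + B \<in> Q"
    and mult: "A \<in> Q \<Longrightarrow> B \<in> Q \<Longrightarrow> A * B \<in> Q"
    and scaleC: "A \<in> Q \<Longrightarrow> scaleC_op c A \<in> Q"
    and LIMSEQ: "(\<And>n. S n \<in> Q) \<Longrightarrow> S \<longlonglongrightarrow> A \<Longrightarrow> A \<in> Q"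
begin

lemma scaleR: "A \<in> Q \<Longrightarrow> r *\<^sub>R A \<in> Q"
  using scaleC[of A "of_real r"] by (simp add: scaleC_op_of_real)

lemma zero: "0 \<in> Q"
  using scaleR[OF one, of 0] by simp

lemma sum: "(\<And>i. i \<in> I \<Longrightarrow> A i \<in> Q) \<Longrightarrow> (\<Sum>i\<in>I. A i) \<in> Q"
  by (induction I rule: infinite_finite_induct) (auto simp: zero add)

lemma poly_op: "A \<in> Q \<Longrightarrow> poly_op p A \<in> Q"
  by (induction p) (auto simp: poly_op_pCons zero one add mult scaleC)

lemma op_rfun:
  assumes "op_between m M A" "continuous_on {m..M} h" "A \<in> Q"
  shows "op_rfun h A \<in> Q"
proof -
  obtain q where "(\<lambda>n. poly_op (q n) A) \<longlonglongrightarrow> op_rfun h A" using op_rfunE[OF assms(1,2)] .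
  then show ?thesis by (rule LIMSEQ[rotated]) (rule poly_op[OF assms(3)])
qed

lemma op_powr:
  assumes "posdef_op A" "A \<in> Q"
  shows "op_powr A s \<in> Q"
proof -
  obtain m M where m: "0 < m" and A: "op_between m M A" using posdef_between[OF assms(1)] .
  show ?thesis
    unfolding op_powr_eq_op_rfun[OF A m]
    by (rule op_rfun[OF A continuous_on_powr_Icc[OF m] assms(2)])
qed

lemma gm: "posdef_op A \<Longrightarrow> posdef_op B \<Longrightarrow> A \<in> Q \<Longrightarrow> B \<in> Q \<Longrightarrow> gm A B \<in> Q"
  unfolding gm_def by (intro mult op_powr posdef_congruence posdef_op_powr)

lemma gmn: "posdef_op X \<Longrightarrow> posdef_op A \<Longrightarrow> X \<in> Q \<Longrightarrow> A \<in> Q \<Longrightarrow> gmn n X A \<in> Q"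
  by (induction n) (simp_all add: gm posdef_gmn)

end

locale posdef_family = closed_op_algebra Q for Q +
  fixes p :: nat and A :: "nat \<Rightarrow> ell2_op"
  assumes p: "1 \<le> p"
    and A: "i \<in> {1..p} \<Longrightarrow> posdef_op (A i)"
    and A_in: "i \<in> {1..p} \<Longrightarrow> A i \<in> Q"
begin

abbreviation avg :: "(nat \<Rightarrow> ell2_op) \<Rightarrow> ell2_op" where
  "avg B \<equiv> (1 / real p) *\<^sub>R (\<Sum>i=1..p. B i)"

abbreviation near :: "real \<Rightarrow> ell2_op \<Rightarrow> bool" where
  "near R X \<equiv> \<forall>i\<in>{1..p}. thompson_le R X (A i)"

definition rel :: "ell2_op \<Rightarrow> nat \<Rightarrow> ell2_op" where
  "rel X i = op_powr X (- 1 / 2) * A i * op_powr X (- 1 / 2)"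

text \<open>Its zeros among the positive definite operators are the solutions. The average in place
  of the sum makes \<open>L X\<close> the first-order coefficient of \<open>M n X\<close> in
  \<open>1 / 2 ^ n\<close>.\<close>

definition L :: "ell2_op \<Rightarrow> ell2_op" where
  "L X = avg (\<lambda>i. op_log (rel X i))"

text \<open>\<open>F n X\<close> as seen from \<open>X\<close>: the congruence that carries
  \<open>X\<close> to \<open>1\<close> carries \<open>F n X\<close> to \<open>M n X\<close>, so the
  distance of \<open>F n X\<close> from \<open>X\<close> becomes that of \<open>M n X\<close> from
  \<open>1\<close>.\<close>

definition M :: "nat \<Rightarrow> ell2_op \<Rightarrow> ell2_op" where
  "M n X = avg (\<lambda>i. op_powr (rel X i) (1 / 2 ^ n))"

text \<open>The fixed point of \<open>F n\<close> is the power mean of exponent \<open>1 / 2 ^ n\<close>.\<close>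

definition F :: "nat \<Rightarrow> ell2_op \<Rightarrow> ell2_op" where
  "F n X = avg (\<lambda>i. gmn n X (A i))"

section \<open>Estimates for the averaged means\<close>

lemma avg_const: "avg (\<lambda>_. B) = B"
  using p by (simp add: sum_constant_scaleR del: sum_constant)

lemma norm_avg_le:
  assumes "\<And>i. i \<in> {1..p} \<Longrightarrow> norm (B i) \<le> c"
  shows "norm (avg B) \<le> c"
proof -
  have "norm (\<Sum>i=1..p. B i) \<le> (\<Sum>i=1..p. c)" by (rule sum_norm_le) (rule assms)
  then show ?thesis using p by (simp add: field_simps)
qed

lemma karcher_iff: "is_karcher_mean p A X \<longleftrightarrow> posdef_op X \<and> L X = 0"
  using p by (simp add: is_karcher_mean_def L_def rel_def)

lemma posdef_F: "posdef_op X \<Longrightarrow> posdef_op (F n X)"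
  unfolding F_def using p by (intro posdef_scaleR posdef_sum posdef_gmn A) auto

lemma F_in: "posdef_op X \<Longrightarrow> X \<in> Q \<Longrightarrow> F n X \<in> Q"
  unfolding F_def by (intro scaleR sum gmn A A_in)

lemma F_eq:
  assumes "posdef_op X"
  shows "F n X = op_powr X (1 / 2) * M n X * op_powr X (1 / 2)"
proof -
  have "F n X = avg (\<lambda>i. op_powr X (1 / 2) * op_powr (rel X i) (1 / 2 ^ n) * op_powr X (1 / 2))"
    unfolding F_def rel_def using gmn_eq[OF assms A] by simp
  then show ?thesis by (simp add: M_def sum_distrib_left sum_distrib_right)
qed

lemma M_eq:
  assumes "posdef_op X"
  shows "M n X = op_powr X (- 1 / 2) * F n X * op_powr X (- 1 / 2)"
  unfolding F_eq[OF assms]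
  by (simp only: mult.assoc op_powr_half_cancel[OF assms] op_powr_half_mult[OF assms] mult_1_right)

lemma congruence_self:
  assumes "posdef_op X"
  shows "op_powr X (- 1 / 2) * X * op_powr X (- 1 / 2) = 1"
proof -
  have "op_powr X (- 1 / 2) * (op_powr X (1 / 2) * op_powr X (1 / 2)) * op_powr X (- 1 / 2) = 1"
    by (simp only: mult.assoc op_powr_half_cancel[OF assms] op_powr_half_mult(2,3)[OF assms])
  then show ?thesis by (simp only: op_powr_half_mult(1)[OF assms])
qed

text \<open>Congruence by \<open>op_powr X (- 1 / 2)\<close> preserves Thompson bounds and carries
  \<open>X\<close> to \<open>1\<close> and \<open>A i\<close> to \<open>rel X i\<close>. A Thompson
  bound against \<open>1\<close> is a spectral interval.\<close>

lemma rel_between: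
  assumes X: "posdef_op X" and i: "i \<in> {1..p}" and R: "thompson_le R X (A i)"
  shows "op_between (exp (- R)) (exp R) (rel X i)"
proof -
  let ?Hi = "op_powr X (- 1 / 2)"
  have Hi: "posdef_op ?Hi" by (rule posdef_op_powr[OF X])
  have "thompson_le R (?Hi * X * ?Hi) (rel X i)"
    unfolding rel_def by (intro thompson_le_congruence posdef_selfadjoint Hi R)
  then have t: "op_le 1 (exp R *\<^sub>R rel X i)" "op_le (rel X i) (exp R *\<^sub>R 1)"
    by (simp_all only: congruence_self[OF X] thompson_le_def)
  have "op_le (exp (- R) *\<^sub>R 1) (exp (- R) *\<^sub>R exp R *\<^sub>R rel X i)"
    by (rule op_le_scaleR) (use t in auto)
  moreover have "selfadjoint_op (rel X i)"
    unfolding rel_def by (intro posdef_selfadjoint posdef_congruence Hi A i)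
  ultimately show ?thesis
    using t(2) by (simp add: op_between_def exp_minus)
qed

lemma M_expansion:
  assumes X: "posdef_op X" and R: "0 \<le> R" "near R X"
  shows "norm (M n X - 1 - (1 / 2 ^ n) *\<^sub>R L X) \<le> (1 / 2 ^ n)\<^sup>2 * (R\<^sup>2 * exp R)"
proof -
  define s :: real where "s = 1 / 2 ^ n"
  have s: "0 \<le> s" "s \<le> 1" by (simp_all add: s_def)
  have "M n X - 1 - s *\<^sub>R L X = avg (\<lambda>i. op_powr (rel X i) s - 1 - s *\<^sub>R op_log (rel X i))"
    unfolding M_def L_def s_def sum_subtractf scaleR_right_diff_distrib avg_const
    by (simp add: scaleR_sum_right mult.commute)
  also have "norm \<dots> \<le> s\<^sup>2 * (R\<^sup>2 * exp R)"
    by (rule norm_avg_le, rule op_powr_expansion[OF rel_between[OF X]])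
       (use R s in auto)
  finally show ?thesis by (simp add: s_def)
qed

text \<open>The powers of \<open>rel X i\<close> stay above \<open>exp (- R)\<close> for every
  \<open>n\<close>, and so does their average. Entering \<open>thompson_le_one\<close> with this
  lower bound is the origin of the factor \<open>exp R\<close>.\<close>

lemma thompson_le_F_self:
  assumes X: "posdef_op X" and R: "0 \<le> R" "near R X" and d: "norm (M n X - 1) \<le> d"
  shows "thompson_le (d * exp R) (F n X) X"
proof -
  have "op_le (exp (- R) *\<^sub>R 1) (op_powr (rel X i) (1 / 2 ^ n))" if "i \<in> {1..p}" for i
  proof -
    have B: "op_between (exp (- R)) (exp R) (rel X i)"
      using rel_between[OF X that] R(2) that by blast
    have "op_le (op_rfun (\<lambda>_. exp (- R)) (rel X i)) (op_rfun (\<lambda>x. x powr (1 / 2 ^ n)) (rel X i))"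
    proof (rule op_rfun_mono[OF B])
      fix x assume x: "exp (- R) \<le> x"
      have "exp (- R) \<le> exp (- R * (1 / 2 ^ n))"
        using R(1) mult_left_le[of "1 / 2 ^ n" R] by simp
      also have "\<dots> = exp (- R) powr (1 / 2 ^ n)" by (simp add: powr_def)
      also have "\<dots> \<le> x powr (1 / 2 ^ n)" using x by (intro powr_mono2) auto
      finally show "exp (- R) \<le> x powr (1 / 2 ^ n)" .
    qed (auto intro: continuous_on_powr_Icc)
    then show ?thesis by (simp add: op_rfun_const[OF B] op_powr_eq_op_rfun[OF B])
  qed
  then have "op_le (avg (\<lambda>_. exp (- R) *\<^sub>R 1)) (M n X)"
    unfolding M_def by (intro op_le_scaleR op_le_sum) auto
  then have "op_le (exp (- R) *\<^sub>R 1) (M n X)" by (simp only: avg_const)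
  then have "thompson_le (d / exp (- R)) (M n X) 1"
    using R(1) d by (intro thompson_le_one) auto
  then have "thompson_le (d * exp R) (M n X) 1" by (simp add: exp_minus divide_inverse)
  then have "thompson_le (d * exp R) (op_powr X (1 / 2) * M n X * op_powr X (1 / 2))
      (op_powr X (1 / 2) * 1 * op_powr X (1 / 2))"
    by (intro thompson_le_congruence posdef_selfadjoint posdef_op_powr X)
  then show ?thesis by (simp add: F_eq[OF X] op_powr_half_mult[OF X])
qed

text \<open>The reverse of \<open>thompson_le_F_self\<close>, for the limit operator, where the
  distance of \<open>F n X\<close> from \<open>X\<close> is known first.\<close>

lemma norm_M_le:
  assumes X: "posdef_op X" and r: "0 \<le> r" "thompson_le r (F n X) X"
  shows "norm (M n X - 1) \<le> (exp r - 1) * exp r"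
proof (rule thompson_le_norm)
  have Hi: "posdef_op (op_powr X (- 1 / 2))" by (rule posdef_op_powr[OF X])
  show "selfadjoint_op (M n X)"
    unfolding M_eq[OF X] by (intro posdef_selfadjoint posdef_congruence posdef_F X Hi)
  have "thompson_le r (op_powr X (- 1 / 2) * F n X * op_powr X (- 1 / 2))
     (op_powr X (- 1 / 2) * X * op_powr X (- 1 / 2))"
    by (intro thompson_le_congruence posdef_selfadjoint Hi r)
  then show t: "thompson_le r (M n X) 1"
    by (simp only: congruence_self[OF X] M_eq[OF X])
  then show "op_le (M n X) (exp r *\<^sub>R 1)" by (simp add: thompson_le_def)
  show "op_le 1 (exp r *\<^sub>R 1)" using op_le_scaleR_one[of 1 "exp r"] r by simp
qed (use r in simp_all)

text \<open>The data \<open>A i\<close> are the same on both sides and contribute distance 0, so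
  only the weight of the moving argument remains.\<close>

lemma thompson_le_F:
  assumes "posdef_op X" "posdef_op Y" "thompson_le r X Y"
  shows "thompson_le ((1 - 1 / 2 ^ n) * r) (F n X) (F n Y)"
  unfolding F_def
proof (intro thompson_le_scaleR thompson_le_sum)
  fix i assume "i \<in> {1..p}"
  then show "thompson_le ((1 - 1 / 2 ^ n) * r) (gmn n X (A i)) (gmn n Y (A i))"
    using thompson_le_gmn[of X "A i" Y "A i" r 0 n] assms A by simp
qed simp

text \<open>Written as \<open>gmn n (A j) (A j)\<close>, the operator \<open>A j\<close> is compared
  with each \<open>gmn n X (A i)\<close> argument by argument, and both pairs have distance at most
  \<open>R\<close>. This traps all iterates in one region, so the constants in the expansions do not
  depend on \<open>n\<close>.\<close>

lemma near_F:
  assumes X: "posdef_op X" "near R X" and R: "near R (A j)" and j: "j \<in> {1..p}"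
  shows "thompson_le R (F n X) (A j)"
proof -
  have "thompson_le R (F n X) (avg (\<lambda>i. gmn n (A j) (A j)))"
    unfolding F_def
  proof (intro thompson_le_scaleR thompson_le_sum)
    fix i assume i: "i \<in> {1..p}"
    have "thompson_le ((1 - 1 / 2 ^ n) * R + 1 / 2 ^ n * R) (gmn n X (A i)) (gmn n (A j) (A j))"
      using X R i j A by (intro thompson_le_gmn) (auto intro: thompson_le_sym)
    then show "thompson_le R (gmn n X (A i)) (gmn n (A j) (A j))" by (simp add: algebra_simps)
  qed simp
  then show ?thesis by (simp only: avg_const gmn_self[OF A[OF j]])
qed

lemma near_exists:
  assumes "posdef_op X"
  obtains R where "0 \<le> R" "near R X"
proof -
  have "\<exists>r. 0 \<le> r \<and> thompson_le r X (A i)" if "i \<in> {1..p}" for i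
    using thompson_le_exists[OF assms A[OF that]] by blast
  then obtain r where r: "\<And>i. i \<in> {1..p} \<Longrightarrow> 0 \<le> r i \<and> thompson_le (r i) X (A i)" by metis
  have "near (\<Sum>i=1..p. r i) X"
  proof
    fix i assume i: "i \<in> {1..p}"
    then have "r i \<le> (\<Sum>i=1..p. r i)" using r by (intro member_le_sum) auto
    then show "thompson_le (\<Sum>i=1..p. r i) X (A i)"
      using r i A assms thompson_le_mono by blast
  qed
  moreover have "0 \<le> (\<Sum>i=1..p. r i)" using r by (intro sum_nonneg) blast
  ultimately show ?thesis using that by blast
qed

lemma near_mono: "posdef_op X \<Longrightarrow> near R X \<Longrightarrow> R \<le> R' \<Longrightarrow> near R' X"
  using thompson_le_mono A by blast

lemma near_all_exists:
  obtains R where "0 \<le> R" "\<And>j. j \<in> {1..p} \<Longrightarrow> near R (A j)"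
proof -
  have "\<exists>r. 0 \<le> r \<and> near r (A j)" if "j \<in> {1..p}" for j
    using near_exists[OF A[OF that]] by blast
  then obtain r where r: "\<And>j. j \<in> {1..p} \<Longrightarrow> 0 \<le> r j \<and> near (r j) (A j)" by metis
  have "near (\<Sum>i=1..p. r i) (A j)" if j: "j \<in> {1..p}" for j
  proof -
    have "r j \<le> (\<Sum>i=1..p. r i)" using r j by (intro member_le_sum) auto
    then show ?thesis using r[OF j] A[OF j] near_mono by blast
  qed
  moreover have "0 \<le> (\<Sum>i=1..p. r i)" using r by (intro sum_nonneg) blast
  ultimately show ?thesis using that by blast
qed

text \<open>The two solutions range over all bounded operators, not just over \<open>Q\<close>. One
  radius \<open>R\<close> for both gives one constant \<open>D\<close> for the two error
  estimates.\<close>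

theorem karcher_unique:
  assumes "is_karcher_mean p A X" "is_karcher_mean p A Y"
  shows "X = Y"
proof -
  have X: "posdef_op X" "L X = 0" and Y: "posdef_op Y" "L Y = 0"
    using assms by (auto simp: karcher_iff)
  obtain R1 where R1: "0 \<le> R1" "near R1 X" using near_exists[OF X(1)] .
  obtain R2 where R2: "0 \<le> R2" "near R2 Y" using near_exists[OF Y(1)] .
  define R where "R = max R1 R2"
  have R: "0 \<le> R" "near R X" "near R Y"
    using R1 R2 near_mono[OF X(1) R1(2), of R] near_mono[OF Y(1) R2(2), of R] by (auto simp: R_def)
  define D where "D = R\<^sup>2 * exp R * exp R"
  have self: "thompson_le ((1 / 2 ^ n)\<^sup>2 * D) (F n Z) Z" if "posdef_op Z" "L Z = 0" "near R Z" for n Z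
  proof -
    have "norm (M n Z - 1) \<le> (1 / 2 ^ n)\<^sup>2 * (R\<^sup>2 * exp R)"
      using M_expansion[OF that(1) R(1) that(3), of n] that(2) by simp
    from thompson_le_F_self[OF that(1) R(1) that(3) this] show ?thesis
      by (simp add: D_def mult_ac)
  qed
  have "thompson_le (2 * D * (1 / 2) ^ n) X Y" for n
  proof -
    define s :: real where "s = 1 / 2 ^ n"
    obtain r0 where r0: "thompson_le r0 X Y" using thompson_le_exists[OF X(1) Y(1)] .
    \<comment> \<open>Each solution is moved by at most \<open>s\<^sup>2 * D\<close>, in total
      \<open>s * b\<close> with \<open>b = 2 * s * D\<close>, and absorption leaves
      \<open>b\<close>.\<close>
    have "thompson_le (2 * s * D) X Y"
    proof (rule thompson_le_absorb[OF _ _ r0])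
      fix r assume "thompson_le r X Y"
      then have "thompson_le ((1 - s) * r) (F n X) (F n Y)"
        unfolding s_def by (intro thompson_le_F X Y)
      moreover have "thompson_le (s\<^sup>2 * D) X (F n X)" "thompson_le (s\<^sup>2 * D) (F n Y) Y"
        unfolding s_def using self X Y R by (auto intro: thompson_le_sym)
      ultimately have "thompson_le (s\<^sup>2 * D + (1 - s) * r + s\<^sup>2 * D) X Y"
        using thompson_le_trans by blast
      moreover have "s\<^sup>2 * D + (1 - s) * r + s\<^sup>2 * D = (1 - s) * r + s * (2 * s * D)"
        by (simp add: power2_eq_square algebra_simps)
      ultimately show "thompson_le ((1 - s) * r + s * (2 * s * D)) X Y" by simp
    qed (simp_all add: s_def)
    then show ?thesis by (simp add: s_def power_one_over mult_ac)
  qed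
  moreover have "(\<lambda>n. 2 * D * (1 / 2) ^ n) \<longlonglongrightarrow> 2 * D * 0"
    by (intro tendsto_intros LIMSEQ_realpow_zero) auto
  ultimately have "thompson_le 0 X Y"
    using thompson_le_limit[of "\<lambda>n. 2 * D * (1 / 2) ^ n" 0 X Y] by simp
  then show ?thesis
    using X Y by (simp add: thompson_le_0_iff posdef_selfadjoint)
qed

text \<open>Banach iteration from \<open>A 1\<close>. The radius \<open>R\<close> is the same for
  every \<open>n\<close>, which the passage to the limit in \<open>n\<close> relies on.\<close>

lemma power_mean_exists:
  assumes R: "0 \<le> R" "\<And>j. j \<in> {1..p} \<Longrightarrow> near R (A j)"
  shows "\<exists>X\<in>Q. posdef_op X \<and> F n X = X \<and> near R X"
proof -
  define s :: real where "s = 1 / 2 ^ n"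
  have s: "0 < s" "s \<le> 1" by (simp_all add: s_def)
  define Y where "Y = (\<lambda>k. (F n ^^ k) (A 1))"
  have Y0: "Y 0 = A 1" and YS: "Y (Suc k) = F n (Y k)" for k by (simp_all add: Y_def)
  have p1: "1 \<in> {1..p}" using p by simp
  have Y: "posdef_op (Y k) \<and> Y k \<in> Q \<and> near R (Y k)" for k
  proof (induction k)
    case 0 then show ?case using A A_in R(2) p1 by (simp only: Y0) blast
  next
    case (Suc k) then show ?case using R(2) by (auto simp: YS intro: posdef_F F_in near_F)
  qed
  \<comment> \<open>All iterates lie within \<open>R\<close> of the starting point, so
    \<open>Y 0\<close> is compared with \<open>Y j\<close> directly and no geometric series has to
    be summed.\<close>
  have step: "thompson_le ((1 - s) ^ k * R) (Y k) (Y (k + j))" for k j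
  proof (induction k)
    case 0
    have "thompson_le R (Y j) (Y 0)" using Y p1 by (simp only: Y0)
    then show ?case by (simp add: thompson_le_sym)
  next
    case (Suc k)
    then have "thompson_le ((1 - s) * ((1 - s) ^ k * R)) (F n (Y k)) (F n (Y (k + j)))"
      unfolding s_def using Y by (intro thompson_le_F) auto
    then show ?case by (simp add: YS mult.assoc)
  qed
  have "\<exists>N. \<forall>m\<ge>N. \<forall>n\<ge>N. thompson_le e (Y m) (Y n)" if "0 < e" for e
  proof -
    have "(\<lambda>k. (1 - s) ^ k * R) \<longlonglongrightarrow> 0 * R"
      using s by (intro tendsto_intros LIMSEQ_realpow_zero) auto
    then have "\<forall>\<^sub>F k in sequentially. (1 - s) ^ k * R < e / 2"
      by (rule order_tendstoD) (use that in simp)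
    then obtain N where N: "(1 - s) ^ N * R < e / 2" by (auto simp: eventually_sequentially)
    have t: "thompson_le (e / 2) (Y N) (Y m)" if "m \<ge> N" for m
      using step[of N "m - N"] N that Y by (auto intro: thompson_le_mono)
    have "thompson_le e (Y m) (Y n)" if "m \<ge> N" "n \<ge> N" for m n
      using thompson_le_trans[OF thompson_le_sym[OF t[OF that(1)]] t[OF that(2)]] by simp
    then show ?thesis by blast
  qed
  with thompson_Cauchy_convergent[of Y] Y
  obtain X where X: "posdef_op X" "Y \<longlonglongrightarrow> X" "\<And>e. e > 0 \<Longrightarrow> \<exists>N. \<forall>n\<ge>N. thompson_le e (Y n) X"
    by blast
  have "thompson_le ((2 - s) * (1 / Suc k)) (F n X) X" for k
  proof -
    define e where "e = 1 / real (Suc k)"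
    have "e > 0" by (simp add: e_def)
    then obtain N where N: "\<And>n. n \<ge> N \<Longrightarrow> thompson_le e (Y n) X" using X(3) by blast
    have "thompson_le ((1 - s) * e) (F n X) (F n (Y N))"
      unfolding s_def using N Y X by (intro thompson_le_F) (auto intro: thompson_le_sym)
    moreover have "thompson_le e (F n (Y N)) X" using N[of "Suc N"] by (simp add: YS)
    ultimately have "thompson_le ((1 - s) * e + e) (F n X) X" by (rule thompson_le_trans)
    moreover have "(1 - s) * e + e = (2 - s) * e" by (simp add: algebra_simps)
    ultimately show ?thesis by (simp only: e_def)
  qed
  moreover have "(\<lambda>k. (2 - s) * (1 / Suc k)) \<longlonglongrightarrow> (2 - s) * 0"
    by (intro tendsto_intros LIMSEQ_Suc[OF lim_1_over_n])
  ultimately have "thompson_le 0 (F n X) X"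
    using thompson_le_limit[of "\<lambda>k. (2 - s) * (1 / Suc k)" 0 "F n X" X] by simp
  then have "F n X = X"
    using X by (simp add: thompson_le_0_iff posdef_selfadjoint posdef_F)
  moreover have "X \<in> Q" using LIMSEQ[OF _ X(2)] Y by blast
  moreover have "near R X"
  proof
    fix i assume "i \<in> {1..p}"
    then show "thompson_le R X (A i)"
      by (intro thompson_le_LIMSEQ[OF X(2) tendsto_const tendsto_const]) (use Y in blast)
  qed
  ultimately show ?thesis using X(1) by blast
qed

theorem karcher_exists: "\<exists>X\<in>Q. is_karcher_mean p A X"
proof -
  obtain R where R: "0 \<le> R" "\<And>j. j \<in> {1..p} \<Longrightarrow> near R (A j)"
    using near_all_exists by blast
  have "\<exists>X. \<forall>n. X n \<in> Q \<and> posdef_op (X n) \<and> F n (X n) = X n \<and> near R (X n)"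
    by (intro choice allI) (use power_mean_exists[OF R] in blast)
  then obtain X where XQ: "\<And>n. X n \<in> Q" and Xpd: "\<And>n. posdef_op (X n)"
    and XF: "\<And>n. F n (X n) = X n" and Xnear: "\<And>n. near R (X n)"
    by blast
  define s where "s n = (1 / 2 ^ n :: real)" for n :: nat
  have s: "0 < s n" "s n \<le> 1" for n by (simp_all add: s_def)
  have s0: "s \<longlonglongrightarrow> 0"
    unfolding s_def power_one_over[symmetric] by (intro LIMSEQ_realpow_zero) auto
  define K where "K = R\<^sup>2 * exp R"
  define D where "D = K * exp R"
  have K0: "0 \<le> K" "0 \<le> D" by (simp_all add: K_def D_def)
  have MX: "M n (X n) = 1" for n
    unfolding M_eq[OF Xpd] XF by (rule congruence_self[OF Xpd])
  \<comment> \<open>At a fixed point \<open>M n (X n)\<close> is exactly \<open>1\<close>; the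
    linear term of the expansion must then be as small as its error.\<close>
  have LX: "norm (L (X n)) \<le> s n * K" for n
  proof -
    have "norm (s n *\<^sub>R L (X n)) \<le> (s n)\<^sup>2 * K"
      using M_expansion[OF Xpd R(1) Xnear, of n n] by (simp add: MX s_def K_def)
    then have "s n * norm (L (X n)) \<le> s n * (s n * K)"
      using s[of n] by (simp add: power2_eq_square mult.assoc)
    then show ?thesis using s[of n] by simp
  qed
  \<comment> \<open>The fixed point for \<open>n\<close> is tested against the map for
    \<open>m\<close>: the product \<open>s m * s n\<close> comes from the linear term
    \<open>L (X n)\<close>, the square of \<open>s m\<close> from the expansion error.\<close>
  have Fself: "thompson_le (s m * (s n + s m) * D) (F m (X n)) (X n)" for m n
  proof -
    have "norm (M m (X n) - 1) \<le> norm (M m (X n) - 1 - s m *\<^sub>R L (X n)) + norm (s m *\<^sub>R L (X n))"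
      using norm_triangle_ineq[of "M m (X n) - 1 - s m *\<^sub>R L (X n)" "s m *\<^sub>R L (X n)"] by simp
    also have "\<dots> \<le> (s m)\<^sup>2 * K + s m * (s n * K)"
      using M_expansion[OF Xpd R(1) Xnear, of m n] mult_left_mono[OF LX[of n], of "s m"] s[of m]
      by (intro add_mono) (auto simp: s_def K_def)
    finally have "norm (M m (X n) - 1) \<le> s m * (s n + s m) * K"
      by (simp add: power2_eq_square algebra_simps)
    from thompson_le_F_self[OF Xpd R(1) Xnear this] show ?thesis
      by (simp add: D_def mult.assoc)
  qed
  \<comment> \<open>\<open>F m\<close> fixes \<open>X m\<close> and moves \<open>X n\<close> by the
    error above. Its factor \<open>s m\<close> equals the gain in the contraction and is
    absorbed.\<close>
  have dist: "thompson_le ((s n + s m) * D) (X n) (X m)" for m n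
  proof -
    obtain r0 where r0: "thompson_le r0 (X n) (X m)" using thompson_le_exists[OF Xpd Xpd] .
    show ?thesis
    proof (rule thompson_le_absorb[OF s r0])
      fix r assume "thompson_le r (X n) (X m)"
      then have "thompson_le ((1 - s m) * r) (F m (X n)) (F m (X m))"
        unfolding s_def by (intro thompson_le_F Xpd)
      then have "thompson_le (s m * (s n + s m) * D + (1 - s m) * r) (X n) (X m)"
        using thompson_le_trans[OF thompson_le_sym[OF Fself]] by (simp add: XF)
      then show "thompson_le ((1 - s m) * r + s m * ((s n + s m) * D)) (X n) (X m)"
        by (simp add: algebra_simps)
    qed
  qed
  have "\<exists>N. \<forall>m\<ge>N. \<forall>n\<ge>N. thompson_le e (X m) (X n)" if "0 < e" for e
  proof -
    have "(\<lambda>k. (s k + s k) * D) \<longlonglongrightarrow> (0 + 0) * D" by (intro tendsto_intros s0)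
    then have "\<forall>\<^sub>F k in sequentially. (s k + s k) * D < e"
      by (rule order_tendstoD) (use that in simp)
    then obtain N where N: "(s N + s N) * D < e" by (auto simp: eventually_sequentially)
    have "thompson_le e (X m) (X n)" if "m \<ge> N" "n \<ge> N" for m n
    proof (rule thompson_le_mono[OF dist])
      have "s m \<le> s N" "s n \<le> s N"
        using that by (auto simp: s_def intro!: divide_left_mono power_increasing)
      then have "(s m + s n) * D \<le> (s N + s N) * D" using K0 by (intro mult_right_mono) auto
      then show "(s m + s n) * D \<le> e" using N by simp
    qed (rule Xpd)+
    then show ?thesis by blast
  qed
  with thompson_Cauchy_convergent[of X] Xpd
  obtain Z where Z: "posdef_op Z" "X \<longlonglongrightarrow> Z" by blast
  have XZ: "thompson_le ((s n + 0) * D) (X n) Z" for n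
    by (rule thompson_le_LIMSEQ[OF tendsto_const Z(2) _ dist]) (intro tendsto_intros s0)
  have nearZ: "near R Z"
  proof
    fix i assume "i \<in> {1..p}"
    then show "thompson_le R Z (A i)"
      by (intro thompson_le_LIMSEQ[OF Z(2) tendsto_const tendsto_const]) (use Xnear in blast)
  qed
  \<comment> \<open>Instead of a continuity argument for \<open>L\<close>, the estimate
    \<open>Fself\<close> is transported from \<open>X n\<close> to \<open>Z\<close> by the
    contraction \<open>F m\<close>. As \<open>n\<close> grows all terms with \<open>s n\<close>
    vanish.\<close>
  have FZ: "thompson_le ((s m)\<^sup>2 * D) (F m Z) Z" for m
  proof -
    have all: "thompson_le ((1 - s m) * (s n * D) + s m * (s n + s m) * D + s n * D) (F m Z) Z" for n
    proof -
      have "thompson_le ((1 - s m) * (s n * D)) (F m Z) (F m (X n))"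
        unfolding s_def[of m] using XZ[of n] by (intro thompson_le_F Xpd Z) (simp add: thompson_le_sym)
      from thompson_le_trans[OF thompson_le_trans[OF this Fself] XZ[of n]] show ?thesis by simp
    qed
    have "(\<lambda>n. (1 - s m) * (s n * D) + s m * (s n + s m) * D + s n * D)
        \<longlonglongrightarrow> (1 - s m) * (0 * D) + s m * (0 + s m) * D + 0 * D"
      by (intro tendsto_intros s0)
    from thompson_le_limit[OF this all] show ?thesis by (simp add: power2_eq_square)
  qed
  define E where "E = D * exp D * exp D + K"
  \<comment> \<open>The bound on \<open>F m Z\<close> makes \<open>M m Z - 1\<close> of order
    \<open>(s m)\<^sup>2\<close>, hence also the linear term \<open>s m *\<^sub>R L Z\<close>;
    division by \<open>s m\<close> leaves a bound that vanishes with growing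
    \<open>m\<close>.\<close>
  have "norm (L Z) \<le> s m * E" for m
  proof -
    define r where "r = (s m)\<^sup>2 * D"
    have r: "0 \<le> r" "r \<le> D"
      using K0 s[of m] by (simp_all add: r_def mult_left_le_one_le power_le_one)
    have "exp r - 1 \<le> r * exp r"
    proof -
      have "(1 + - r) * exp r \<le> exp (- r) * exp r"
        by (intro mult_right_mono exp_ge_add_one_self) simp
      then show ?thesis by (simp add: algebra_simps flip: exp_add)
    qed
    then have "(exp r - 1) * exp r \<le> r * exp r * exp r" by (intro mult_right_mono) auto
    also have "\<dots> \<le> r * exp D * exp D" using r by (intro mult_mono) auto
    finally have "norm (M m Z - 1) \<le> (s m)\<^sup>2 * (D * exp D * exp D)"
      using norm_M_le[OF Z(1) r(1), of m] FZ[of m] by (simp add: r_def mult.assoc)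
    moreover have "norm (M m Z - 1 - s m *\<^sub>R L Z) \<le> (s m)\<^sup>2 * K"
      using M_expansion[OF Z(1) R(1) nearZ, of m] by (simp add: s_def K_def)
    moreover have "norm (s m *\<^sub>R L Z) \<le> norm (M m Z - 1) + norm (M m Z - 1 - s m *\<^sub>R L Z)"
      using norm_triangle_ineq4[of "M m Z - 1" "M m Z - 1 - s m *\<^sub>R L Z"] by simp
    ultimately have "s m * norm (L Z) \<le> (s m)\<^sup>2 * E"
      using s[of m] by (simp add: E_def algebra_simps)
    then have "s m * norm (L Z) \<le> s m * (s m * E)" by (simp add: power2_eq_square mult.assoc)
    then show ?thesis using s[of m] by simp
  qed
  moreover have "(\<lambda>m. s m * E) \<longlonglongrightarrow> 0 * E" by (intro tendsto_intros s0)
  ultimately have "norm (L Z) \<le> 0 * E"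
    by (intro LIMSEQ_le_const) auto
  then have "is_karcher_mean p A Z" using Z(1) by (simp add: karcher_iff)
  moreover have "Z \<in> Q" using LIMSEQ[OF XQ Z(2)] .
  ultimately show ?thesis by blast
qed

end

section \<open>Coordinates\<close>

lemma cinner_ell2_basis: "cinner_ell2 (ell2_basis i) x = ell2_coord x i"
proof -
  have "(\<lambda>n. cnj (ell2_coord (ell2_basis i) n) * ell2_coord x n) = (\<lambda>n. if n = i then ell2_coord x i else 0)"
    by (auto simp: ell2_basis.rep_eq)
  moreover have "(\<lambda>n. if n = i then ell2_coord x i else 0) sums ell2_coord x i"
    using sums_single[of i "\<lambda>_. ell2_coord x i"] by (simp add: eq_commute)
  ultimately show ?thesis by (simp add: cinner_ell2.rep_eq sums_iff)
qed

lemma op_entry_eq: "op_entry A i j = ell2_coord (A \<bullet>\<^sub>v ell2_basis j) i"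
  by (simp add: op_entry_def cinner_ell2_basis)

lemma ell2_coord_bounded_linear: "bounded_linear (\<lambda>x. ell2_coord x i)"
proof (rule bounded_linear_intro[where K = "norm (ell2_basis i)"])
  show "norm (ell2_coord x i) \<le> norm x * norm (ell2_basis i)" for x
    using norm_cinner_ell2_le[of "ell2_basis i" x] by (simp add: cinner_ell2_basis mult.commute)
qed (simp_all add: plus_ell2.rep_eq scaleR_ell2.rep_eq scaleR_conv_of_real)

lemma ell2_eqI: "(\<And>n. ell2_coord x n = ell2_coord y n) \<Longrightarrow> x = y"
  by (simp flip: ell2_coord_inject add: fun_eq_iff)

lemma norm_ell2_sq: "(norm x)\<^sup>2 = (\<Sum>n. (cmod (ell2_coord x n))\<^sup>2)"
  by (simp add: norm_ell2_def suminf_nonneg[OF square_summable_ell2])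

lemma ell2_coord_sum: "ell2_coord (\<Sum>j\<in>J. f j) n = (\<Sum>j\<in>J. ell2_coord (f j) n)"
  by (induction J rule: infinite_finite_induct) (simp_all add: zero_ell2.rep_eq plus_ell2.rep_eq)

definition ell2_fin :: "nat set \<Rightarrow> (nat \<Rightarrow> complex) \<Rightarrow> ell2" where
  "ell2_fin J c = (\<Sum>j\<in>J. c j *\<^sub>C ell2_basis j)"

lemma ell2_coord_fin: "finite J \<Longrightarrow> ell2_coord (ell2_fin J c) n = (if n \<in> J then c n else 0)"
proof -
  assume J: "finite J"
  have "ell2_coord (ell2_fin J c) n = (\<Sum>j\<in>J. if n = j then c j else 0)"
    unfolding ell2_fin_def ell2_coord_sum
    by (intro sum.cong) (auto simp: scaleC_ell2.rep_eq ell2_basis.rep_eq)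
  then show ?thesis using J by (simp add: sum.delta')
qed

lemma norm_ell2_fin: "finite J \<Longrightarrow> (norm (ell2_fin J c))\<^sup>2 = (\<Sum>j\<in>J. (cmod (c j))\<^sup>2)"
  unfolding norm_ell2_sq
  by (subst suminf_finite[where N = J]) (auto simp: ell2_coord_fin)

lemma norm_ell2_basis [simp]: "norm (ell2_basis i) = 1"
proof -
  have "(norm (ell2_fin {i} (\<lambda>_. 1)))\<^sup>2 = 1" by (subst norm_ell2_fin) auto
  moreover have "ell2_fin {i} (\<lambda>_. 1) = ell2_basis i" by (simp add: ell2_fin_def)
  ultimately show ?thesis by (simp add: power2_eq_1_iff) (metis norm_ge_zero not_one_le_zero le_minus_one_simps(3))
qed

lemma ell2_trunc_LIMSEQ: "(\<lambda>N. ell2_fin {..<N} (ell2_coord x)) \<longlonglongrightarrow> x"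
proof -
  define f where "f n = (cmod (ell2_coord x n))\<^sup>2" for n
  have f: "summable f" unfolding f_def by (rule square_summable_ell2)
  have "norm (ell2_fin {..<N} (ell2_coord x) - x) = sqrt (suminf f - (\<Sum>n<N. f n))" for N
  proof -
    define g where "g n = (if n < N then 0 else f n)" for n
    have g: "(\<lambda>n. (cmod (ell2_coord (ell2_fin {..<N} (ell2_coord x) - x) n))\<^sup>2) = g"
      by (auto simp: g_def f_def minus_ell2.rep_eq ell2_coord_fin)
    then have "summable g" by (metis square_summable_ell2)
    then have "suminf g = (\<Sum>n. g (n + N)) + (\<Sum>n<N. g n)" by (rule suminf_split_initial_segment)
    also have "\<dots> = (\<Sum>n. f (n + N))" by (simp add: g_def)
    also have "\<dots> = suminf f - (\<Sum>n<N. f n)" by (rule suminf_minus_initial_segment[OF f])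
    finally show ?thesis by (simp add: norm_ell2_def g)
  qed
  moreover have "(\<lambda>N. sqrt (suminf f - (\<Sum>n<N. f n))) \<longlonglongrightarrow> sqrt (suminf f - suminf f)"
    by (intro tendsto_intros summable_LIMSEQ f)
  ultimately have "(\<lambda>N. norm (ell2_fin {..<N} (ell2_coord x) - x)) \<longlonglongrightarrow> 0" by simp
  then show ?thesis by (simp add: tendsto_norm_zero_iff LIM_zero_iff)
qed

text \<open>Finitely supported vectors are dense. This makes the definite description of a Toeplitz
  operator by its matrix unique.\<close>

lemma op_eq_of_entries:
  assumes "\<And>i j. op_entry A i j = op_entry B i j"
  shows "A = B"
proof (rule op_eqI)
  fix x
  have b: "A \<bullet>\<^sub>v ell2_basis j = B \<bullet>\<^sub>v ell2_basis j" for j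
    using assms by (intro ell2_eqI) (simp add: op_entry_eq)
  have "A \<bullet>\<^sub>v ell2_fin {..<N} (ell2_coord x) = B \<bullet>\<^sub>v ell2_fin {..<N} (ell2_coord x)" for N
    by (simp add: ell2_fin_def op_apply_sum_right b del: sum.lessThan_Suc)
  then show "A \<bullet>\<^sub>v x = B \<bullet>\<^sub>v x"
    using tendsto_op_apply_right[OF ell2_trunc_LIMSEQ[of x], of A]
      tendsto_op_apply_right[OF ell2_trunc_LIMSEQ[of x], of B] LIMSEQ_unique by auto
qed

lemma op_entry_linear:
  "op_entry (A + B) i j = op_entry A i j + op_entry B i j"
  "op_entry (A - B) i j = op_entry A i j - op_entry B i j"
  "op_entry (scaleC_op c A) i j = c * op_entry A i j"
  by (simp_all add: op_entry_eq plus_ell2.rep_eq minus_ell2.rep_eq scaleC_ell2.rep_eq)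

lemma op_entry_LIMSEQ: "S \<longlonglongrightarrow> A \<Longrightarrow> (\<lambda>n. op_entry (S n) i j) \<longlonglongrightarrow> op_entry A i j"
  unfolding op_entry_eq by (intro bounded_linear.tendsto[OF ell2_coord_bounded_linear] tendsto_op_apply)


section \<open>Compact operators\<close>

text \<open>Any compact set containing the image of the unit ball will do, so images and sums of
  compact sets can serve without computing closures.\<close>

lemma compact_op_iff: "compact_op K \<longleftrightarrow> (\<exists>T. compact T \<and> (\<forall>x. norm x \<le> 1 \<longrightarrow> K \<bullet>\<^sub>v x \<in> T))"
proof
  assume "compact_op K"
  moreover have "K \<bullet>\<^sub>v x \<in> closure ((\<lambda>x. K \<bullet>\<^sub>v x) ` cball 0 1)" if "norm x \<le> 1" for x
    by (rule subsetD[OF closure_subset]) (use that in auto)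
  ultimately show "\<exists>T. compact T \<and> (\<forall>x. norm x \<le> 1 \<longrightarrow> K \<bullet>\<^sub>v x \<in> T)"
    unfolding compact_op_def by blast
next
  assume "\<exists>T. compact T \<and> (\<forall>x. norm x \<le> 1 \<longrightarrow> K \<bullet>\<^sub>v x \<in> T)"
  then obtain T where T: "compact T" "\<forall>x. norm x \<le> 1 \<longrightarrow> K \<bullet>\<^sub>v x \<in> T" by blast
  then have "(\<lambda>x. K \<bullet>\<^sub>v x) ` cball 0 1 \<subseteq> T" by auto
  then have "closure ((\<lambda>x. K \<bullet>\<^sub>v x) ` cball 0 1) \<subseteq> T"
    using T(1) by (intro closure_minimal compact_imp_closed)
  then show "compact_op K"
    unfolding compact_op_def using compact_Int_closed[OF T(1) closed_closure] by (metis inf.absorb2)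
qed

lemma compact_op_zero [simp]: "compact_op 0"
  unfolding compact_op_iff by (intro exI[of _ "{0}"]) simp

lemma compact_op_add:
  assumes "compact_op K" "compact_op L"
  shows "compact_op (K + L)"
proof -
  obtain S T where S: "compact S" "\<And>x. norm x \<le> 1 \<Longrightarrow> K \<bullet>\<^sub>v x \<in> S"
    and T: "compact T" "\<And>x. norm x \<le> 1 \<Longrightarrow> L \<bullet>\<^sub>v x \<in> T"
    using assms unfolding compact_op_iff by blast
  show ?thesis
    unfolding compact_op_iff using S(2) T(2)
    by (intro exI[of _ "{x + y | x y. x \<in> S \<and> y \<in> T}"] conjI compact_sums[OF S(1) T(1)]) auto
qed

lemma compact_op_mult_left:
  assumes "compact_op K"
  shows "compact_op (A * K)"
proof -
  obtain T where T: "compact T" "\<And>x. norm x \<le> 1 \<Longrightarrow> K \<bullet>\<^sub>v x \<in> T"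
    using assms unfolding compact_op_iff by blast
  have "compact ((\<lambda>x. A \<bullet>\<^sub>v x) ` T)"
    by (intro compact_continuous_image linear_continuous_on bounded_linear_op_apply_right T)
  then show ?thesis
    unfolding compact_op_iff using T(2) by (intro exI[of _ "(\<lambda>x. A \<bullet>\<^sub>v x) ` T"]) auto
qed

lemma compact_op_mult_right:
  assumes "compact_op K"
  shows "compact_op (K * A)"
proof -
  obtain T where T: "compact T" "\<And>x. norm x \<le> 1 \<Longrightarrow> K \<bullet>\<^sub>v x \<in> T"
    using assms unfolding compact_op_iff by blast
  define c where "c = norm A + 1"
  have c: "c > 0" by (simp add: c_def add_nonneg_pos)
  have "(K * A) \<bullet>\<^sub>v x \<in> (\<lambda>y. c *\<^sub>R y) ` T" if "norm x \<le> 1" for x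
  proof (rule image_eqI)
    have "norm (A \<bullet>\<^sub>v x) \<le> norm A * 1"
      using norm_op_apply[of A x] mult_left_mono[OF that, of "norm A"] by simp
    then show "K \<bullet>\<^sub>v ((1 / c) *\<^sub>R (A \<bullet>\<^sub>v x)) \<in> T" using c by (intro T(2)) (simp add: c_def field_simps)
  qed (use c in simp)
  then show ?thesis
    unfolding compact_op_iff using compact_scaling[OF T(1)] by blast
qed

lemma compact_op_scaleC: "compact_op K \<Longrightarrow> compact_op (scaleC_op c K)"
  using compact_op_mult_left[of K "scaleC_op c 1"] by simp

lemma compact_op_uminus: "compact_op K \<Longrightarrow> compact_op (- K)"
  using compact_op_mult_left[of K "- 1"] by simp

lemma compact_op_LIMSEQ:
  assumes "\<And>n. compact_op (S n)" "S \<longlonglongrightarrow> K"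
  shows "compact_op K"
  unfolding compact_op_def compact_eq_totally_bounded
proof (intro conjI allI impI)
  let ?I = "(\<lambda>x. K \<bullet>\<^sub>v x) ` cball 0 1"
  show "complete (closure ?I)" by (simp add: complete_eq_closed)
  fix e :: real assume "0 < e"
  then have "0 < e / 4" by simp
  from LIMSEQ_D[OF assms(2) this] obtain n where n: "norm (S n - K) < e / 4" by blast
  obtain T where T: "compact T" "\<And>x. norm x \<le> 1 \<Longrightarrow> S n \<bullet>\<^sub>v x \<in> T"
    using assms(1)[of n] unfolding compact_op_iff by blast
  obtain F where F: "finite F" "T \<subseteq> (\<Union>y\<in>F. ball y (e / 4))"
    using T(1) \<open>0 < e / 4\<close> unfolding compact_eq_totally_bounded by meson
  \<comment> \<open>The balls are closed so that their finite union also contains the closure of the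
    image.\<close>
  have "?I \<subseteq> (\<Union>y\<in>F. cball y (e / 2))"
  proof clarsimp
    fix x :: ell2 assume x: "norm x \<le> 1"
    then obtain y where y: "y \<in> F" "dist y (S n \<bullet>\<^sub>v x) < e / 4" using F(2) T(2) by fastforce
    have "dist (S n \<bullet>\<^sub>v x) (K \<bullet>\<^sub>v x) \<le> norm (S n - K) * 1"
      using norm_op_apply[of "S n - K" x] mult_left_mono[OF x, of "norm (S n - K)"]
      by (simp add: dist_norm)
    then show "\<exists>y\<in>F. dist y (K \<bullet>\<^sub>v x) * 2 \<le> e"
      using y n dist_triangle[of y "K \<bullet>\<^sub>v x" "S n \<bullet>\<^sub>v x"] by (intro bexI[of _ y]) auto
  qed
  then have "closure ?I \<subseteq> (\<Union>y\<in>F. cball y (e / 2))"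
    by (rule closure_minimal) (use F(1) in \<open>auto intro!: closed_UN\<close>)
  also have "\<dots> \<subseteq> (\<Union>y\<in>F. ball y e)" using \<open>0 < e\<close> by auto
  finally show "\<exists>F. finite F \<and> closure ?I \<subseteq> (\<Union>y\<in>F. ball y e)" using F(1) by blast
qed


section \<open>Shifts\<close>

lemma op_exists:
  assumes "bounded_linear f" "\<And>c x. f (c *\<^sub>C x) = c *\<^sub>C f x"
  shows "\<exists>A. \<forall>x. A \<bullet>\<^sub>v x = f x"
proof -
  have "blinfun_of_op (Abs_ell2_op (Blinfun f)) = Blinfun f"
    using assms by (intro Abs_ell2_op_inverse) (simp add: bounded_linear_Blinfun_apply)
  then have "\<forall>x. Abs_ell2_op (Blinfun f) \<bullet>\<^sub>v x = f x"
    by (simp add: op_apply.rep_eq bounded_linear_Blinfun_apply[OF assms(1)])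
  then show ?thesis by blast
qed

lemma backward_shift_exists: "\<exists>V. \<forall>x n. ell2_coord (V \<bullet>\<^sub>v x) n = ell2_coord x (Suc n)"
proof -
  define f where "f x = Abs_ell2 (\<lambda>n. ell2_coord x (Suc n))" for x
  have s: "summable (\<lambda>n. (cmod (ell2_coord x (Suc n)))\<^sup>2)" for x
    using square_summable_ell2[of x] by (subst summable_Suc_iff)
  have f: "ell2_coord (f x) n = ell2_coord x (Suc n)" for x n
    by (simp add: f_def Abs_ell2_inverse s)
  have "norm (f x) \<le> norm x * 1" for x
  proof -
    have "(norm x)\<^sup>2 = (norm (f x))\<^sup>2 + (cmod (ell2_coord x 0))\<^sup>2"
      using suminf_split_head[OF square_summable_ell2[of x]] by (simp add: norm_ell2_sq f)
    then show ?thesis by (simp add: power2_le_imp_le)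
  qed
  then have "bounded_linear f"
    by (intro bounded_linear_intro[where K = 1] ell2_eqI)
       (simp_all add: f plus_ell2.rep_eq scaleR_ell2.rep_eq)
  moreover have "f (c *\<^sub>C x) = c *\<^sub>C f x" for c x
    by (rule ell2_eqI) (simp add: f scaleC_ell2.rep_eq)
  ultimately obtain A where "\<And>x. A \<bullet>\<^sub>v x = f x" using op_exists[of f] by blast
  then show ?thesis using f by (intro exI[of _ A]) simp
qed

lemma forward_shift_exists:
  "\<exists>U. \<forall>x n. ell2_coord (U \<bullet>\<^sub>v x) n = (if n = 0 then 0 else ell2_coord x (n - 1))"
proof -
  define f where "f x = Abs_ell2 (\<lambda>n. if n = 0 then 0 else ell2_coord x (n - 1))" for x
  have s: "summable (\<lambda>n. (cmod (if n = 0 then 0 else ell2_coord x (n - 1)))\<^sup>2)" for x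
    using square_summable_ell2[of x] by (subst summable_Suc_iff[symmetric]) simp
  have f: "ell2_coord (f x) n = (if n = 0 then 0 else ell2_coord x (n - 1))" for x n
    by (simp add: f_def Abs_ell2_inverse s)
  have "norm (f x) \<le> norm x * 1" for x
  proof -
    have "(norm (f x))\<^sup>2 = (norm x)\<^sup>2"
      using suminf_split_head[OF square_summable_ell2[of "f x"]] by (simp add: norm_ell2_sq f)
    then show ?thesis by (simp add: power2_eq_iff_nonneg)
  qed
  then have "bounded_linear f"
    by (intro bounded_linear_intro[where K = 1] ell2_eqI)
       (simp_all add: f plus_ell2.rep_eq scaleR_ell2.rep_eq)
  moreover have "f (c *\<^sub>C x) = c *\<^sub>C f x" for c x
    by (rule ell2_eqI) (simp add: f scaleC_ell2.rep_eq)
  ultimately obtain A where "\<And>x. A \<bullet>\<^sub>v x = f x" using op_exists[of f] by blast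
  then show ?thesis using f by (intro exI[of _ A]) simp
qed

definition bshift :: ell2_op where
  "bshift = (SOME V. \<forall>x n. ell2_coord (V \<bullet>\<^sub>v x) n = ell2_coord x (Suc n))"

definition fshift :: ell2_op where
  "fshift = (SOME U. \<forall>x n. ell2_coord (U \<bullet>\<^sub>v x) n = (if n = 0 then 0 else ell2_coord x (n - 1)))"

lemma ell2_coord_bshift [simp]: "ell2_coord (bshift \<bullet>\<^sub>v x) n = ell2_coord x (Suc n)"
  using someI_ex[OF backward_shift_exists] by (simp add: bshift_def)

lemma ell2_coord_fshift [simp]:
  "ell2_coord (fshift \<bullet>\<^sub>v x) n = (if n = 0 then 0 else ell2_coord x (n - 1))"
  using someI_ex[OF forward_shift_exists] by (simp add: fshift_def)

lemma bshift_fshift: "bshift * fshift = 1"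
  by (intro op_eqI ell2_eqI) simp

text \<open>The difference is the rank one projection to coordinate 0. It is the only defect of
  unitarity of the shift, and the source of all compact corrections in products of Toeplitz
  operators.\<close>

lemma compact_op_one_minus_fshift_bshift: "compact_op (1 - fshift * bshift)"
proof -
  have eq: "(1 - fshift * bshift) \<bullet>\<^sub>v x = ell2_coord x 0 *\<^sub>C ell2_basis 0" for x
    by (rule ell2_eqI) (simp add: minus_ell2.rep_eq scaleC_ell2.rep_eq ell2_basis.rep_eq)
  define T where "T = (\<lambda>c. c *\<^sub>C ell2_basis 0) ` cball 0 1"
  have "bounded_linear (\<lambda>c. c *\<^sub>C ell2_basis 0)"
    by (rule bounded_linear_intro[where K = 1])
       (simp_all add: scaleC_ell2_add_left norm_scaleC_ell2 scaleR_conv_of_real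
         scaleC_ell2_of_real flip: scaleC_ell2_scaleC)
  then have T: "compact T"
    unfolding T_def by (intro compact_continuous_image linear_continuous_on compact_cball)
  have "cmod (ell2_coord x 0) \<le> 1" if "norm x \<le> 1" for x
    using norm_cinner_ell2_le[of "ell2_basis 0" x] that by (simp add: cinner_ell2_basis)
  then have "(1 - fshift * bshift) \<bullet>\<^sub>v x \<in> T" if "norm x \<le> 1" for x
    using that unfolding eq by (auto simp: T_def)
  with T show ?thesis unfolding compact_op_iff by blast
qed

text \<open>The Toeplitz operator of \<open>trig k\<close>. Positive \<open>k\<close> belongs to the
  backward shift because the matrix entry at \<open>i\<close>, \<open>j\<close> is the coefficient
  of index \<open>j - i\<close>.\<close>

definition shift :: "int \<Rightarrow> ell2_op" where
  "shift k = (if 0 \<le> k then bshift ^ nat k else fshift ^ nat (- k))"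

lemma ell2_coord_bshift_power: "ell2_coord ((bshift ^ k) \<bullet>\<^sub>v x) n = ell2_coord x (n + k)"
  by (induction k arbitrary: n) auto

lemma ell2_coord_fshift_power:
  "ell2_coord ((fshift ^ k) \<bullet>\<^sub>v x) n = (if n < k then 0 else ell2_coord x (n - k))"
  by (induction k arbitrary: n) auto

lemma op_entry_shift: "op_entry (shift k) i j = (if int j - int i = k then 1 else 0)"
  by (auto simp: op_entry_eq shift_def ell2_coord_bshift_power ell2_coord_fshift_power ell2_basis.rep_eq)

lemma bshift_shift: "bshift * shift k = shift (k + 1)"
proof (cases "0 \<le> k")
  case True then show ?thesis by (simp add: shift_def nat_add_distrib)
next
  case False
  then have "nat (- k) = Suc (nat (- k - 1))" by simp
  then have "bshift * shift k = (bshift * fshift) * fshift ^ nat (- k - 1)"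
    using False by (simp add: shift_def mult.assoc)
  also have "\<dots> = shift (k + 1)"
    using False by (auto simp: bshift_fshift shift_def)
  finally show ?thesis .
qed

lemma fshift_shift: "compact_op (fshift * shift k - shift (k - 1))"
proof (cases "k \<le> 0")
  case True
  then have "fshift * shift k = shift (k - 1)"
    by (auto simp: shift_def nat_diff_distrib Suc_nat_eq_nat_zadd1 simp flip: power_Suc)
  then show ?thesis by simp
next
  case False
  have "fshift * shift k - shift (k - 1) = (fshift * bshift - 1) * shift (k - 1)"
    using bshift_shift[of "k - 1"] by (simp add: algebra_simps)
  also have "fshift * bshift - 1 = - (1 - fshift * bshift)" by simp
  finally show ?thesis
    by (simp only: compact_op_mult_right compact_op_uminus compact_op_one_minus_fshift_bshift)
qed

lemma shift_mult: "compact_op (shift k * shift l - shift (k + l))"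
proof (induction k rule: int_induct[where k = 0])
  case base
  show ?case by (simp add: shift_def)
next
  case (step1 i)
  have "shift (i + 1) * shift l - shift (i + 1 + l) = bshift * (shift i * shift l - shift (i + l))"
    using bshift_shift[of i] bshift_shift[of "i + l"]
    by (simp add: right_diff_distrib add_ac flip: mult.assoc)
  then show ?case using step1 by (simp add: compact_op_mult_left)
next
  case (step2 i)
  \<comment> \<open>Here \<open>i \<le> 0\<close>, so the left factor changes without error; the new
    compact term comes only from \<open>fshift * shift (i + l)\<close>.\<close>
  have "fshift * shift i = shift (i - 1)"
    using step2 by (auto simp: shift_def nat_diff_distrib Suc_nat_eq_nat_zadd1 simp flip: power_Suc)
  then have "shift (i - 1) * shift l - shift (i - 1 + l)
      = fshift * (shift i * shift l - shift (i + l)) + (fshift * shift (i + l) - shift (i + l - 1))"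
    by (simp add: right_diff_distrib algebra_simps flip: mult.assoc)
  then show ?case
    using step2 by (simp only: compact_op_add compact_op_mult_left fshift_shift)
qed

section \<open>Trigonometric polynomials\<close>

definition trig :: "int \<Rightarrow> real \<Rightarrow> complex" where
  "trig k t = exp (\<i> * of_int k * of_real t)"

lemma trig_mult: "trig k t * trig l t = trig (k + l) t"
  by (simp add: trig_def algebra_simps flip: exp_add)

lemma trig_0 [simp]: "trig 0 t = 1"
  by (simp add: trig_def)

lemma cnj_trig: "cnj (trig k t) = trig (- k) t"
  by (simp add: trig_def exp_cnj)

lemma norm_trig [simp]: "cmod (trig k t) = 1"
  by (simp add: trig_def)

lemma trig_2pi: "trig k (2 * pi) = 1"
  using exp_integer_2pi[of "of_int k"] by (simp add: trig_def mult_ac)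

lemma continuous_on_trig [continuous_intros]: "continuous_on S (trig k)"
  unfolding trig_def by (intro continuous_intros)

lemma trig_power: "trig k t ^ n = trig (k * int n) t"
  by (induction n) (simp_all add: trig_mult algebra_simps)

inductive trig_poly :: "(real \<Rightarrow> complex) \<Rightarrow> bool" where
  basis: "trig_poly (trig k)"
| add: "trig_poly f \<Longrightarrow> trig_poly g \<Longrightarrow> trig_poly (\<lambda>t. f t + g t)"
| scale: "trig_poly f \<Longrightarrow> trig_poly (\<lambda>t. c * f t)"

lemma trig_poly_const: "trig_poly (\<lambda>_. c)"
  using trig_poly.scale[OF trig_poly.basis[of 0], of c] by simp

lemma trig_poly_mult:
  assumes "trig_poly f" "trig_poly g"
  shows "trig_poly (\<lambda>t. f t * g t)"
  using assms(1)
proof induction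
  case (basis k)
  from assms(2) show ?case
  proof induction
    case (basis l)
    show ?case using trig_poly.basis[of "k + l"] by (simp add: trig_mult eta_contract_eq)
  next
    case (add f g)
    then show ?case using trig_poly.add[OF add.IH] by (simp add: distrib_left)
  next
    case (scale f c)
    then show ?case using trig_poly.scale[OF scale.IH, of c] by (simp add: mult_ac)
  qed
next
  case (add f h)
  then show ?case using trig_poly.add[OF add.IH] by (simp add: distrib_right)
next
  case (scale f c)
  then show ?case using trig_poly.scale[OF scale.IH, of c] by (simp add: mult_ac)
qed

lemma trig_poly_of_real_polynomial:
  fixes g :: "complex \<Rightarrow> real"
  assumes "real_polynomial_function g"
  shows "trig_poly (\<lambda>t. of_real (g (trig 1 t)))"
  using assms
proof induction
  case (linear g)
  \<comment> \<open>A real-linear \<open>g\<close> is \<open>Re z * g 1 + Im z * g \<i>\<close>;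
    expressing \<open>Re z\<close> and \<open>Im z\<close> by \<open>z\<close> and its conjugate
    gives the two coefficients.\<close>
  have "of_real (g (trig 1 t)) = ((of_real (g 1) - \<i> * of_real (g \<i>)) / 2) * trig 1 t
      + ((of_real (g 1) + \<i> * of_real (g \<i>)) / 2) * trig (- 1) t" for t
  proof -
    define z where "z = trig 1 t"
    have "g z = g (Re z *\<^sub>R 1 + Im z *\<^sub>R \<i>)"
      by (rule arg_cong[of _ _ g]) (simp add: complex_eq_iff)
    also have "\<dots> = Re z * g 1 + Im z * g \<i>"
      using linear by (simp add: linear_simps bounded_linear.linear linear_add linear_scale)
    finally show ?thesis
      unfolding cnj_trig[symmetric] z_def[symmetric] by (simp add: complex_eq_iff field_simps)
  qed
  then show ?case by (simp only: trig_poly.intros)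
next
  case (const c) then show ?case by (simp add: trig_poly_const)
next
  case (add f g) then show ?case using trig_poly.add[OF add.IH] by simp
next
  case (mult f g) then show ?case using trig_poly_mult[OF mult.IH] by simp
qed

section \<open>Continuous periodic symbols and density of trigonometric polynomials\<close>

lemma C2pi_continuous: "a \<in> C2pi \<Longrightarrow> continuous_on {0..2 * pi} a"
  by (simp add: C2pi_def)

lemma C2pi_trig: "trig k \<in> C2pi"
  using trig_2pi[of k] by (simp add: C2pi_def continuous_on_trig) (simp add: trig_def)

lemma C2pi_add: "f \<in> C2pi \<Longrightarrow> g \<in> C2pi \<Longrightarrow> (\<lambda>t. f t + g t) \<in> C2pi"
  by (auto simp: C2pi_def intro!: continuous_intros)

lemma C2pi_diff: "f \<in> C2pi \<Longrightarrow> g \<in> C2pi \<Longrightarrow> (\<lambda>t. f t - g t) \<in> C2pi"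
  by (auto simp: C2pi_def intro!: continuous_intros)

lemma C2pi_mult: "f \<in> C2pi \<Longrightarrow> g \<in> C2pi \<Longrightarrow> (\<lambda>t. f t * g t) \<in> C2pi"
  by (auto simp: C2pi_def intro!: continuous_intros)

lemma C2pi_const: "(\<lambda>_. c) \<in> C2pi"
  by (auto simp: C2pi_def)

lemma C2pi_scale: "f \<in> C2pi \<Longrightarrow> (\<lambda>t. c * f t) \<in> C2pi"
  by (intro C2pi_mult C2pi_const)

lemma C2pi_trig_poly: "trig_poly f \<Longrightarrow> f \<in> C2pi"
  by (induction rule: trig_poly.induct) (auto intro: C2pi_trig C2pi_add C2pi_scale)

lemma C2pi_uniform_limit:
  assumes "\<And>n. f n \<in> C2pi" "uniform_limit {0..2 * pi} f a sequentially"
  shows "a \<in> C2pi"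
proof -
  have "continuous_on {0..2 * pi} a"
    by (rule uniform_limit_theorem[OF _ assms(2)]) (use assms(1) in \<open>auto simp: C2pi_def\<close>)
  moreover have "(\<lambda>n. f n 0) \<longlonglongrightarrow> a 0" "(\<lambda>n. f n (2 * pi)) \<longlonglongrightarrow> a (2 * pi)"
    by (rule tendsto_uniform_limitI[OF assms(2)], simp)+
  then have "a 0 = a (2 * pi)"
    using assms(1) LIMSEQ_unique by (auto simp: C2pi_def)
  ultimately show ?thesis by (simp add: C2pi_def)
qed

text \<open>The circle is a quotient of \<open>[0, 2\<pi>]\<close>, so \<open>a\<close> is a continuous function on the circle.\<close>

lemma C2pi_on_circle:
  assumes "a \<in> C2pi"
  obtains f where "continuous_on (sphere 0 1) f" "\<And>t. t \<in> {0..2 * pi} \<Longrightarrow> f (trig 1 t) = a t"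
proof
  define f where "f = a \<circ> Arg2pi"
  let ?I = "{0..2 * pi}" and ?S = "sphere (0::complex) 1"
  have arg: "trig 1 (Arg2pi z) = z" if "z \<in> ?S" for z
    using that Arg2pi_eq[of z] by (simp add: trig_def)
  have im: "trig 1 ` ?I = ?S"
  proof
    show "?S \<subseteq> trig 1 ` ?I"
    proof
      fix z assume z: "z \<in> ?S"
      have "Arg2pi z \<in> ?I" using Arg2pi_ge_0[of z] Arg2pi_lt_2pi[of z] by auto
      then show "z \<in> trig 1 ` ?I" using arg[OF z] by (metis image_eqI)
    qed
  qed auto
  show fa: "f (trig 1 t) = a t" if "t \<in> ?I" for t
  proof (cases "t = 2 * pi")
    case True
    have "Arg2pi 1 = 0" by (rule Arg2pi_unique[of 1]) auto
    then show ?thesis using assms True trig_2pi[of 1] by (simp add: f_def C2pi_def)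
  next
    case False
    then have "Arg2pi (trig 1 t) = t"
      using that by (intro Arg2pi_unique[of 1]) (auto simp: trig_def)
    then show ?thesis by (simp add: f_def)
  qed
  show "continuous_on ?S f"
    unfolding continuous_on_open
  proof (intro allI impI)
    fix U assume "openin (top_of_set (f ` ?S)) U"
    then obtain W where W: "open W" "U = f ` ?S \<inter> W" by (auto simp: openin_open)
    have "f ` ?S = a ` ?I"
      unfolding im[symmetric] image_image using fa by (intro image_cong) auto
    then have "?I \<inter> trig 1 -` (?S \<inter> f -` U) = ?I \<inter> a -` W"
      using fa by (auto simp: W)
    moreover have "openin (top_of_set ?I) (?I \<inter> a -` W)"
      using continuous_openin_preimage_gen[OF C2pi_continuous[OF assms] W(1)] .
    ultimately show "openin (top_of_set ?S) (?S \<inter> f -` U)"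
      using Abstract_Topology_2.continuous_imp_quotient_map[OF continuous_on_trig im, of "?S \<inter> f -` U"] by auto
  qed
qed

text \<open>Stone-Weierstrass on the circle, used for real and imaginary part separately. A real
  polynomial in the two coordinates of the plane is a trigonometric polynomial on the
  circle.\<close>

lemma trig_poly_dense:
  assumes "a \<in> C2pi" "0 < e"
  obtains q where "trig_poly q" "\<And>t. t \<in> {0..2 * pi} \<Longrightarrow> cmod (q t - a t) < e"
proof -
  obtain f where f: "continuous_on (sphere 0 1) f" "\<And>t. t \<in> {0..2 * pi} \<Longrightarrow> f (trig 1 t) = a t"
    using C2pi_on_circle[OF assms(1)] by blast
  obtain g where g: "real_polynomial_function g" "\<And>z. z \<in> sphere 0 1 \<Longrightarrow> \<bar>Re (f z) - g z\<bar> < e / 2"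
    using Stone_Weierstrass_real_polynomial_function[of "sphere (0::complex) 1" "\<lambda>z. Re (f z)" "e / 2"]
      f(1) assms(2) by (auto intro: continuous_intros)
  obtain h where h: "real_polynomial_function h" "\<And>z. z \<in> sphere 0 1 \<Longrightarrow> \<bar>Im (f z) - h z\<bar> < e / 2"
    using Stone_Weierstrass_real_polynomial_function[of "sphere (0::complex) 1" "\<lambda>z. Im (f z)" "e / 2"]
      f(1) assms(2) by (auto intro: continuous_intros)
  define q where "q t = complex_of_real (g (trig 1 t)) + \<i> * of_real (h (trig 1 t))" for t
  have "trig_poly q"
    unfolding q_def by (intro trig_poly.add trig_poly.scale trig_poly_of_real_polynomial g h)
  moreover have "cmod (q t - a t) < e" if "t \<in> {0..2 * pi}" for t
  proof -
    have "cmod (q t - a t) \<le> \<bar>Re (q t - a t)\<bar> + \<bar>Im (q t - a t)\<bar>" by (rule cmod_le)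
    also have "\<dots> < e / 2 + e / 2"
      using g(2)[of "trig 1 t"] h(2)[of "trig 1 t"] f(2)[OF that]
      by (intro add_strict_mono) (auto simp: q_def abs_minus_commute)
    finally show ?thesis by simp
  qed
  ultimately show ?thesis using that by blast
qed

text \<open>Density as an induction rule. It carries the existence of Toeplitz operators, their
  products modulo compact operators and their symbols from characters to all continuous
  symbols.\<close>

lemma C2pi_induct [consumes 1, case_names trig add scale limit]:
  assumes "a \<in> C2pi"
    and trig: "\<And>k. P (trig k)"
    and add: "\<And>f g. f \<in> C2pi \<Longrightarrow> g \<in> C2pi \<Longrightarrow> P f \<Longrightarrow> P g \<Longrightarrow> P (\<lambda>t. f t + g t)"
    and scale: "\<And>f c. f \<in> C2pi \<Longrightarrow> P f \<Longrightarrow> P (\<lambda>t. c * f t)"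
    and limit: "\<And>f a. (\<And>n::nat. f n \<in> C2pi) \<Longrightarrow> (\<And>n. P (f n)) \<Longrightarrow> a \<in> C2pi \<Longrightarrow>
      uniform_limit {0..2 * pi} f a sequentially \<Longrightarrow> P a"
  shows "P a"
proof -
  have tp: "P q" if "trig_poly q" for q
    using that by induction (auto intro: trig add scale C2pi_trig_poly)
  have "\<exists>q. trig_poly q \<and> (\<forall>t\<in>{0..2 * pi}. dist (q t) (a t) < e)" if "0 < e" for e
    by (rule trig_poly_dense[OF assms(1) that]) (auto simp: dist_norm)
  from uniform_limit_sequence_exists[of trig_poly, OF this] obtain q
    where q: "\<And>n. trig_poly (q n)" "uniform_limit {0..2 * pi} q a sequentially" by blast
  then show ?thesis using limit[of q a] tp C2pi_trig_poly assms(1) by blast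
qed


section \<open>Toeplitz operators\<close>

lemma fourier_coeff_eq:
  "fourier_coeff a k = integral {0..2 * pi} (\<lambda>t. a t * trig (- k) t) / (2 * pi)"
  by (simp add: fourier_coeff_def trig_def)

lemma fourier_integrable:
  assumes "continuous_on {0..2 * pi} a"
  shows "(\<lambda>t. a t * trig k t) integrable_on {0..2 * pi}"
  by (intro integrable_continuous_interval continuous_intros assms)

lemma fourier_coeff_trig: "fourier_coeff (trig l) k = (if l = k then 1 else 0)"
proof (cases "l = k")
  case True
  then show ?thesis by (simp add: fourier_coeff_eq trig_mult scaleR_conv_of_real)
next
  case False
  define c where "c = \<i> * of_int (l - k)"
  have "c \<noteq> 0" using False by (simp add: c_def)
  have "((\<lambda>t. trig (l - k) t) has_integral
      exp (c * of_real (2 * pi)) / c - exp (c * of_real 0) / c) {0..2 * pi}"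
    unfolding trig_def c_def[symmetric]
    using \<open>c \<noteq> 0\<close>
    by (intro fundamental_theorem_of_calculus)
       (auto intro!: derivative_eq_intros has_vector_derivative_real_field)
  moreover have "exp (c * of_real (2 * pi)) = 1"
    using trig_2pi[of "l - k"] by (simp add: trig_def c_def)
  ultimately have "integral {0..2 * pi} (\<lambda>t. trig (l - k) t) = 0"
    by (simp add: integral_unique)
  then show ?thesis using False by (simp add: fourier_coeff_eq trig_mult)
qed

lemma fourier_coeff_add:
  assumes "a \<in> C2pi" "b \<in> C2pi"
  shows "fourier_coeff (\<lambda>t. a t + b t) k = fourier_coeff a k + fourier_coeff b k"
  unfolding fourier_coeff_eq distrib_right
  by (subst integral_add) (use assms in \<open>auto intro!: fourier_integrable C2pi_continuous simp: add_divide_distrib\<close>)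

lemma fourier_coeff_scale: "fourier_coeff (\<lambda>t. c * a t) k = c * fourier_coeff a k"
  by (simp add: fourier_coeff_eq mult.assoc)

lemma fourier_coeff_diff:
  assumes "a \<in> C2pi" "b \<in> C2pi"
  shows "fourier_coeff (\<lambda>t. a t - b t) k = fourier_coeff a k - fourier_coeff b k"
  using fourier_coeff_add[OF C2pi_diff[OF assms] assms(2), of k] by simp

lemma norm_fourier_coeff_le:
  assumes "a \<in> C2pi" "\<And>t. t \<in> {0..2 * pi} \<Longrightarrow> cmod (a t) \<le> c"
  shows "cmod (fourier_coeff a k) \<le> c"
proof -
  have "cmod (integral {0..2 * pi} (\<lambda>t. a t * trig (- k) t)) \<le> c * (2 * pi - 0)"
    by (intro integral_bound continuous_intros C2pi_continuous assms(1))
       (use assms(2) in \<open>auto simp: norm_mult\<close>)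
  then show ?thesis by (simp add: fourier_coeff_eq norm_divide field_simps)
qed

text \<open>Whatever the sup norm of a symbol controls converges along uniformly convergent symbols;
  this serves Fourier coefficients and Toeplitz operators alike.\<close>

lemma LIMSEQ_of_uniform_limit:
  assumes "uniform_limit S f a sequentially"
    and le: "\<And>n c. (\<And>t. t \<in> S \<Longrightarrow> norm (f n t - a t) \<le> c) \<Longrightarrow> norm (g n - l) \<le> c"
  shows "g \<longlonglongrightarrow> l"
proof (rule LIMSEQ_I)
  fix e :: real assume "0 < e"
  then obtain N where N: "\<forall>n\<ge>N. \<forall>t\<in>S. dist (f n t) (a t) < e / 2"
    using uniform_limitD[OF assms(1), of "e / 2"] unfolding eventually_sequentially by auto
  have "norm (g n - l) \<le> e / 2" if "n \<ge> N" for n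
    by (rule le) (use N that in \<open>force simp: dist_norm\<close>)
  then show "\<exists>no. \<forall>n\<ge>no. norm (g n - l) < e"
    using \<open>0 < e\<close> by (intro exI[of _ N]) (smt (verit) field_sum_of_halves)
qed

lemma fourier_coeff_LIMSEQ:
  assumes "\<And>n. f n \<in> C2pi" "a \<in> C2pi" "uniform_limit {0..2 * pi} f a sequentially"
  shows "(\<lambda>n. fourier_coeff (f n) k) \<longlonglongrightarrow> fourier_coeff a k"
  by (rule LIMSEQ_of_uniform_limit[OF assms(3)], unfold fourier_coeff_diff[OF assms(1,2), symmetric])
     (rule norm_fourier_coeff_le[OF C2pi_diff[OF assms(1,2)]])

text \<open>A relation that can be used before the existence of the operator is known.\<close>

definition is_toeplitz :: "ell2_op \<Rightarrow> (real \<Rightarrow> complex) \<Rightarrow> bool" where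
  "is_toeplitz A a \<longleftrightarrow> (\<forall>i j. op_entry A i j = fourier_coeff a (int j - int i))"

lemma is_toeplitz_unique: "is_toeplitz A a \<Longrightarrow> is_toeplitz B a \<Longrightarrow> A = B"
  by (rule op_eq_of_entries) (simp add: is_toeplitz_def)

text \<open>The negative frequency matches the matrix convention: in
  \<open>cnj (fin_symbol J u t) * fin_symbol J v t\<close> the pair \<open>u i\<close>,
  \<open>v j\<close> meets \<open>trig (int i - int j)\<close>, which integrates \<open>a\<close> to
  its coefficient of index \<open>j - i\<close>.\<close>

definition fin_symbol :: "nat set \<Rightarrow> (nat \<Rightarrow> complex) \<Rightarrow> real \<Rightarrow> complex" where
  "fin_symbol J u t = (\<Sum>j\<in>J. u j * trig (- int j) t)"

lemma continuous_on_fin_symbol: "continuous_on S (fin_symbol J u)"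
  unfolding fin_symbol_def by (intro continuous_intros)

lemma fourier_form:
  assumes a: "continuous_on {0..2 * pi} a" and J: "finite J"
  shows "(\<Sum>i\<in>J. \<Sum>j\<in>J. cnj (u i) * v j * fourier_coeff a (int j - int i))
    = integral {0..2 * pi} (\<lambda>t. a t * (cnj (fin_symbol J u t) * fin_symbol J v t)) / (2 * pi)"
proof -
  have *: "a t * (cnj (fin_symbol J u t) * fin_symbol J v t)
      = (\<Sum>i\<in>J. \<Sum>j\<in>J. cnj (u i) * v j * (a t * trig (int i - int j) t))" for t
  proof -
    have "a t * (cnj (fin_symbol J u t) * fin_symbol J v t)
        = a t * (\<Sum>i\<in>J. \<Sum>j\<in>J. cnj (u i * trig (- int i) t) * (v j * trig (- int j) t))"
      by (simp only: fin_symbol_def cnj_sum sum_product)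
    also have "\<dots> = (\<Sum>i\<in>J. \<Sum>j\<in>J. a t * (cnj (u i * trig (- int i) t) * (v j * trig (- int j) t)))"
      by (simp only: sum_distrib_left)
    also have "\<dots> = (\<Sum>i\<in>J. \<Sum>j\<in>J. cnj (u i) * v j * (a t * trig (int i - int j) t))"
    proof (intro sum.cong refl)
      fix i j
      have "trig (int i - int j) t = trig (int i) t * trig (- int j) t" by (simp add: trig_mult)
      then show "a t * (cnj (u i * trig (- int i) t) * (v j * trig (- int j) t))
          = cnj (u i) * v j * (a t * trig (int i - int j) t)"
        by (simp add: cnj_trig mult_ac)
    qed
    finally show ?thesis .
  qed
  have int: "(\<lambda>t. cnj (u i) * v j * (a t * trig (int i - int j) t)) integrable_on {0..2 * pi}" for i j
    by (intro integrable_continuous_interval continuous_intros a)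
  have "integral {0..2 * pi} (\<lambda>t. a t * (cnj (fin_symbol J u t) * fin_symbol J v t))
      = (\<Sum>i\<in>J. \<Sum>j\<in>J. cnj (u i) * v j * integral {0..2 * pi} (\<lambda>t. a t * trig (int i - int j) t))"
    unfolding * by (simp add: integral_sum integrable_sum J int)
  then show ?thesis
    by (simp add: fourier_coeff_eq sum_divide_distrib)
qed

text \<open>The case of the constant symbol 1 in \<open>fourier_form\<close>, where only the
  diagonal survives.\<close>

lemma fin_symbol_Parseval:
  assumes "finite J"
  shows "integral {0..2 * pi} (\<lambda>t. (cmod (fin_symbol J u t))\<^sup>2) = 2 * pi * (norm (ell2_fin J u))\<^sup>2"
proof -
  have 1: "fourier_coeff (\<lambda>_. 1) k = (if k = 0 then 1 else 0)" for k
    using fourier_coeff_trig[of 0 k] by (simp add: trig_def[abs_def])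
  have "(\<Sum>i\<in>J. \<Sum>j\<in>J. cnj (u i) * u j * fourier_coeff (\<lambda>_. 1) (int j - int i))
      = (\<Sum>i\<in>J. \<Sum>j\<in>J. if j = i then cnj (u i) * u i else 0)"
    by (intro sum.cong refl) (auto simp: 1)
  also have "\<dots> = of_real ((norm (ell2_fin J u))\<^sup>2)"
    unfolding norm_ell2_fin[OF assms] using assms
    by (simp add: sum.delta complex_norm_square mult.commute del: of_real_power)
  finally have "of_real ((norm (ell2_fin J u))\<^sup>2)
      = integral {0..2 * pi} (\<lambda>t. cnj (fin_symbol J u t) * fin_symbol J u t) / (2 * pi)"
    using fourier_form[of "\<lambda>_. 1" J u u] assms by simp
  also have "(\<lambda>t. cnj (fin_symbol J u t) * fin_symbol J u t)
      = complex_of_real \<circ> (\<lambda>t. (cmod (fin_symbol J u t))\<^sup>2)"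
    by (auto simp: complex_norm_square mult.commute simp del: of_real_power)
  also have "integral {0..2 * pi} \<dots> = of_real (integral {0..2 * pi} (\<lambda>t. (cmod (fin_symbol J u t))\<^sup>2))"
    by (intro integral_linear bounded_linear_of_real integrable_continuous_interval
        continuous_intros continuous_on_fin_symbol)
  finally have "complex_of_real ((norm (ell2_fin J u))\<^sup>2)
      = of_real (integral {0..2 * pi} (\<lambda>t. (cmod (fin_symbol J u t))\<^sup>2) / (2 * pi))" by simp
  then show ?thesis by (simp only: of_real_eq_iff) (simp add: field_simps)
qed

text \<open>For finitely supported vectors the form is an integral of \<open>a\<close> against two
  trigonometric polynomials; the arithmetic-geometric inequality under the integral and Parseval's
  identity bound it. Truncation extends this to all vectors.\<close>

lemma is_toeplitz_norm_le:
  assumes A: "is_toeplitz A a" and a: "a \<in> C2pi"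
    and c: "\<And>t. t \<in> {0..2 * pi} \<Longrightarrow> cmod (a t) \<le> c"
  shows "norm A \<le> c"
proof -
  have "0 \<le> c" using c[of 0] norm_ge_zero order_trans by (metis atLeastAtMost_iff order_refl pi_ge_zero mult_nonneg_nonneg zero_le_numeral)
  have ac: "continuous_on {0..2 * pi} a" by (rule C2pi_continuous[OF a])
  have fin: "x \<bullet> (A \<bullet>\<^sub>v y) \<le> c / 2 * ((norm x)\<^sup>2 + (norm y)\<^sup>2)"
    if J: "finite J" and xy: "x = ell2_fin J u" "y = ell2_fin J v" for x y J u v
  proof -
    let ?u = "fin_symbol J u" and ?v = "fin_symbol J v"
    have "cinner_ell2 x (A \<bullet>\<^sub>v y) = (\<Sum>i\<in>J. cnj (u i) * ell2_coord (A \<bullet>\<^sub>v y) i)"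
      unfolding xy(1) cinner_ell2.rep_eq
      by (subst suminf_finite[where N = J]) (auto simp: J ell2_coord_fin)
    also have "\<dots> = (\<Sum>i\<in>J. \<Sum>j\<in>J. cnj (u i) * v j * fourier_coeff a (int j - int i))"
      using A unfolding xy(2) ell2_fin_def op_apply_sum_right ell2_coord_sum is_toeplitz_def op_entry_eq
      by (simp add: scaleC_ell2.rep_eq sum_distrib_left mult.assoc)
    also have "\<dots> = integral {0..2 * pi} (\<lambda>t. a t * (cnj (?u t) * ?v t)) / (2 * pi)"
      by (rule fourier_form[OF ac J])
    finally have eq: "cinner_ell2 x (A \<bullet>\<^sub>v y) = integral {0..2 * pi} (\<lambda>t. a t * (cnj (?u t) * ?v t)) / (2 * pi)" .
    have iu: "(\<lambda>t. (cmod (fin_symbol J w t))\<^sup>2) integrable_on {0..2 * pi}" for w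
      by (intro integrable_continuous_interval continuous_intros continuous_on_fin_symbol)
    have "cmod (integral {0..2 * pi} (\<lambda>t. a t * (cnj (?u t) * ?v t)))
        \<le> integral {0..2 * pi} (\<lambda>t. c / 2 * ((cmod (?u t))\<^sup>2 + (cmod (?v t))\<^sup>2))"
    proof (rule integral_norm_bound_integral)
      fix t assume t: "t \<in> {0..2 * pi}"
      have "cmod (a t) * (cmod (?u t) * cmod (?v t)) \<le> c * (((cmod (?u t))\<^sup>2 + (cmod (?v t))\<^sup>2) / 2)"
        using sum_squares_bound[of "cmod (?u t)" "cmod (?v t)"] \<open>0 \<le> c\<close> c[OF t]
        by (intro mult_mono) auto
      then show "cmod (a t * (cnj (?u t) * ?v t)) \<le> c / 2 * ((cmod (?u t))\<^sup>2 + (cmod (?v t))\<^sup>2)"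
        by (simp add: norm_mult)
    qed (intro integrable_continuous_interval continuous_intros continuous_on_fin_symbol ac)+
    also have "\<dots> = c / 2 * (2 * pi * (norm x)\<^sup>2 + 2 * pi * (norm y)\<^sup>2)"
      unfolding xy using J by (simp add: integral_add iu fin_symbol_Parseval)
    finally have "cmod (cinner_ell2 x (A \<bullet>\<^sub>v y)) \<le> c / 2 * ((norm x)\<^sup>2 + (norm y)\<^sup>2)"
      unfolding eq by (simp add: norm_divide field_simps)
    then show ?thesis
      unfolding inner_ell2_def using complex_Re_le_cmod order_trans by blast
  qed
  have all: "x \<bullet> (A \<bullet>\<^sub>v y) \<le> c / 2 * ((norm x)\<^sup>2 + (norm y)\<^sup>2)" for x y
  proof (rule LIMSEQ_le)
    let ?x = "\<lambda>N. ell2_fin {..<N} (ell2_coord x)" and ?y = "\<lambda>N. ell2_fin {..<N} (ell2_coord y)"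
    show "(\<lambda>N. ?x N \<bullet> (A \<bullet>\<^sub>v ?y N)) \<longlonglongrightarrow> x \<bullet> (A \<bullet>\<^sub>v y)"
      by (intro tendsto_intros tendsto_op_apply_right ell2_trunc_LIMSEQ)
    show "(\<lambda>N. c / 2 * ((norm (?x N))\<^sup>2 + (norm (?y N))\<^sup>2)) \<longlonglongrightarrow> c / 2 * ((norm x)\<^sup>2 + (norm y)\<^sup>2)"
      by (intro tendsto_intros ell2_trunc_LIMSEQ)
    show "\<exists>N. \<forall>n\<ge>N. ?x n \<bullet> (A \<bullet>\<^sub>v ?y n) \<le> c / 2 * ((norm (?x n))\<^sup>2 + (norm (?y n))\<^sup>2)"
      using fin by blast
  qed
  show ?thesis by (rule norm_op_le_of_form[OF \<open>0 \<le> c\<close> all])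
qed

section \<open>Toeplitz operators with continuous symbols\<close>

lemma is_toeplitz_shift: "is_toeplitz (shift k) (trig k)"
  by (auto simp: is_toeplitz_def op_entry_shift fourier_coeff_trig)

lemma is_toeplitz_add:
  "is_toeplitz A a \<Longrightarrow> is_toeplitz B b \<Longrightarrow> a \<in> C2pi \<Longrightarrow> b \<in> C2pi \<Longrightarrow> is_toeplitz (A + B) (\<lambda>t. a t + b t)"
  by (simp add: is_toeplitz_def op_entry_linear fourier_coeff_add)

lemma is_toeplitz_diff:
  "is_toeplitz A a \<Longrightarrow> is_toeplitz B b \<Longrightarrow> a \<in> C2pi \<Longrightarrow> b \<in> C2pi \<Longrightarrow> is_toeplitz (A - B) (\<lambda>t. a t - b t)"
  by (simp add: is_toeplitz_def op_entry_linear fourier_coeff_diff)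

lemma is_toeplitz_scale: "is_toeplitz A a \<Longrightarrow> is_toeplitz (scaleC_op c A) (\<lambda>t. c * a t)"
  by (simp add: is_toeplitz_def op_entry_linear fourier_coeff_scale)

text \<open>The norm bound for differences makes the operators of uniformly convergent symbols a
  Cauchy sequence; the matrix of the limit is found entry by entry.\<close>

lemma is_toeplitz_exists: "a \<in> C2pi \<Longrightarrow> \<exists>A. is_toeplitz A a"
proof (induction rule: C2pi_induct)
  case (limit f a)
  then obtain S where S: "\<And>n. is_toeplitz (S n) (f n)" by metis
  have "Cauchy S"
  proof (rule CauchyI)
    fix e :: real assume "0 < e"
    then obtain N where N: "\<And>n t. n \<ge> N \<Longrightarrow> t \<in> {0..2 * pi} \<Longrightarrow> dist (f n t) (a t) < e / 4"
      using uniform_limitD[OF limit(3), of "e / 4"] \<open>0 < e\<close> unfolding eventually_sequentially by (metis divide_pos_pos zero_less_numeral)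
    have "norm (S m - S n) < e" if "m \<ge> N" "n \<ge> N" for m n
    proof -
      have "norm (S m - S n) \<le> e / 2"
      proof (rule is_toeplitz_norm_le[OF is_toeplitz_diff[OF S S limit(1) limit(1)]])
        fix t assume t: "t \<in> {0..2 * pi}"
        have "dist (f m t) (f n t) \<le> dist (f m t) (a t) + dist (f n t) (a t)"
          by (rule dist_triangle2)
        then show "cmod (f m t - f n t) \<le> e / 2"
          using N[OF that(1) t] N[OF that(2) t] by (simp add: dist_norm)
      qed (intro C2pi_diff limit(1))
      then show ?thesis using \<open>0 < e\<close> by simp
    qed
    then show "\<exists>M. \<forall>m\<ge>M. \<forall>n\<ge>M. norm (S m - S n) < e" by blast
  qed
  then obtain A where A: "S \<longlonglongrightarrow> A" using Cauchy_convergent convergent_def by blast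
  have "op_entry A i j = fourier_coeff a (int j - int i)" for i j
    using op_entry_LIMSEQ[OF A, of i j] fourier_coeff_LIMSEQ[OF limit(1,2,3), of "int j - int i"] S
      LIMSEQ_unique unfolding is_toeplitz_def by auto
  then show ?case unfolding is_toeplitz_def by blast
qed (use is_toeplitz_shift is_toeplitz_add is_toeplitz_scale in blast)+

lemma is_toeplitz_toeplitz: "a \<in> C2pi \<Longrightarrow> is_toeplitz (toeplitz a) a"
proof -
  assume "a \<in> C2pi"
  then obtain A where "is_toeplitz A a" using is_toeplitz_exists by blast
  moreover from this have "toeplitz a = A"
    unfolding toeplitz_def is_toeplitz_def[symmetric]
    by (rule the_equality) (blast intro: is_toeplitz_unique calculation)
  ultimately show ?thesis by simp
qed

lemma toeplitz_eqI: "is_toeplitz A a \<Longrightarrow> a \<in> C2pi \<Longrightarrow> toeplitz a = A"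
  by (rule is_toeplitz_unique[OF is_toeplitz_toeplitz])

lemma toeplitz_add:
  "a \<in> C2pi \<Longrightarrow> b \<in> C2pi \<Longrightarrow> toeplitz (\<lambda>t. a t + b t) = toeplitz a + toeplitz b"
  by (intro toeplitz_eqI is_toeplitz_add is_toeplitz_toeplitz C2pi_add)

lemma toeplitz_scale: "a \<in> C2pi \<Longrightarrow> toeplitz (\<lambda>t. c * a t) = scaleC_op c (toeplitz a)"
  by (intro toeplitz_eqI is_toeplitz_scale is_toeplitz_toeplitz C2pi_scale)

lemma toeplitz_trig: "toeplitz (trig k) = shift k"
  by (intro toeplitz_eqI is_toeplitz_shift C2pi_trig)

lemma toeplitz_one: "toeplitz (\<lambda>_. 1) = 1"
  using toeplitz_trig[of 0] by (simp add: trig_def[abs_def] shift_def)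

text \<open>The symbol of the Karcher mean agrees with \<open>geo_mean_symbol p a\<close> only on
  the interval; this lemma makes that enough.\<close>

lemma toeplitz_cong:
  assumes "\<And>t. t \<in> {0..2 * pi} \<Longrightarrow> a t = b t"
  shows "toeplitz a = toeplitz b"
proof -
  have "fourier_coeff a k = fourier_coeff b k" for k
    unfolding fourier_coeff_def
    by (subst Henstock_Kurzweil_Integration.integral_cong) (use assms in auto)
  then show ?thesis by (simp add: toeplitz_def)
qed

lemma toeplitz_LIMSEQ:
  assumes "\<And>n. f n \<in> C2pi" "a \<in> C2pi" "uniform_limit {0..2 * pi} f a sequentially"
  shows "(\<lambda>n. toeplitz (f n)) \<longlonglongrightarrow> toeplitz a"
  by (rule LIMSEQ_of_uniform_limit[OF assms(3)],
      rule is_toeplitz_norm_le[OF is_toeplitz_diff C2pi_diff[OF assms(1,2)]])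
     (auto intro: is_toeplitz_toeplitz assms)

section \<open>Products modulo compact operators\<close>

lemma uniform_limit_C2pi_mult:
  assumes "\<And>n. f n \<in> C2pi" "a \<in> C2pi" "b \<in> C2pi" "uniform_limit {0..2 * pi} f a sequentially"
  shows "uniform_limit {0..2 * pi} (\<lambda>n t. f n t * b t) (\<lambda>t. a t * b t) sequentially"
    and "uniform_limit {0..2 * pi} (\<lambda>n t. b t * f n t) (\<lambda>t. b t * a t) sequentially"
proof -
  have bd: "bounded (g ` {0..2 * pi})" if "g \<in> C2pi" for g
    by (intro compact_imp_bounded compact_continuous_image C2pi_continuous that) simp
  show 1: "uniform_limit {0..2 * pi} (\<lambda>n t. f n t * b t) (\<lambda>t. a t * b t) sequentially"
    by (intro uniform_lim_mult assms uniform_limit_const bd)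
  then show "uniform_limit {0..2 * pi} (\<lambda>n t. b t * f n t) (\<lambda>t. b t * a t) sequentially"
    by (simp add: mult.commute)
qed

text \<open>Density is used in one factor at a time. With a character on the left the base case is
  \<open>shift_mult\<close>, and limits are harmless because compact operators are closed in
  norm.\<close>

lemma toeplitz_mult_trig:
  "b \<in> C2pi \<Longrightarrow> compact_op (toeplitz (trig k) * toeplitz b - toeplitz (\<lambda>t. trig k t * b t))"
proof (induction rule: C2pi_induct)
  case (trig l)
  have "(\<lambda>t. trig k t * trig l t) = trig (k + l)" by (auto simp: trig_mult)
  then show ?case by (simp add: toeplitz_trig shift_mult)
next
  case (add f g)
  have "toeplitz (\<lambda>t. trig k t * (f t + g t)) = toeplitz (\<lambda>t. trig k t * f t) + toeplitz (\<lambda>t. trig k t * g t)"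
    unfolding distrib_left by (intro toeplitz_add C2pi_mult C2pi_trig add)
  then show ?case
    using compact_op_add[OF add(3,4)] by (simp add: toeplitz_add[OF add(1,2)] algebra_simps)
next
  case (scale f c)
  have "toeplitz (\<lambda>t. c * (trig k t * f t)) = scaleC_op c (toeplitz (\<lambda>t. trig k t * f t))"
    by (intro toeplitz_scale C2pi_mult C2pi_trig scale)
  then show ?case
    using compact_op_scaleC[OF scale(2), of c]
    by (simp add: toeplitz_scale[OF scale(1)] scaleC_op_diff_right mult_ac)
next
  case (limit f a)
  show ?case
  proof (rule compact_op_LIMSEQ[OF limit(4)])
    show "(\<lambda>n. toeplitz (trig k) * toeplitz (f n) - toeplitz (\<lambda>t. trig k t * f n t))
      \<longlonglongrightarrow> toeplitz (trig k) * toeplitz a - toeplitz (\<lambda>t. trig k t * a t)"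
      by (intro tendsto_intros toeplitz_LIMSEQ uniform_limit_C2pi_mult C2pi_mult C2pi_trig limit)
  qed
qed

lemma toeplitz_mult:
  assumes b: "b \<in> C2pi"
  shows "a \<in> C2pi \<Longrightarrow> compact_op (toeplitz a * toeplitz b - toeplitz (\<lambda>t. a t * b t))"
proof (induction rule: C2pi_induct)
  case (trig k)
  show ?case by (rule toeplitz_mult_trig[OF b])
next
  case (add f g)
  have "toeplitz (\<lambda>t. (f t + g t) * b t) = toeplitz (\<lambda>t. f t * b t) + toeplitz (\<lambda>t. g t * b t)"
    unfolding distrib_right by (intro toeplitz_add C2pi_mult b add)
  then show ?case
    using compact_op_add[OF add(3,4)] by (simp add: toeplitz_add[OF add(1,2)] algebra_simps)
next
  case (scale f c)
  have "toeplitz (\<lambda>t. c * (f t * b t)) = scaleC_op c (toeplitz (\<lambda>t. f t * b t))"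
    by (intro toeplitz_scale C2pi_mult b scale)
  then show ?case
    using compact_op_scaleC[OF scale(2), of c]
    by (simp add: toeplitz_scale[OF scale(1)] scaleC_op_diff_right mult_ac)
next
  case (limit f a)
  show ?case
  proof (rule compact_op_LIMSEQ[OF limit(4)])
    show "(\<lambda>n. toeplitz (f n) * toeplitz b - toeplitz (\<lambda>t. f n t * b t))
      \<longlonglongrightarrow> toeplitz a * toeplitz b - toeplitz (\<lambda>t. a t * b t)"
      by (intro tendsto_intros toeplitz_LIMSEQ uniform_limit_C2pi_mult C2pi_mult b limit)
  qed
qed

section \<open>The symbol at a point\<close>

text \<open>
  For a quasi-Toeplitz operator the unit vectors \<open>wave n t\<close>, which move to infinity, are approximate
  eigenvectors whose approximate eigenvalue is the symbol at \<open>t\<close>.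
\<close>

definition wave :: "nat \<Rightarrow> real \<Rightarrow> ell2" where
  "wave n t = ell2_fin {Suc n..<2 * Suc n} (\<lambda>j. of_real (1 / sqrt (Suc n)) * trig (int j) t)"

definition symbol_at :: "real \<Rightarrow> ell2_op \<Rightarrow> complex \<Rightarrow> bool" where
  "symbol_at t A c \<longleftrightarrow> (\<lambda>n. A \<bullet>\<^sub>v wave n t - c *\<^sub>C wave n t) \<longlonglongrightarrow> 0"

lemma ell2_coord_wave: "ell2_coord (wave n t) j =
    (if Suc n \<le> j \<and> j < 2 * Suc n then of_real (1 / sqrt (Suc n)) * trig (int j) t else 0)"
  unfolding wave_def by (subst ell2_coord_fin) auto

lemma norm_wave [simp]: "norm (wave n t) = 1"
proof -
  have "(norm (wave n t))\<^sup>2 = (\<Sum>j=Suc n..<2 * Suc n. 1 / real (Suc n))"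
    unfolding wave_def
    by (subst norm_ell2_fin) (auto simp: norm_mult norm_divide power_divide simp del: of_nat_Suc)
  also have "\<dots> = 1" by simp
  finally show ?thesis
    by (simp add: power2_eq_1_iff) (metis norm_ge_zero not_one_le_zero le_minus_one_simps(3))
qed

text \<open>A shift acts on a wave as multiplication by a phase except at the two ends of the
  support. The error thus has two entries of modulus \<open>1 / sqrt (Suc n)\<close>.\<close>

lemma shift_error_LIMSEQ:
  assumes J: "\<And>n. finite (J n)" "\<And>n. card (J n) = 2"
    and x: "\<And>n. x n = ell2_fin (J n) (d n)"
    and d: "\<And>n j. j \<in> J n \<Longrightarrow> cmod (d n j) = 1 / sqrt (Suc n)"
  shows "x \<longlonglongrightarrow> 0"
proof -
  have "norm (x n) = sqrt (2 * (1 / real (Suc n)))" for n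
  proof -
    have "(norm (x n))\<^sup>2 = (\<Sum>j\<in>J n. 1 / real (Suc n))"
      unfolding x norm_ell2_fin[OF J(1)]
      by (intro sum.cong) (simp_all add: d power_divide del: of_nat_Suc)
    also have "\<dots> = 2 * (1 / real (Suc n))" by (simp add: J)
    finally show ?thesis by (metis norm_ge_zero real_sqrt_unique)
  qed
  moreover have "(\<lambda>n. sqrt (2 * (1 / real (Suc n)))) \<longlonglongrightarrow> sqrt (2 * 0)"
    by (intro tendsto_intros LIMSEQ_Suc[OF lim_1_over_n])
  ultimately have "(\<lambda>n. norm (x n)) \<longlonglongrightarrow> 0" by simp
  then show ?thesis by (rule tendsto_norm_zero_cancel)
qed

lemma symbol_at_bshift: "symbol_at t bshift (trig 1 t)"
  unfolding symbol_at_def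
proof (rule shift_error_LIMSEQ)
  fix n
  define s where "s = complex_of_real (1 / sqrt (Suc n))"
  have w: "ell2_coord (wave n t) i = (if n < i \<and> i \<le> 2 * n + 1 then s * trig (int i) t else 0)" for i
    by (auto simp: ell2_coord_wave s_def)
  \<comment> \<open>The support runs from \<open>n + 1\<close> to \<open>2 * n + 1\<close>: the
    shifted wave gains the place \<open>n\<close>, and the unshifted one is left alone at
    \<open>2 * n + 1\<close>.\<close>
  show "bshift \<bullet>\<^sub>v wave n t - trig 1 t *\<^sub>C wave n t = ell2_fin {n, 2 * n + 1}
      (\<lambda>j. if j = n then of_real (1 / sqrt (Suc n)) * trig (int n + 1) t
           else - of_real (1 / sqrt (Suc n)) * trig (2 * int n + 2) t)"
    unfolding s_def[symmetric]
  proof (rule ell2_eqI)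
    fix j
    have m: "trig 1 t * (s * trig (int j) t) = s * trig (int j + 1) t"
      by (simp add: mult.left_commute[of _ s] trig_mult add.commute)
    consider "j < n" | "j = n" | "n < j" "j < 2 * n + 1" | "j = 2 * n + 1" | "2 * n + 1 < j"
      by linarith
    then show "ell2_coord (bshift \<bullet>\<^sub>v wave n t - trig 1 t *\<^sub>C wave n t) j = ell2_coord (ell2_fin {n, 2 * n + 1}
        (\<lambda>j. if j = n then s * trig (int n + 1) t else - s * trig (2 * int n + 2) t)) j"
      by cases (auto simp: ell2_coord_fin minus_ell2.rep_eq scaleC_ell2.rep_eq w m trig_mult add.commute)
  qed
qed (auto simp: norm_mult norm_divide)

lemma symbol_at_fshift: "symbol_at t fshift (trig (- 1) t)"
  unfolding symbol_at_def
proof (rule shift_error_LIMSEQ)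
  fix n
  define s where "s = complex_of_real (1 / sqrt (Suc n))"
  have w: "ell2_coord (wave n t) i = (if n < i \<and> i \<le> 2 * n + 1 then s * trig (int i) t else 0)" for i
    by (auto simp: ell2_coord_wave s_def)
  show "fshift \<bullet>\<^sub>v wave n t - trig (- 1) t *\<^sub>C wave n t = ell2_fin {n + 1, 2 * n + 2}
      (\<lambda>j. if j = n + 1 then - of_real (1 / sqrt (Suc n)) * trig (int n) t
           else of_real (1 / sqrt (Suc n)) * trig (2 * int n + 1) t)"
    unfolding s_def[symmetric]
  proof (rule ell2_eqI)
    fix j
    have m: "trig (- 1) t * (s * trig (int j) t) = s * trig (int j - 1) t"
      by (simp add: mult.left_commute[of _ s] trig_mult)
    consider "j = 0" | "0 < j" "j < n + 1" | "j = n + 1" | "n + 1 < j" "j < 2 * n + 2"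
      | "j = 2 * n + 2" | "2 * n + 2 < j"
      by linarith
    then show "ell2_coord (fshift \<bullet>\<^sub>v wave n t - trig (- 1) t *\<^sub>C wave n t) j = ell2_coord (ell2_fin {n + 1, 2 * n + 2}
        (\<lambda>j. if j = n + 1 then - s * trig (int n) t else s * trig (2 * int n + 1) t)) j"
      by cases (auto simp: ell2_coord_fin minus_ell2.rep_eq scaleC_ell2.rep_eq w m trig_mult of_nat_diff add.commute)
  qed
qed (auto simp: norm_mult norm_divide)

section \<open>Calculation rules for the symbol at a point\<close>

lemma symbol_at_add:
  assumes "symbol_at t A c" "symbol_at t B d"
  shows "symbol_at t (A + B) (c + d)"
  using tendsto_add[OF assms[unfolded symbol_at_def]]
  by (simp add: symbol_at_def scaleC_ell2_add_left algebra_simps)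

lemma symbol_at_scaleC:
  assumes "symbol_at t A c"
  shows "symbol_at t (scaleC_op d A) (d * c)"
  using bounded_linear.tendsto[OF bounded_linear_scaleC_ell2[of d] assms[unfolded symbol_at_def]]
  by (simp add: symbol_at_def scaleC_ell2_diff_right scaleC_ell2_scaleC)

lemma symbol_at_one: "symbol_at t 1 1"
  by (simp add: symbol_at_def)

lemma symbol_at_zero: "symbol_at t 0 0"
  by (simp add: symbol_at_def)

lemma symbol_at_mult:
  assumes "symbol_at t A c" "symbol_at t B d"
  shows "symbol_at t (A * B) (c * d)"
proof -
  have "(\<lambda>n. A \<bullet>\<^sub>v (B \<bullet>\<^sub>v wave n t - d *\<^sub>C wave n t) + d *\<^sub>C (A \<bullet>\<^sub>v wave n t - c *\<^sub>C wave n t))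
      \<longlonglongrightarrow> A \<bullet>\<^sub>v 0 + d *\<^sub>C 0"
    by (intro tendsto_add tendsto_op_apply_right bounded_linear.tendsto[OF bounded_linear_scaleC_ell2]
        assms[unfolded symbol_at_def])
  then show ?thesis
    by (simp add: symbol_at_def scaleC_ell2_diff_right scaleC_ell2_scaleC mult.commute)
qed

lemma symbol_at_sum:
  "(\<And>i. i \<in> I \<Longrightarrow> symbol_at t (A i) (c i)) \<Longrightarrow> symbol_at t (\<Sum>i\<in>I. A i) (\<Sum>i\<in>I. c i)"
  by (induction I rule: infinite_finite_induct) (auto simp: symbol_at_zero symbol_at_add)

lemma symbol_at_power: "symbol_at t A c \<Longrightarrow> symbol_at t (A ^ n) (c ^ n)"
  by (induction n) (auto simp: symbol_at_one symbol_at_mult)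

lemma symbol_at_poly_op: "symbol_at t A c \<Longrightarrow> symbol_at t (poly_op p A) (poly p c)"
proof (induction p)
  case (pCons a p)
  have "symbol_at t (scaleC_op a 1 + A * poly_op p A) (a * 1 + c * poly p c)"
    using pCons by (intro symbol_at_add symbol_at_mult symbol_at_scaleC symbol_at_one)
  then show ?case by (simp add: poly_op_pCons)
qed (simp add: symbol_at_zero)

lemma symbol_at_shift: "symbol_at t (shift k) (trig k t)"
proof (cases "0 \<le> k")
  case True
  then show ?thesis
    using symbol_at_power[OF symbol_at_bshift, of t "nat k"] by (simp add: shift_def trig_power)
next
  case False
  then show ?thesis
    using symbol_at_power[OF symbol_at_fshift, of t "nat (- k)"] by (simp add: shift_def trig_power)
qed

lemma symbol_at_LIMSEQ:
  assumes S: "\<And>n. symbol_at t (S n) (c n)" and "S \<longlonglongrightarrow> A" and "c \<longlonglongrightarrow> d"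
  shows "symbol_at t A d"
  unfolding symbol_at_def
proof (rule LIMSEQ_I)
  fix e :: real assume "0 < e"
  then have "0 < e / 3" by simp
  obtain N1 where N1: "\<And>n. n \<ge> N1 \<Longrightarrow> norm (S n - A) < e / 3"
    using LIMSEQ_D[OF assms(2) \<open>0 < e / 3\<close>] by blast
  obtain N2 where N2: "\<And>n. n \<ge> N2 \<Longrightarrow> norm (c n - d) < e / 3"
    using LIMSEQ_D[OF assms(3) \<open>0 < e / 3\<close>] by blast
  define m where "m = max N1 N2"
  obtain N where N: "\<And>n. n \<ge> N \<Longrightarrow> norm (S m \<bullet>\<^sub>v wave n t - c m *\<^sub>C wave n t) < e / 3"
    using LIMSEQ_D[OF S[of m, unfolded symbol_at_def] \<open>0 < e / 3\<close>] by auto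
  have "norm (A \<bullet>\<^sub>v wave n t - d *\<^sub>C wave n t - 0) < e" if "n \<ge> N" for n
  proof -
    let ?v = "wave n t"
    have "A \<bullet>\<^sub>v ?v - d *\<^sub>C ?v
        = (S m \<bullet>\<^sub>v ?v - c m *\<^sub>C ?v) - (S m - A) \<bullet>\<^sub>v ?v + (c m - d) *\<^sub>C ?v"
      by (simp add: scaleC_ell2_diff_left)
    then have "norm (A \<bullet>\<^sub>v ?v - d *\<^sub>C ?v) \<le> norm (S m \<bullet>\<^sub>v ?v - c m *\<^sub>C ?v) + norm ((S m - A) \<bullet>\<^sub>v ?v)
        + norm ((c m - d) *\<^sub>C ?v)"
      by (smt (verit) norm_triangle_ineq norm_triangle_ineq4)
    also have "norm ((S m - A) \<bullet>\<^sub>v ?v) \<le> norm (S m - A)"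
      using norm_op_apply[of "S m - A" ?v] by simp
    also have "norm ((c m - d) *\<^sub>C ?v) = norm (c m - d)" by (simp add: norm_scaleC_ell2)
    finally show ?thesis using N[OF that] N1[of m] N2[of m] by (simp add: m_def)
  qed
  then show "\<exists>no. \<forall>n\<ge>no. norm (A \<bullet>\<^sub>v wave n t - d *\<^sub>C wave n t - 0) < e" by blast
qed

text \<open>Waves are unit vectors, so an approximate eigenvalue is bounded by the norm. This gives
  uniqueness of the symbol, and uniform convergence of symbols along norm convergent
  operators.\<close>

lemma norm_symbol_at_le:
  assumes "symbol_at t A c"
  shows "cmod c \<le> norm A"
proof (rule LIMSEQ_le)
  show "(\<lambda>n::nat. cmod c) \<longlonglongrightarrow> cmod c" by simp
  have "(\<lambda>n. norm A + norm (A \<bullet>\<^sub>v wave n t - c *\<^sub>C wave n t)) \<longlonglongrightarrow> norm A + norm (0::ell2)"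
    using assms unfolding symbol_at_def by (intro tendsto_intros)
  then show "(\<lambda>n. norm A + norm (A \<bullet>\<^sub>v wave n t - c *\<^sub>C wave n t)) \<longlonglongrightarrow> norm A" by simp
  have "cmod c \<le> norm A + norm (A \<bullet>\<^sub>v wave n t - c *\<^sub>C wave n t)" for n
  proof -
    have "cmod c = norm (c *\<^sub>C wave n t)" by (simp add: norm_scaleC_ell2)
    also have "\<dots> \<le> norm (A \<bullet>\<^sub>v wave n t) + norm (A \<bullet>\<^sub>v wave n t - c *\<^sub>C wave n t)"
      using norm_triangle_ineq4[of "A \<bullet>\<^sub>v wave n t" "A \<bullet>\<^sub>v wave n t - c *\<^sub>C wave n t"] by simp
    also have "norm (A \<bullet>\<^sub>v wave n t) \<le> norm A" using norm_op_apply[of A "wave n t"] by simp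
    finally show ?thesis by simp
  qed
  then show "\<exists>N. \<forall>n\<ge>N. cmod c \<le> norm A + norm (A \<bullet>\<^sub>v wave n t - c *\<^sub>C wave n t)" by blast
qed

lemma symbol_at_diff:
  assumes "symbol_at t A c" "symbol_at t B d"
  shows "symbol_at t (A - B) (c - d)"
  using symbol_at_add[OF assms(1) symbol_at_scaleC[OF assms(2), of "- 1"]]
  by (simp add: scaleC_op_minus_left)

lemma symbol_at_unique: "symbol_at t A c \<Longrightarrow> symbol_at t A d \<Longrightarrow> c = d"
  using norm_symbol_at_le[OF symbol_at_diff[of t A c A d]] by simp

text \<open>The quadratic form at the waves converges to \<open>c\<close>, and it is real and lies
  in the interval for every wave.\<close>

lemma symbol_at_between:
  assumes A: "op_between m M A" and c: "symbol_at t A c"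
  shows "c \<in> of_real ` {m..M}"
proof -
  let ?q = "\<lambda>n. cinner_ell2 (wave n t) (A \<bullet>\<^sub>v wave n t)"
  have sa: "selfadjoint_op A" using A by (simp add: op_between_def)
  have vv: "cinner_ell2 (wave n t) (wave n t) = 1" for n
    using norm_ell2_sq[of "wave n t"] by (simp add: cinner_ell2_self)
  have eq: "?q n - c = cinner_ell2 (wave n t) (A \<bullet>\<^sub>v wave n t - c *\<^sub>C wave n t)" for n
  proof -
    have "?q n = cinner_ell2 (wave n t) ((A \<bullet>\<^sub>v wave n t - c *\<^sub>C wave n t) + c *\<^sub>C wave n t)" by simp
    also have "\<dots> = cinner_ell2 (wave n t) (A \<bullet>\<^sub>v wave n t - c *\<^sub>C wave n t) + c"
      by (simp only: cinner_ell2_add_right cinner_ell2_scaleC_right vv mult_1_right)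
    finally show ?thesis by simp
  qed
  have "(\<lambda>n. ?q n - c) \<longlonglongrightarrow> 0"
  proof (rule Lim_null_comparison)
    show "\<forall>\<^sub>F n in sequentially. norm (?q n - c) \<le> norm (A \<bullet>\<^sub>v wave n t - c *\<^sub>C wave n t)"
      unfolding eq
      by (intro always_eventually allI order_trans[OF norm_cinner_ell2_le]) simp
    show "(\<lambda>n. norm (A \<bullet>\<^sub>v wave n t - c *\<^sub>C wave n t)) \<longlonglongrightarrow> 0"
      using c unfolding symbol_at_def by (rule tendsto_norm_zero)
  qed
  then have q: "?q \<longlonglongrightarrow> c" by (simp add: LIM_zero_iff)
  have "cnj (?q n) = ?q n" for n
    using sa cinner_ell2_commute[of "A \<bullet>\<^sub>v wave n t" "wave n t"] by (simp add: selfadjoint_op_def)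
  then have "Im (?q n) = 0" for n by (metis complex_cnj_cancel_iff Im_complex_of_real complex_eq_cancel_iff2 cnj.sel(2) equal_neg_zero)
  then have "(\<lambda>n. 0) \<longlonglongrightarrow> Im c" using tendsto_Im[OF q] by simp
  then have "Im c = 0" using LIMSEQ_unique tendsto_const by blast
  have re: "m \<le> Re (?q n)" "Re (?q n) \<le> M" for n
    using A unfolding op_between_def op_le_def
    by (auto simp: dot_square_norm dest!: spec[of _ "wave n t"] simp flip: inner_ell2_def)
  have "m \<le> Re c" by (rule LIMSEQ_le_const[OF tendsto_Re[OF q]]) (use re in auto)
  moreover have "Re c \<le> M" by (rule LIMSEQ_le_const2[OF tendsto_Re[OF q]]) (use re in auto)
  ultimately show ?thesis
    using \<open>Im c = 0\<close> by (intro image_eqI[of _ _ "Re c"]) (auto simp: complex_eq_iff)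
qed

lemma symbol_at_op_rfun:
  assumes A: "op_between m M A" and h: "continuous_on {m..M} h" and x: "symbol_at t A (of_real x)"
  shows "symbol_at t (op_rfun h A) (of_real (h x))"
proof -
  obtain p where p: "uniform_limit (of_real ` {m..M}) (\<lambda>n. poly (p n)) (\<lambda>z. of_real (h (Re z))) sequentially"
    "(\<lambda>n. poly_op (p n) A) \<longlonglongrightarrow> op_rfun h A" using op_rfunE[OF A h] .
  have "(\<lambda>n. poly (p n) (of_real x)) \<longlonglongrightarrow> of_real (h x)"
    using tendsto_uniform_limitI[OF p(1) symbol_at_between[OF A x]] by simp
  then show ?thesis
    by (rule symbol_at_LIMSEQ[OF symbol_at_poly_op[OF x] p(2)])
qed

text \<open>The waves tend weakly to 0: a row of a bounded operator is square summable, and the wave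
  meets only a segment of it that moves to infinity.\<close>

lemma entry_row_LIMSEQ:
  "(\<lambda>n. ell2_coord (K \<bullet>\<^sub>v wave n t) i) \<longlonglongrightarrow> 0"
proof -
  define b where "b j = ell2_coord (K \<bullet>\<^sub>v ell2_basis j) i" for j
  have row: "ell2_coord (K \<bullet>\<^sub>v ell2_fin J c) i = cinner_ell2 (ell2_fin J (\<lambda>j. cnj (b j))) (ell2_fin J c)"
    if "finite J" for J c
  proof -
    have "ell2_coord (K \<bullet>\<^sub>v ell2_fin J c) i = (\<Sum>j\<in>J. c j * b j)"
      by (simp add: ell2_fin_def op_apply_sum_right ell2_coord_sum scaleC_ell2.rep_eq b_def)
    also have "\<dots> = cinner_ell2 (ell2_fin J (\<lambda>j. cnj (b j))) (ell2_fin J c)"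
      unfolding cinner_ell2.rep_eq
      by (subst suminf_finite[where N = J]) (auto simp: that ell2_coord_fin mult.commute)
    finally show ?thesis .
  qed
  define s where "s J = (\<Sum>j\<in>J. (cmod (b j))\<^sup>2)" for J
  have norm_sq: "(norm (ell2_fin J (\<lambda>j. cnj (b j))))\<^sup>2 = s J" if "finite J" for J
    by (simp add: norm_ell2_fin[OF that] s_def)
  have norm_b: "norm (ell2_fin J (\<lambda>j. cnj (b j))) = sqrt (s J)" if "finite J" for J
    by (rule real_sqrt_unique[OF norm_sq[OF that], symmetric]) simp
  have coord_le: "cmod (ell2_coord x i) \<le> norm x" for x
    using norm_cinner_ell2_le[of "ell2_basis i" x] by (simp add: cinner_ell2_basis)
  \<comment> \<open>Apply \<open>K\<close> to the conjugate of a piece of its own row: coordinate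
    \<open>i\<close> of the result is the squared norm of that piece.\<close>
  have "s J \<le> (norm K)\<^sup>2" if J: "finite J" for J
  proof -
    let ?w = "ell2_fin J (\<lambda>j. cnj (b j))"
    have "(norm ?w)\<^sup>2 = cmod (cinner_ell2 ?w ?w)"
      by (simp only: cinner_ell2_self norm_ell2_sq[symmetric] norm_of_real) simp
    also have "\<dots> \<le> norm (K \<bullet>\<^sub>v ?w)" unfolding row[OF J, symmetric] by (rule coord_le)
    also have "\<dots> \<le> norm K * norm ?w" by (rule norm_op_apply)
    finally have "norm ?w * norm ?w \<le> norm K * norm ?w" by (simp only: power2_eq_square)
    then have "norm ?w \<le> norm K" by (cases "norm ?w = 0") simp_all
    then have "(norm ?w)\<^sup>2 \<le> (norm K)\<^sup>2" by (rule power_mono) simp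
    then show ?thesis by (simp only: norm_sq[OF J])
  qed
  then have "summable (\<lambda>j. (cmod (b j))\<^sup>2)"
    by (intro bounded_imp_summable[where B = "(norm K)\<^sup>2"]) (auto simp: s_def)
  then have conv: "(\<lambda>n. s {..<n}) \<longlonglongrightarrow> (\<Sum>j. (cmod (b j))\<^sup>2)"
    unfolding s_def by (rule summable_LIMSEQ)
  \<comment> \<open>The mass on the support is a difference of two partial sums of a convergent
    series.\<close>
  have "s {Suc n..<2 * Suc n} = s {..<2 * Suc n} - s {..<Suc n}" for n
    unfolding s_def using sum_diff[of "{..<2 * Suc n}" "{..<Suc n}" "\<lambda>j. (cmod (b j))\<^sup>2"]
    by (simp add: lessThan_minus_lessThan del: sum.lessThan_Suc)
  moreover have "(\<lambda>n. s {..<2 * Suc n} - s {..<Suc n}) \<longlonglongrightarrow> 0"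
  proof -
    have "(\<lambda>n. s {..<2 * Suc n}) \<longlonglongrightarrow> (\<Sum>j. (cmod (b j))\<^sup>2)"
      by (rule LIMSEQ_subseq_LIMSEQ[OF conv, unfolded o_def]) (auto simp: strict_mono_def)
    from tendsto_diff[OF this LIMSEQ_Suc[OF conv]] show ?thesis by simp
  qed
  ultimately have "(\<lambda>n. s {Suc n..<2 * Suc n}) \<longlonglongrightarrow> 0" by simp
  then have "(\<lambda>n. sqrt (s {Suc n..<2 * Suc n})) \<longlonglongrightarrow> sqrt 0" by (rule tendsto_real_sqrt)
  then have lim: "(\<lambda>n. sqrt (s {Suc n..<2 * Suc n})) \<longlonglongrightarrow> 0" by simp
  have "cmod (ell2_coord (K \<bullet>\<^sub>v wave n t) i) \<le> sqrt (s {Suc n..<2 * Suc n})" for n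
  proof -
    have "cmod (ell2_coord (K \<bullet>\<^sub>v wave n t) i)
        \<le> norm (ell2_fin {Suc n..<2 * Suc n} (\<lambda>j. cnj (b j))) * norm (wave n t)"
      unfolding wave_def by (subst row, simp) (rule norm_cinner_ell2_le)
    then show ?thesis by (simp add: norm_b)
  qed
  then show ?thesis
    by (intro Lim_null_comparison[OF _ lim] always_eventually allI)
qed

text \<open>A compact operator maps the weakly null waves to a norm null sequence: a subsequence
  staying away from 0 would have a limit point, all of whose coordinates vanish.\<close>

lemma symbol_at_compact_op:
  assumes "compact_op K"
  shows "symbol_at t K 0"
proof (rule ccontr)
  let ?x = "\<lambda>n. K \<bullet>\<^sub>v wave n t"
  assume "\<not> symbol_at t K 0"
  then have "\<not> ?x \<longlonglongrightarrow> 0" by (simp add: symbol_at_def)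
  then obtain e where e: "e > 0" "\<And>N. \<exists>n\<ge>N. norm (?x n) \<ge> e"
    unfolding LIMSEQ_iff by (auto simp: not_less)
  then have "infinite {n. norm (?x n) \<ge> e}" by (auto simp: infinite_nat_iff_unbounded_le)
  then obtain r where r: "strict_mono r" "\<And>n::nat. norm (?x (r n)) \<ge> e"
    using infinite_enumerate by blast
  have "compact (closure ((\<lambda>x. K \<bullet>\<^sub>v x) ` cball 0 1))" using assms by (simp add: compact_op_def)
  moreover have "?x (r n) \<in> closure ((\<lambda>x. K \<bullet>\<^sub>v x) ` cball 0 1)" for n
    by (rule subsetD[OF closure_subset]) auto
  ultimately obtain z q where z: "strict_mono q" "((\<lambda>n. ?x (r n)) \<circ> q) \<longlonglongrightarrow> z"
    unfolding compact_def by (metis (lifting))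
  have "ell2_coord z i = 0" for i
  proof (rule LIMSEQ_unique)
    show "(\<lambda>n. ell2_coord (?x (r (q n))) i) \<longlonglongrightarrow> ell2_coord z i"
      using bounded_linear.tendsto[OF ell2_coord_bounded_linear z(2)] by (simp add: o_def)
    show "(\<lambda>n. ell2_coord (?x (r (q n))) i) \<longlonglongrightarrow> 0"
      using LIMSEQ_subseq_LIMSEQ[OF entry_row_LIMSEQ strict_mono_o[OF r(1) z(1)], of K t i]
      by (simp add: o_def)
  qed
  then have "z = 0" by (intro ell2_eqI) (simp add: zero_ell2.rep_eq)
  then have "(\<lambda>n. norm (?x (r (q n)))) \<longlonglongrightarrow> 0"
    using tendsto_norm[OF z(2)] by (simp add: o_def)
  then have "e \<le> 0" by (rule LIMSEQ_le_const) (use r(2) in auto)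
  then show False using e(1) by simp
qed

lemma symbol_at_toeplitz: "a \<in> C2pi \<Longrightarrow> t \<in> {0..2 * pi} \<Longrightarrow> symbol_at t (toeplitz a) (a t)"
proof (induction rule: C2pi_induct)
  case (trig k)
  show ?case by (simp add: toeplitz_trig symbol_at_shift)
next
  case (add f g)
  then show ?case by (simp add: toeplitz_add symbol_at_add)
next
  case (scale f c)
  then show ?case by (simp add: toeplitz_scale symbol_at_scaleC)
next
  case (limit f a)
  show ?case
  proof (rule symbol_at_LIMSEQ)
    show "symbol_at t (toeplitz (f n)) (f n t)" for n using limit by blast
    show "(\<lambda>n. toeplitz (f n)) \<longlonglongrightarrow> toeplitz a" using limit by (intro toeplitz_LIMSEQ)
    show "(\<lambda>n. f n t) \<longlonglongrightarrow> a t" using limit by (intro tendsto_uniform_limitI)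
  qed
qed

lemma symbol_at_quasi_toeplitz:
  "a \<in> C2pi \<Longrightarrow> compact_op K \<Longrightarrow> t \<in> {0..2 * pi} \<Longrightarrow> symbol_at t (toeplitz a + K) (a t)"
  using symbol_at_add[OF symbol_at_toeplitz symbol_at_compact_op, of a t K] by simp

lemma symbol_at_posdef:
  assumes "posdef_op A" "symbol_at t A c"
  obtains x where "0 < x" "c = of_real x"
proof -
  obtain m M where "0 < m" "op_between m M A" using posdef_between[OF assms(1)] .
  then show ?thesis using symbol_at_between[OF _ assms(2)] that by fastforce
qed

lemma symbol_at_op_powr:
  assumes "posdef_op A" "symbol_at t A (of_real x)"
  shows "symbol_at t (op_powr A s) (of_real (x powr s))"
proof -
  obtain m M where m: "0 < m" and A: "op_between m M A" using posdef_between[OF assms(1)] .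
  show ?thesis
    unfolding op_powr_eq_op_rfun[OF A m]
    by (rule symbol_at_op_rfun[OF A continuous_on_powr_Icc[OF m] assms(2)])
qed

lemma symbol_at_op_log:
  assumes "posdef_op A" "symbol_at t A (of_real x)"
  shows "symbol_at t (op_log A) (of_real (ln x))"
proof -
  obtain m M where m: "0 < m" and A: "op_between m M A" using posdef_between[OF assms(1)] .
  have "continuous_on {m..M} ln" by (intro continuous_intros) (use m in auto)
  then show ?thesis
    unfolding op_log_eq_op_rfun[OF A m] by (rule symbol_at_op_rfun[OF A _ assms(2)])
qed


section \<open>The algebra of quasi-Toeplitz operators\<close>

lemma quasi_toeplitzE:
  assumes "A \<in> quasi_toeplitz"
  obtains a K where "a \<in> C2pi" "compact_op K" "A = toeplitz a + K"
  using assms by (auto simp: quasi_toeplitz_def)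

lemma quasi_toeplitzI: "a \<in> C2pi \<Longrightarrow> compact_op (A - toeplitz a) \<Longrightarrow> A \<in> quasi_toeplitz"
  unfolding quasi_toeplitz_def by (force intro: exI[of _ "A - toeplitz a"])

text \<open>Norm convergence of the sum says nothing directly about its two parts. The symbols are
  controlled by the norm, so they converge uniformly to some \<open>a\<close> and their Toeplitz
  operators in norm; the compact parts then converge as differences.\<close>

lemma quasi_toeplitz_LIMSEQ:
  assumes S: "\<And>n. S n \<in> quasi_toeplitz" and A: "S \<longlonglongrightarrow> A"
  shows "A \<in> quasi_toeplitz"
proof -
  have "\<exists>f. f \<in> C2pi \<and> compact_op (S n - toeplitz f)" for n
    using S[of n] by (force elim: quasi_toeplitzE)
  then obtain f where f: "\<And>n. f n \<in> C2pi" "\<And>n. compact_op (S n - toeplitz (f n))" by metis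
  have sym: "symbol_at t (S n) (f n t)" if "t \<in> {0..2 * pi}" for t n
    using symbol_at_quasi_toeplitz[OF f(1) f(2) that, of n n] by simp
  have "uniformly_convergent_on {0..2 * pi} f"
  proof (intro Cauchy_uniformly_convergent uniformly_Cauchy_onI)
    fix e :: real assume "0 < e"
    have "Cauchy S" using A LIMSEQ_imp_Cauchy by blast
    then obtain N where N: "\<And>m n. m \<ge> N \<Longrightarrow> n \<ge> N \<Longrightarrow> norm (S m - S n) < e"
      using CauchyD[OF _ \<open>0 < e\<close>] by blast
    have "dist (f m t) (f n t) < e" if "t \<in> {0..2 * pi}" "m \<ge> N" "n \<ge> N" for t m n
      using norm_symbol_at_le[OF symbol_at_diff[OF sym sym], of t m n] that N[of m n]
      by (simp add: dist_norm)
    then show "\<exists>M. \<forall>t\<in>{0..2 * pi}. \<forall>m\<ge>M. \<forall>n\<ge>M. dist (f m t) (f n t) < e" by blast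
  qed
  then obtain a where a: "uniform_limit {0..2 * pi} f a sequentially"
    by (auto simp: uniformly_convergent_on_def)
  have aC: "a \<in> C2pi" by (rule C2pi_uniform_limit[OF f(1) a])
  have "(\<lambda>n. S n - toeplitz (f n)) \<longlonglongrightarrow> A - toeplitz a"
    by (intro tendsto_diff A toeplitz_LIMSEQ f aC a)
  then have "compact_op (A - toeplitz a)" by (rule compact_op_LIMSEQ[OF f(2)])
  then show ?thesis using aC by (rule quasi_toeplitzI[rotated])
qed

lemma closed_op_algebra_quasi_toeplitz: "closed_op_algebra quasi_toeplitz"
proof
  show "1 \<in> quasi_toeplitz"
    by (rule quasi_toeplitzI[OF C2pi_const[of 1]]) (simp add: toeplitz_one)
next
  fix A B assume "A \<in> quasi_toeplitz" "B \<in> quasi_toeplitz"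
  then obtain a K b L where a: "a \<in> C2pi" "compact_op K" and A: "A = toeplitz a + K"
    and b: "b \<in> C2pi" "compact_op L" and B: "B = toeplitz b + L"
    by (elim quasi_toeplitzE) blast
  show "A + B \<in> quasi_toeplitz"
    by (rule quasi_toeplitzI[OF C2pi_add[OF a(1) b(1)]])
       (simp add: A B toeplitz_add a b compact_op_add)
  have "A * B - toeplitz (\<lambda>t. a t * b t)
      = (toeplitz a * toeplitz b - toeplitz (\<lambda>t. a t * b t)) + toeplitz a * L + K * B"
    by (simp add: A B algebra_simps)
  then have "compact_op (A * B - toeplitz (\<lambda>t. a t * b t))"
    by (simp only: compact_op_add compact_op_mult_left compact_op_mult_right toeplitz_mult a b)
  then show "A * B \<in> quasi_toeplitz"
    using C2pi_mult[OF a(1) b(1)] by (rule quasi_toeplitzI[rotated])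
next
  fix A c assume "A \<in> quasi_toeplitz"
  then obtain a K where a: "a \<in> C2pi" "compact_op K" and A: "A = toeplitz a + K"
    by (rule quasi_toeplitzE)
  show "scaleC_op c A \<in> quasi_toeplitz"
    by (rule quasi_toeplitzI[OF C2pi_scale[OF a(1), of c]])
       (simp add: A toeplitz_scale a compact_op_scaleC scaleC_op_add_right)
qed (rule quasi_toeplitz_LIMSEQ)

text \<open>On numbers the two factors \<open>x powr (- 1 / 2)\<close> combine to
  \<open>1 / x\<close>, and the equation says that \<open>ln x\<close> is the average of the
  \<open>ln (y i)\<close>. Positivity of the operators makes all these numbers positive
  reals.\<close>

lemma karcher_symbol:
  assumes p: "1 \<le> p"
    and A: "\<And>i. i \<in> {1..p} \<Longrightarrow> posdef_op (A i)"
    and sym: "\<And>i. i \<in> {1..p} \<Longrightarrow> symbol_at t (A i) (a i t)"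
    and X: "is_karcher_mean p A X" and g: "symbol_at t X c"
  shows "c = geo_mean_symbol p a t"
proof -
  have Xpd: "posdef_op X" using X by (simp add: is_karcher_mean_def)
  obtain x where x: "0 < x" "c = of_real x" using symbol_at_posdef[OF Xpd g] .
  have "\<exists>y. 0 < y \<and> a i t = of_real y" if "i \<in> {1..p}" for i
    using symbol_at_posdef[OF A[OF that] sym[OF that]] by blast
  then obtain y where y: "\<And>i. i \<in> {1..p} \<Longrightarrow> 0 < y i \<and> a i t = of_real (y i)" by metis
  let ?Hi = "op_powr X (- 1 / 2)"
  have Hi: "symbol_at t ?Hi (of_real (x powr (- 1 / 2)))"
    using symbol_at_op_powr[OF Xpd] g x by simp
  have "symbol_at t (op_log (?Hi * A i * ?Hi)) (of_real (ln (y i) - ln x))" if i: "i \<in> {1..p}" for i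
  proof -
    have "symbol_at t (?Hi * A i * ?Hi)
        (of_real (x powr (- 1 / 2)) * of_real (y i) * of_real (x powr (- 1 / 2)))"
      using sym[OF i] y[OF i] by (intro symbol_at_mult Hi) simp
    then have "symbol_at t (?Hi * A i * ?Hi) (of_real (x powr (- 1 / 2) * y i * x powr (- 1 / 2)))"
      by simp
    then have "symbol_at t (op_log (?Hi * A i * ?Hi))
        (of_real (ln (x powr (- 1 / 2) * y i * x powr (- 1 / 2))))"
      by (intro symbol_at_op_log posdef_congruence A[OF i] posdef_op_powr Xpd)
    moreover have "ln (x powr (- 1 / 2) * y i * x powr (- 1 / 2)) = ln (y i) - ln x"
      using x y[OF i] by (simp add: ln_mult ln_powr)
    ultimately show ?thesis by simp
  qed
  then have "symbol_at t (\<Sum>i=1..p. op_log (?Hi * A i * ?Hi)) (\<Sum>i=1..p. of_real (ln (y i) - ln x))"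
    by (rule symbol_at_sum)
  moreover have "(\<Sum>i=1..p. op_log (?Hi * A i * ?Hi)) = 0"
    using X by (simp add: is_karcher_mean_def)
  ultimately have "(\<Sum>i=1..p. complex_of_real (ln (y i) - ln x)) = 0"
    using symbol_at_unique symbol_at_zero by metis
  then have "(\<Sum>i=1..p. ln (y i) - ln x) = 0"
    by (simp only: of_real_sum[symmetric] of_real_eq_0_iff)
  then have "real p * ln x = (\<Sum>i=1..p. ln (y i))" by (simp add: sum_subtractf)
  also have "\<dots> = ln (\<Prod>i=1..p. y i)" by (rule ln_prod[symmetric]) (use y in fastforce)+
  finally have lnx: "ln x = 1 / real p * ln (\<Prod>i=1..p. y i)" using p by (simp add: field_simps)
  have pos: "(\<Prod>i=1..p. y i) > 0" by (rule prod_pos) (use y in blast)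
  have "x = exp (1 / real p * ln (\<Prod>i=1..p. y i))"
    unfolding lnx[symmetric] using x(1) by simp
  \<comment> \<open>Real \<open>powr\<close> has a separate value at base 0; \<open>pos\<close>
    selects the other branch of its definition.\<close>
  also have "\<dots> = (\<Prod>i=1..p. y i) powr (1 / real p)"
    unfolding powr_def by (rule if_not_P[symmetric]) (use pos in linarith)
  finally have xp: "x = (\<Prod>i=1..p. y i) powr (1 / real p)" .
  have "(\<Prod>i=1..p. a i t) = of_real (\<Prod>i=1..p. y i)" using y by (simp add: of_real_prod)
  then have "geo_mean_symbol p a t = of_real (\<Prod>i=1..p. y i) powr of_real (1 / real p)"
    by (simp add: geo_mean_symbol_def)
  also have "\<dots> = of_real x" using pos by (simp only: powr_of_real less_imp_le xp)
  finally show ?thesis using x by simp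
qed

theorem theorem21:
  fixes p :: nat
    and a :: "nat \<Rightarrow> real \<Rightarrow> complex"
    and K A :: "nat \<Rightarrow> ell2_op"
  assumes "p \<ge> 1"
    and "\<And>i. i \<in> {1..p} \<Longrightarrow> a i \<in> C2pi"
    and "\<And>i. i \<in> {1..p} \<Longrightarrow> compact_op (K i)"
    and "\<And>i. i \<in> {1..p} \<Longrightarrow> A i = toeplitz (a i) + K i"
    and "\<And>i. i \<in> {1..p} \<Longrightarrow> posdef_op (A i)"
  shows "(\<forall>i\<in>{1..p}. \<forall>t\<in>{0..2 * pi}. \<exists>r>0. a i t = complex_of_real r) \<and>
         (\<exists>!X. is_karcher_mean p A X) \<and>
         (\<forall>X. is_karcher_mean p A X \<longrightarrow>
              X \<in> quasi_toeplitz \<and>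
              geo_mean_symbol p a \<in> C2pi \<and>
              (\<exists>K\<^sub>G. compact_op K\<^sub>G \<and> X = toeplitz (geo_mean_symbol p a) + K\<^sub>G))"
proof -
  interpret closed_op_algebra quasi_toeplitz by (rule closed_op_algebra_quasi_toeplitz)
  interpret posdef_family quasi_toeplitz p A
    by unfold_locales (use assms in \<open>auto simp: quasi_toeplitz_def\<close>)
  have sym: "symbol_at t (A i) (a i t)" if "i \<in> {1..p}" "t \<in> {0..2 * pi}" for i t
    using symbol_at_quasi_toeplitz[OF assms(2,3)[OF that(1)] that(2)] assms(4)[OF that(1)] by simp
  have pos: "\<exists>r>0. a i t = complex_of_real r" if "i \<in> {1..p}" "t \<in> {0..2 * pi}" for i t
    using symbol_at_posdef[OF assms(5)[OF that(1)] sym[OF that]] by blast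
  have ex1: "\<exists>!X. is_karcher_mean p A X"
    using karcher_exists karcher_unique by blast
  have "X \<in> quasi_toeplitz \<and> geo_mean_symbol p a \<in> C2pi \<and>
      (\<exists>K\<^sub>G. compact_op K\<^sub>G \<and> X = toeplitz (geo_mean_symbol p a) + K\<^sub>G)"
    if X: "is_karcher_mean p A X" for X
  proof -
    \<comment> \<open>Existence holds inside the algebra and uniqueness among all operators, so an
      arbitrary solution is the one in the algebra.\<close>
    have XQ: "X \<in> quasi_toeplitz" using karcher_exists karcher_unique X by blast
    then obtain g L where g: "g \<in> C2pi" "compact_op L" "X = toeplitz g + L"
      by (rule quasi_toeplitzE)
    have eq: "g t = geo_mean_symbol p a t" if t: "t \<in> {0..2 * pi}" for t
      by (rule karcher_symbol[OF assms(1,5) sym X])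
         (use symbol_at_quasi_toeplitz[OF g(1,2) t] g(3) t in simp_all)
    \<comment> \<open>Continuity and periodicity are inherited from \<open>g\<close>, so the
      continuity of the principal power is not discussed.\<close>
    have "continuous_on {0..2 * pi} (geo_mean_symbol p a)"
      by (rule continuous_on_eq[OF C2pi_continuous[OF g(1)] eq])
    then have "geo_mean_symbol p a \<in> C2pi"
      using g(1) eq[of 0] eq[of "2 * pi"] by (simp add: C2pi_def)
    moreover have "toeplitz g = toeplitz (geo_mean_symbol p a)" by (rule toeplitz_cong) (rule eq)
    ultimately show ?thesis using XQ g by auto
  qed
  with pos ex1 show ?thesis by blast
qed

end
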